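(* Let $d,m\ge1$ be integers, let $1\le q<\infty$, and let $U\subseteq\mathbb{R}^m$ be open and bounded. Then the characteristic map $$\mathcal{E}_u:W^{1,q}(U,\mathrm{Norm}(d))\to W^{1,q}(U,\mathcal{A}_d(\mathbb{C})),\qquad A\mapsto\Lambda\circ A,$$ is continuous, where $W^{1,q}(U,\mathcal{A}_d(\mathbb{C}))$ carries the metric $\rho_\Delta^{1,q}(f,g)=\|\Delta\circ f-\Delta\circ g\|_{W^{1,q}(U,\mathbb{R}^N)}$ for an Almgren embedding $\Delta:\mathcal{A}_d(\mathbb{C})\to\mathbb{R}^N$.
   Context: $M_d(\mathbb{C})$ is the space of complex $d\times d$ matrices with the Frobenius norm $\|\cdot\|_2$, and $\mathrm{Norm}(d)=\{A\in M_d(\mathbb{C}):A^*A=AA^*\}$. $\mathcal{A}_d(\mathbb{C})$ is the set of unordered $d$-tuples $[z]=[z_1,\dots,z_d]$ of complex numbers (orbits of the permutation action of the symmetric group $S_d$ on $\mathbb{C}^d$) with the metric $\mathbf{d}_2([z],[w])=\min_{\sigma\in S_d}(\sum_i|z_i-w_{\sigma(i)}|^2)^{1/2}$. $\Lambda:\mathrm{Norm}(d)\to\mathcal{A}_d(\mathbb{C})$ sends $A$ to the unordered tuple of its eigenvalues with multiplicity. Almgren embedding: for a unit complex number $\theta$ put $\eta(z)=\mathrm{Re}(\theta z)$ and let $H:\mathcal{A}_d(\mathbb{C})\to\mathbb{R}^d$ send $[z]$ to the array of $\eta(z_1),\dots,\eta(z_d)$ arranged in increasing order. Choose a finite set $\{\eta_1,\dots,\eta_h\}$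 of such forms (given by unit complex numbers $\theta_1,\dots,\theta_h$) for which there is $\alpha>0$ such that for any $d^2$ complex numbers $z_1,\dots,z_{d^2}$ some $\eta_l$ satisfies $|\eta_l(z_k)|\ge\alpha|z_k|$ for all $k$ (such sets exist). With $H_l$ associated to $\eta_l$, $\Delta([z])=h^{-1/2}(H_1([z]),\dots,H_h([z]))\in\mathbb{R}^N$, $N=dh$, is an Almgren embedding; it is bi-Lipschitz onto its image with $\mathrm{Lip}(\Delta)\le1$. $W^{1,q}(U,\mathbb{R}^N)$ and $W^{1,q}(U,M_d(\mathbb{C}))$ carry the norm $\|f\|_{L^q}+\sum_{i}\|\partial_if\|_{L^q}$ (with $L^q$ norms of the pointwise Euclidean norm). $W^{1,q}(U,\mathcal{A}_d(\mathbb{C}))=\{f:U\to\mathcal{A}_d(\mathbb{C}):\Delta\circ f\in W^{1,q}(U,\mathbb{R}^N)\}$. $W^{1,q}(U,\mathrm{Norm}(d))$ is the set of $A\in W^{1,q}(U,M_d(\mathbb{C}))$ with values in $\mathrm{Norm}(d)$, with the topology induced from $W^{1,q}(U,M_d(\mathbb{C}))$. *)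

theory Defs
  imports
    "HOL-Analysis.Analysis"
    "HOL-Computational_Algebra.Computational_Algebra"
begin

text \<open>Partial derivatives are directional derivatives along the standard basis \<^term>\<open>Basis\<close>;
  for \<^typ>\<open>real ^ 'm\<close> these are the vectors \<^term>\<open>axis i (1::real)\<close>.\<close>

definition partial_deriv :: "'a::euclidean_space \<Rightarrow> ('a \<Rightarrow> real) \<Rightarrow> 'a \<Rightarrow> real" where
  "partial_deriv b \<phi> x = frechet_derivative \<phi> (at x) b"

fun C_k :: "nat \<Rightarrow> ('a::euclidean_space \<Rightarrow> real) \<Rightarrow> bool" where
  "C_k 0 \<phi> \<longleftrightarrow> continuous_on UNIV \<phi>"
| "C_k (Suc k) \<phi> \<longleftrightarrow>
     (\<forall>x. \<phi> differentiable (at x)) \<and> (\<forall>b\<in>Basis. C_k k (partial_deriv b \<phi>))"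

definition test_function :: "'a::euclidean_space set \<Rightarrow> ('a \<Rightarrow> real) \<Rightarrow> bool" where
  "test_function U \<phi> \<longleftrightarrow>
     (\<forall>k. C_k k \<phi>) \<and> compact (closure {x. \<phi> x \<noteq> 0}) \<and> closure {x. \<phi> x \<noteq> 0} \<subseteq> U"

definition locally_integrable :: "'a::euclidean_space set \<Rightarrow> ('a \<Rightarrow> 'b::euclidean_space) \<Rightarrow> bool" where
  "locally_integrable U f \<longleftrightarrow> (\<forall>K. compact K \<and> K \<subseteq> U \<longrightarrow> set_integrable lebesgue K f)"

definition is_weak_partial ::
  "'a::euclidean_space set \<Rightarrow> 'a \<Rightarrow> ('a \<Rightarrow> 'b::euclidean_space) \<Rightarrow> ('a \<Rightarrow> 'b) \<Rightarrow> bool" where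
  "is_weak_partial U b f g \<longleftrightarrow>
     locally_integrable U f \<and> locally_integrable U g \<and>
     (\<forall>\<phi>. test_function U \<phi> \<longrightarrow>
        (LINT x:U|lebesgue. partial_deriv b \<phi> x *\<^sub>R f x) = - (LINT x:U|lebesgue. \<phi> x *\<^sub>R g x))"

text \<open>A weak partial derivative is unique up to null sets, so the choice below does not
  affect the norm.\<close>

definition weak_partial ::
  "'a::euclidean_space set \<Rightarrow> 'a \<Rightarrow> ('a \<Rightarrow> 'b::euclidean_space) \<Rightarrow> 'a \<Rightarrow> 'b" where
  "weak_partial U b f = (SOME g. is_weak_partial U b f g)"

definition Lq_space :: "real \<Rightarrow> 'a::euclidean_space set \<Rightarrow> ('a \<Rightarrow> 'b::euclidean_space) set" where
  "Lq_space q U = {f. set_borel_measurable lebesgue U f \<and>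
                      set_integrable lebesgue U (\<lambda>x. norm (f x) powr q)}"

definition Lq_norm :: "real \<Rightarrow> 'a::euclidean_space set \<Rightarrow> ('a \<Rightarrow> 'b::euclidean_space) \<Rightarrow> real" where
  "Lq_norm q U f = (LINT x:U|lebesgue. norm (f x) powr q) powr (1 / q)"

text \<open>The elements are functions rather than almost-everywhere classes, so
  \<open>sobolev_norm\<close> is a seminorm that vanishes exactly on the functions that are zero almost
  everywhere on \<^term>\<open>U\<close>. Values outside \<^term>\<open>U\<close> are irrelevant.\<close>

definition sobolev :: "real \<Rightarrow> 'a::euclidean_space set \<Rightarrow> ('a \<Rightarrow> 'b::euclidean_space) set" where
  "sobolev q U = {f. f \<in> Lq_space q U \<and>
                     (\<forall>b\<in>Basis. \<exists>g\<in>Lq_space q U. is_weak_partial U b f g)}"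

definition sobolev_norm :: "real \<Rightarrow> 'a::euclidean_space set \<Rightarrow> ('a \<Rightarrow> 'b::euclidean_space) \<Rightarrow> real" where
  "sobolev_norm q U f = Lq_norm q U f + (\<Sum>b\<in>Basis. Lq_norm q U (weak_partial U b f))"

text \<open>The norm of \<^typ>\<open>complex ^ 'd ^ 'd\<close> is the Frobenius norm.\<close>

definition conj_transpose :: "complex ^ 'd ^ 'd \<Rightarrow> complex ^ 'd ^ 'd" where
  "conj_transpose A = (\<chi> i j. cnj (A $ j $ i))"

definition Norm_mat :: "(complex ^ 'd ^ 'd) set" where
  "Norm_mat = {A. conj_transpose A ** A = A ** conj_transpose A}"

definition charpoly :: "complex ^ 'd ^ 'd \<Rightarrow> complex poly" where
  "charpoly A = det (\<chi> i j. (if i = j then [:0, 1:] else 0) - [:A $ i $ j:])"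

text \<open>An unordered \<open>d\<close>-tuple is a multiset of size \<open>d\<close>.\<close>

definition unordered_tuples :: "nat \<Rightarrow> complex multiset set" where
  "unordered_tuples d = {M. size M = d}"

definition eigenvalues :: "complex ^ 'd ^ 'd \<Rightarrow> complex multiset" where
  "eigenvalues A = proots (charpoly A)"

definition almgren_family :: "nat \<Rightarrow> ('h \<Rightarrow> complex) \<Rightarrow> bool" where
  "almgren_family d \<theta> \<longleftrightarrow>
     (\<forall>l. cmod (\<theta> l) = 1) \<and>
     (\<exists>\<alpha>>0. \<forall>z :: nat \<Rightarrow> complex. \<exists>l. \<forall>k<d\<^sup>2. \<bar>Re (\<theta> l * z k)\<bar> \<ge> \<alpha> * cmod (z k))"

text \<open>For multisets of size \<^term>\<open>CARD('d)\<close>. The bijection \<^term>\<open>to_nat_on (UNIV :: 'd set)\<close>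
  from \<^typ>\<open>'d\<close> to \<^term>\<open>{..<CARD('d)}\<close> says which coordinate carries the k-th smallest
  value; a different numbering only permutes coordinates.\<close>

definition sorted_projection :: "complex \<Rightarrow> complex multiset \<Rightarrow> real ^ 'd" where
  "sorted_projection \<theta> M =
     (\<chi> i. sorted_list_of_multiset (image_mset (\<lambda>z. Re (\<theta> * z)) M) ! to_nat_on (UNIV :: 'd set) i)"

text \<open>The target \<^typ>\<open>real ^ 'd ^ 'h\<close> is Euclidean space of dimension
  \<^term>\<open>CARD('d) * CARD('h)\<close>.\<close>

definition almgren :: "('h \<Rightarrow> complex) \<Rightarrow> complex multiset \<Rightarrow> real ^ 'd ^ 'h" where
  "almgren \<theta> M = (\<chi> l. (1 / sqrt (real CARD('h))) *\<^sub>R sorted_projection (\<theta> l) M)"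

definition sobolev_Norm :: "real \<Rightarrow> 'a::euclidean_space set \<Rightarrow> ('a \<Rightarrow> complex ^ 'd ^ 'd) set" where
  "sobolev_Norm q U = {A \<in> sobolev q U. \<forall>x\<in>U. A x \<in> Norm_mat}"

definition sobolev_tuples ::
  "(complex multiset \<Rightarrow> real ^ 'd ^ 'h) \<Rightarrow> real \<Rightarrow> 'a::euclidean_space set \<Rightarrow>
   ('a \<Rightarrow> complex multiset) set" where
  "sobolev_tuples \<Delta> q U =
     {f. (\<forall>x\<in>U. f x \<in> unordered_tuples CARD('d)) \<and> \<Delta> \<circ> f \<in> sobolev q U}"

definition rho ::
  "(complex multiset \<Rightarrow> real ^ 'd ^ 'h) \<Rightarrow> real \<Rightarrow> 'a::euclidean_space set \<Rightarrow>
   ('a \<Rightarrow> complex multiset) \<Rightarrow> ('a \<Rightarrow> complex multiset) \<Rightarrow> real" where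
  "rho \<Delta> q U f g = sobolev_norm q U (\<lambda>x. \<Delta> (f x) - \<Delta> (g x))"

definition char_map :: "('a \<Rightarrow> complex ^ 'd ^ 'd) \<Rightarrow> 'a \<Rightarrow> complex multiset" where
  "char_map A = eigenvalues \<circ> A"

text \<open>Continuity of a map between (pseudo)metric spaces given by a carrier and a distance.
  It includes that the map lands in the target, and it forces points at distance 0 to be sent to
  points at distance 0; for Sobolev spaces of representatives it therefore amounts to
  well-definedness and continuity on almost-everywhere classes.\<close>

definition continuous_between ::
  "'a set \<Rightarrow> ('a \<Rightarrow> 'a \<Rightarrow> real) \<Rightarrow> 'b set \<Rightarrow> ('b \<Rightarrow> 'b \<Rightarrow> real) \<Rightarrow> ('a \<Rightarrow> 'b) \<Rightarrow> bool" where
  "continuous_between X dX Y dY F \<longleftrightarrow>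
     (\<forall>x\<in>X. F x \<in> Y) \<and>
     (\<forall>x\<in>X. \<forall>\<epsilon>>0. \<exists>\<delta>>0. \<forall>y\<in>X. dX x y < \<delta> \<longrightarrow> dY (F x) (F y) < \<epsilon>)"

end

theory Submission
  imports Defs
begin

text \<open>For normal \<open>A\<close> the numbers \<open>Re (\<theta> \<lambda>)\<close>, \<open>\<lambda>\<close> an eigenvalue of \<open>A\<close>, are the eigenvalues of the
  Hermitian part of \<open>\<theta> A\<close>. By Ky Fan's principle, minus the sum of the \<open>n\<close> smallest of them is a
  supremum of linear functionals of \<open>A\<close>, so every coordinate of \<open>\<Delta> \<circ> \<Lambda>\<close> is a difference of two
  convex Lipschitz functions defined on all matrices.

  Composition with a convex Lipschitz \<open>f\<close> is continuous on \<open>W\<^sup>1\<^sup>,\<^sup>q\<close>. The difference quotients of \<open>u\<close>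
  converge to its weak derivative \<open>g\<close> in \<open>L\<^sup>1\<close> on compact sets, so the right and the left difference
  quotients of \<open>f \<circ> u\<close> identify both \<open>f'(u; g)\<close> and \<open>- f'(u; - g)\<close> as weak derivatives of \<open>f \<circ> u\<close>.
  Hence the two agree almost everywhere. Since \<open>f'\<close> is jointly upper semicontinuous, it is continuous along
  sequences at such points, and a dominated convergence argument gives convergence of the derivatives
  in \<open>L\<^sup>q\<close>.\<close>

section \<open>Smooth bump functions\<close>

text \<open>The obstacle is that sorted eigenvalue data may fail to be differentiable where
  eigenvalues, or their projections, coincide, and a Sobolev map can take such values on a set of
  positive measure. Almost everywhere differentiability of the outer function is therefore of no
  help, and a Lipschitz bound controls only the size of the derivative of a composition, not its
  dependence on the inner map. One-sided directional derivatives exist everywhere for convex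
  functions, and the weak derivative turns out to point only in directions where the two sides
  agree. The extension to all matrices matters: convexity needs a linear domain, and the chain rule
  compares f at u(x + h b) with f at u(x) + h g(x), a matrix that need not be normal. The
  definitions integrate against \<open>lebesgue\<close>, while shifts and Fubini are carried out
  with Borel representatives over \<open>lborel\<close>; several lemmas exist only to pass between
  the two.\<close>

fun smooth1 :: "nat \<Rightarrow> (real \<Rightarrow> real) \<Rightarrow> bool" where
  "smooth1 0 f \<longleftrightarrow> continuous_on UNIV f"
| "smooth1 (Suc k) f \<longleftrightarrow> (\<exists>f'. (\<forall>x. (f has_real_derivative f' x) (at x)) \<and> smooth1 k f')"

lemma smooth1_Suc_imp: "smooth1 (Suc k) f \<Longrightarrow> smooth1 k f"
proof (induction k arbitrary: f)
  case 0
  then show ?case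
    by (auto simp: continuous_on_eq_continuous_at dest!: DERIV_isCont)
next
  case (Suc k)
  then show ?case by (metis smooth1.simps(2))
qed

lemma smooth1_add: "smooth1 k f \<Longrightarrow> smooth1 k g \<Longrightarrow> smooth1 k (\<lambda>x. f x + g x)"
proof (induction k arbitrary: f g)
  case 0
  then show ?case by (auto intro: continuous_intros)
next
  case (Suc k)
  then obtain f' g' where "\<And>x. (f has_real_derivative f' x) (at x)" "smooth1 k f'"
      "\<And>x. (g has_real_derivative g' x) (at x)" "smooth1 k g'" by auto
  with Suc.IH show ?case
    by (auto intro!: exI[of _ "\<lambda>x. f' x + g' x"] derivative_intros)
qed

lemma smooth1_mult: "smooth1 k f \<Longrightarrow> smooth1 k g \<Longrightarrow> smooth1 k (\<lambda>x. f x * g x)"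
proof (induction k arbitrary: f g)
  case 0
  then show ?case by (auto intro: continuous_intros)
next
  case (Suc k)
  then obtain f' g' where f: "\<And>x. (f has_real_derivative f' x) (at x)" "smooth1 k f'"
      and g: "\<And>x. (g has_real_derivative g' x) (at x)" "smooth1 k g'" by auto
  have "smooth1 k f" "smooth1 k g" using Suc.prems smooth1_Suc_imp by blast+
  with Suc.IH f g have "smooth1 k (\<lambda>x. f' x * g x + g' x * f x)"
    by (intro smooth1_add) auto
  then show ?case using f g
    by (auto intro!: exI[of _ "\<lambda>x. f' x * g x + g' x * f x"] derivative_eq_intros)
qed

lemma smooth1_const: "smooth1 k (\<lambda>x. c)"
  by (induction k arbitrary: c) (auto intro!: exI[of _ "\<lambda>x. 0"])

lemma smooth1_affine: "smooth1 k f \<Longrightarrow> smooth1 k (\<lambda>x. f (c * x + d))"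
proof (induction k arbitrary: f)
  case 0
  then have "continuous_on UNIV f" by simp
  then have "continuous_on UNIV (\<lambda>x. f (c * x + d))"
    by (rule continuous_on_compose2) (auto intro: continuous_intros)
  then show ?case by simp
next
  case (Suc k)
  then obtain f' where f: "\<And>x. (f has_real_derivative f' x) (at x)" "smooth1 k f'" by auto
  have "smooth1 k (\<lambda>x. f' (c * x + d) * c)"
    using Suc.IH[OF f(2)] by (intro smooth1_mult smooth1_const)
  moreover have "((\<lambda>x. f (c * x + d)) has_real_derivative f' (c * x + d) * c) (at x)" for x
    by (rule DERIV_chain2[OF f(1)]) (auto intro!: derivative_eq_intros)
  ultimately show ?case unfolding smooth1.simps by (intro exI[of _ "\<lambda>x. f' (c * x + d) * c"]) blast
qed

text \<open>The class of functions \<open>p(1/t) exp(-1/t)\<close>, extended by 0 to \<open>t \<le> 0\<close>, is closed under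
  differentiation.\<close>

definition flat :: "real poly \<Rightarrow> real \<Rightarrow> real" where
  "flat p t = (if t > 0 then poly p (1 / t) * exp (- (1 / t)) else 0)"

lemma poly_exp_tendsto_0: "((\<lambda>s::real. poly p s * exp (- s)) \<longlongrightarrow> 0) at_top"
proof -
  have "((\<lambda>s::real. \<Sum>i\<le>degree p. coeff p i * (s ^ i / exp s)) \<longlongrightarrow> (\<Sum>i\<le>degree p. coeff p i * 0)) at_top"
    by (intro tendsto_intros tendsto_power_div_exp_0)
  then show ?thesis
    by (simp add: poly_altdef exp_minus field_simps sum_distrib_left)
qed

text \<open>With s = 1/t the derivative of p(s) exp(-s) in t is s^2 (p(s) - p'(s)) exp(-s), and
  \<open>[:0, 0, 1:]\<close> is the factor s^2.\<close>

lemma flat_has_derivative: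
  "(flat p has_real_derivative flat ([:0, 0, 1:] * (p - pderiv p)) t) (at t)"
proof -
  consider "t < 0" | "t = 0" | "t > 0" by linarith
  then show ?thesis
  proof cases
    case 1
    have ev: "eventually (\<lambda>s. flat p s = 0) (nhds t)"
      by (rule eventually_mono[OF eventually_nhds_in_open[of "{..<0}" t]]) (use 1 in \<open>auto simp: flat_def\<close>)
    have "flat ([:0, 0, 1:] * (p - pderiv p)) t = 0" using 1 by (simp add: flat_def)
    then show ?thesis using DERIV_cong_ev[OF refl ev refl, of 0] by simp
  next
    case 3
    have ev: "eventually (\<lambda>s. flat p s = poly p (1 / s) * exp (- (1 / s))) (nhds t)"
      by (rule eventually_mono[OF eventually_nhds_in_open[of "{0<..}" t]]) (use 3 in \<open>auto simp: flat_def\<close>)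
    have "((\<lambda>s. poly p (1 / s) * exp (- (1 / s))) has_real_derivative
         (poly (pderiv p) (1 / t) * (- (1 / t\<^sup>2))) * exp (- (1 / t)) + 
          (exp (- (1 / t)) * (1 / t\<^sup>2)) * poly p (1 / t)) (at t)"
      using 3 by (intro DERIV_mult DERIV_chain2[OF poly_DERIV] DERIV_chain2[OF DERIV_exp])
        (auto intro!: derivative_eq_intros simp: power2_eq_square)
    also have "(poly (pderiv p) (1 / t) * (- (1 / t\<^sup>2))) * exp (- (1 / t)) + 
          (exp (- (1 / t)) * (1 / t\<^sup>2)) * poly p (1 / t) = flat ([:0, 0, 1:] * (p - pderiv p)) t"
      using 3 by (simp add: flat_def power2_eq_square field_simps)
    finally show ?thesis using DERIV_cong_ev[OF refl ev refl] by blast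
  next
    case 2
    have r: "((\<lambda>s. flat p s / s) \<longlongrightarrow> 0) (at_right 0)"
    proof -
      \<comment> \<open>Dividing by s turns p(1/s) into (1/s) p(1/s), which is
        \<open>pCons 0 p\<close> at 1/s, so the quotient is again a polynomial times the
        exponential.\<close>
      have "((\<lambda>s. poly (pCons 0 p) (inverse s) * exp (- (inverse s))) \<longlongrightarrow> 0) (at_right (0::real))"
        by (rule filterlim_compose[OF poly_exp_tendsto_0 filterlim_inverse_at_top_right])
      then show ?thesis
        by (rule Lim_transform_eventually)
          (auto simp: flat_def eventually_at_right_field field_simps intro!: exI[of _ 1])
    qed
    have l: "((\<lambda>s. flat p s / s) \<longlongrightarrow> 0) (at_left 0)"
      by (rule tendsto_eventually) (auto simp: flat_def eventually_at_left_field intro!: exI[of _ "-1"])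
    from l r have "((\<lambda>s. flat p s / s) \<longlongrightarrow> 0) (at 0)" by (rule filterlim_split_at)
    then show ?thesis using 2 by (simp add: DERIV_def flat_def)
  qed
qed

lemma smooth1_flat: "smooth1 k (flat p)"
proof (induction k arbitrary: p)
  case 0
  show ?case
    using DERIV_isCont[OF flat_has_derivative] by (simp add: continuous_on_eq_continuous_at)
next
  case (Suc k)
  then show ?case
    unfolding smooth1.simps using flat_has_derivative by blast
qed

text \<open>A partial derivative along \<open>b\<close> only replaces the factor \<open>F b\<close>
  by its derivative, so the product shape persists; hence the induction over \<open>k\<close> leaves
  \<open>F\<close> arbitrary.\<close>

lemma C_k_prod:
  fixes F :: "'a::euclidean_space \<Rightarrow> real \<Rightarrow> real"
  assumes "\<And>i k. i \<in> Basis \<Longrightarrow> smooth1 k (F i)"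
  shows "C_k k (\<lambda>x::'a. \<Prod>i\<in>Basis. F i (x \<bullet> i))"
  using assms
proof (induction k arbitrary: F)
  case 0
  show ?case
    unfolding C_k.simps
  proof (intro continuous_on_prod)
    fix i :: 'a assume "i \<in> Basis"
    from 0[OF this, of 0] have "continuous_on UNIV (F i)" by simp
    then show "continuous_on UNIV (\<lambda>x. F i (x \<bullet> i))"
      by (rule continuous_on_compose2) (auto intro: continuous_intros)
  qed
next
  case (Suc k)
  have "\<exists>f'. \<forall>i\<in>Basis. (\<forall>x. (F i has_real_derivative f' i x) (at x))"
  proof (rule bchoice, rule ballI)
    fix i :: 'a assume "i \<in> Basis"
    from Suc.prems[OF this, of "Suc 0"] show "\<exists>f'. \<forall>x. (F i has_real_derivative f' x) (at x)"
      by auto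
  qed
  then obtain f' where f': "\<And>i x. i \<in> Basis \<Longrightarrow> (F i has_real_derivative f' i x) (at x)" by blast
  \<comment> \<open>One \<open>f'\<close> is fixed before the order \<open>n\<close> varies;
    uniqueness of derivatives identifies the witness obtained at each order with it.\<close>
  have sm: "smooth1 n (f' i)" if i: "i \<in> Basis" for i n
  proof -
    obtain g where g: "\<And>x. (F i has_real_derivative g x) (at x)" "smooth1 n g"
      using Suc.prems[OF i, of "Suc n"] by auto
    have "g = f' i" by (rule ext) (rule DERIV_unique[OF g(1) f'[OF i]])
    with g show ?thesis by simp
  qed
  have der: "((\<lambda>x. \<Prod>i\<in>Basis. F i (x \<bullet> i)) has_derivative
      (\<lambda>y. \<Sum>i\<in>Basis. (f' i (x \<bullet> i) * (y \<bullet> i)) * (\<Prod>j\<in>Basis - {i}. F j (x \<bullet> j)))) (at x)" for x :: 'a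
  proof (rule has_derivative_prod)
    fix i :: 'a assume i: "i \<in> Basis"
    have "((\<lambda>x. x \<bullet> i) has_derivative (\<lambda>y. y \<bullet> i)) (at x)" by (auto intro!: derivative_eq_intros)
    from has_derivative_compose[OF this f'[OF i, unfolded has_field_derivative_def]]
    show "((\<lambda>x. F i (x \<bullet> i)) has_derivative (\<lambda>y. f' i (x \<bullet> i) * (y \<bullet> i))) (at x)" .
  qed
  have part: "partial_deriv b (\<lambda>x. \<Prod>i\<in>Basis. F i (x \<bullet> i)) =
      (\<lambda>x. \<Prod>i\<in>Basis. (if i = b then f' b else F i) (x \<bullet> i))" if b: "b \<in> Basis" for b :: 'a
  proof
    fix x :: 'a
    have "partial_deriv b (\<lambda>x. \<Prod>i\<in>Basis. F i (x \<bullet> i)) x =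
      (\<Sum>i\<in>Basis. (f' i (x \<bullet> i) * (b \<bullet> i)) * (\<Prod>j\<in>Basis - {i}. F j (x \<bullet> j)))"
      by (simp only: partial_deriv_def frechet_derivative_at[OF der, symmetric])
    also have "\<dots> = (\<Sum>i\<in>Basis. if i = b then f' b (x \<bullet> b) * (\<Prod>j\<in>Basis - {b}. F j (x \<bullet> j)) else 0)"
      using b by (intro sum.cong) (auto simp: inner_Basis)
    also have "\<dots> = f' b (x \<bullet> b) * (\<Prod>j\<in>Basis - {b}. F j (x \<bullet> j))"
      using b by simp
    also have "\<dots> = (\<Prod>i\<in>Basis. (if i = b then f' b else F i) (x \<bullet> i))"
      using b by (subst prod.remove[of _ b]) auto
    finally show "partial_deriv b (\<lambda>x. \<Prod>i\<in>Basis. F i (x \<bullet> i)) x = \<dots>" .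
  qed
  have "C_k k (\<lambda>x::'a. \<Prod>i\<in>Basis. (if i = b then f' b else F i) (x \<bullet> i))" if "b \<in> Basis" for b
    by (rule Suc.IH) (use sm[OF that] Suc.prems in \<open>simp split: if_split\<close>)
  then show ?case
    using der part by (simp add: differentiable_def) blast
qed

text \<open>\<open>flat 1 t\<close> is exp(-1/t) for t > 0 and tends to 1 as t grows. Stretching by
  \<open>Suc n\<close> therefore makes these bumps converge to the indicator of the open box, while
  their supports stay in the closed box.\<close>

definition bump :: "'a::euclidean_space \<Rightarrow> 'a \<Rightarrow> nat \<Rightarrow> 'a \<Rightarrow> real" where
  "bump a b n x = (\<Prod>i\<in>Basis. flat 1 (real (Suc n) * (x \<bullet> i - a \<bullet> i)) * flat 1 (real (Suc n) * (b \<bullet> i - x \<bullet> i)))"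

lemma flat_1_bounds: "0 \<le> flat 1 t" "flat 1 t \<le> 1"
  by (auto simp: flat_def)

lemma bump_bounds: "0 \<le> bump a b n x" "bump a b n x \<le> 1"
  unfolding bump_def
  by (auto intro!: prod_nonneg prod_le_1 mult_nonneg_nonneg mult_le_one flat_1_bounds)

lemma bump_eq_0:
  assumes "x \<notin> box a b"
  shows "bump a b n x = 0"
proof -
  from assms obtain i where "i \<in> Basis" "x \<bullet> i \<le> a \<bullet> i \<or> b \<bullet> i \<le> x \<bullet> i"
    by (auto simp: mem_box not_less)
  then show ?thesis
    unfolding bump_def by (intro prod_zero bexI[of _ i]) (auto simp: flat_def zero_less_mult_iff)
qed

lemma flat_1_tendsto:
  assumes "t > 0"
  shows "(\<lambda>n. flat 1 (real (Suc n) * t)) \<longlonglongrightarrow> 1"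
proof -
  have "(\<lambda>n. exp (- (inverse (real (Suc n)) * inverse t))) \<longlonglongrightarrow> exp (- (0 * inverse t))"
    by (intro tendsto_intros LIMSEQ_inverse_real_of_nat)
  moreover have "flat 1 (real (Suc n) * t) = exp (- (inverse (real (Suc n)) * inverse t))" for n
    using assms by (simp add: flat_def divide_simps del: of_nat_Suc)
  ultimately show ?thesis by simp
qed

lemma bump_tendsto: "(\<lambda>n. bump a b n x) \<longlonglongrightarrow> indicator (box a b) x"
proof (cases "x \<in> box a b")
  case True
  then have "(\<lambda>n. bump a b n x) \<longlonglongrightarrow> (\<Prod>i\<in>(Basis::'a set). 1 * 1)"
    unfolding bump_def by (intro tendsto_prod tendsto_mult flat_1_tendsto) (auto simp: mem_box)
  with True show ?thesis by simp
qed (simp add: bump_eq_0)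

lemma test_function_bump:
  assumes "cbox a b \<subseteq> U"
  shows "test_function U (bump a b n)"
proof -
  have "C_k k (bump a b n)" for k
    unfolding bump_def
  proof (rule C_k_prod)
    fix i k
    have "smooth1 k (\<lambda>t. flat 1 (real (Suc n) * t + (- real (Suc n) * (a \<bullet> i))) *
         flat 1 (- real (Suc n) * t + (real (Suc n) * (b \<bullet> i))))"
      by (intro smooth1_mult smooth1_affine smooth1_flat)
    then show "smooth1 k (\<lambda>t. flat 1 (real (Suc n) * (t - a \<bullet> i)) * flat 1 (real (Suc n) * (b \<bullet> i - t)))"
      by (simp add: algebra_simps)
  qed
  moreover have sub: "closure {x. bump a b n x \<noteq> 0} \<subseteq> cbox a b"
    using bump_eq_0 box_subset_cbox by (intro closure_minimal) blast+
  moreover have "compact (closure {x. bump a b n x \<noteq> 0})"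
    using bounded_subset[OF bounded_cbox sub] by (simp add: compact_eq_bounded_closed)
  ultimately show ?thesis using assms by (auto simp: test_function_def)
qed

section \<open>Uniqueness of weak derivatives\<close>

text \<open>Boxes are an intersection-stable generator of the Borel sets, and the sets over which
  \<open>w\<close> integrates to 0 are closed under complements and disjoint unions. A function with
  zero integral over every Borel set vanishes almost everywhere.\<close>

lemma AE_zero_if_box_integrals_zero:
  fixes w :: "'a::euclidean_space \<Rightarrow> 'b::euclidean_space"
  assumes int: "integrable lborel w"
    and box: "\<And>a b. (LINT x:box a b|lborel. w x) = 0"
  shows "AE x in lborel. w x = 0"
proof (rule sigma_finite_measure.density_zero[OF sigma_finite_lborel int])
  fix A :: "'a set" assume "A \<in> sets lborel"
  then have A: "A \<in> sigma_sets UNIV (range (\<lambda>(a, b). box a b))"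
    by (simp add: borel_eq_box)
  have sint: "set_integrable lborel S w" if "S \<in> sets borel" for S
    using int that unfolding set_integrable_def by (intro integrable_mult_indicator) auto
  have sets: "S \<in> sets borel" if "S \<in> sigma_sets UNIV (range (\<lambda>(a, b). box a b :: 'a set))" for S
    using that by (simp add: borel_eq_box)
  \<comment> \<open>Passing to complements needs the integral over the whole space, which is
    exhausted by an increasing sequence of boxes.\<close>
  have UNIV: "(LINT x:UNIV|lborel. w x) = 0"
  proof -
    let ?B = "\<lambda>n::nat. box (- (real n *\<^sub>R One)) (real n *\<^sub>R One) :: 'a set"
    have "(\<lambda>n. LINT x:?B n|lborel. w x) \<longlonglongrightarrow> (LINT x:(\<Union>n. ?B n)|lborel. w x)"
    proof (rule set_integral_cont_up)
      have "- (real n * v) < x \<and> x < real n * v" if "- (real m * v) < x" "x < real m * v" "m \<le> n" "0 \<le> v"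
        for m n :: nat and x v :: real
        using mult_right_mono[of "real m" "real n" v] that by linarith
      then show "incseq ?B" by (fastforce simp: incseq_def mem_box)
    qed (auto intro: sint)
    then show ?thesis
      unfolding UN_box_eq_UNIV by (simp add: box LIMSEQ_const_iff)
  qed
  have stable: "Int_stable (range (\<lambda>(a, b). box a b :: 'a set))"
    unfolding Int_stable_def by (force simp: box_Int_box)
  have "range (\<lambda>(a, b). box a b :: 'a set) \<subseteq> Pow UNIV" by simp
  with stable show "(LINT x:A|lborel. w x) = 0" using A
  proof (induction rule: sigma_sets_induct_disjoint)
    case (compl A)
    have "(LINT x:UNIV|lborel. w x) = (LINT x:A|lborel. w x) + (LINT x:UNIV - A|lborel. w x)"
      using sets[OF compl(1)] by (subst set_integral_Un[symmetric]) (auto intro: sint)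
    then show ?case using compl UNIV by simp
  next
    case (union A)
    have "(LINT x:(\<Union>i. A i)|lborel. w x) = (\<Sum>i. LINT x:A i|lborel. w x)"
      using union by (intro lebesgue_integral_countable_add) (auto intro!: sint sets sets.countable_UN simp: disjoint_family_on_def image_subset_iff)
    then show ?case using union by simp
  next
    case empty
    show ?case by (simp add: set_lebesgue_integral_def)
  qed (auto simp: box)
qed

text \<open>Provides the Borel representatives on which shifts and Fubini operate. The coordinates
  are corrected one by one, each on a null set, which reduces the claim to real-valued
  functions.\<close>

lemma integrable_lebesgue_ex_borel:
  fixes f :: "'a::euclidean_space \<Rightarrow> 'b::euclidean_space"
  assumes "integrable lebesgue f"
  obtains g where "integrable lborel g" "AE x in lebesgue. f x = g x"
proof -
  have "\<exists>h. h \<in> borel_measurable lborel \<and> (AE x in lborel. f x \<bullet> i = h x)" for i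
  proof -
    have "(\<lambda>x. f x \<bullet> i) \<in> borel_measurable lebesgue" using borel_measurable_integrable[OF assms] by simp
    then show ?thesis using completion_ex_borel_measurable_real by blast
  qed
  then have "\<exists>h. \<forall>i. h i \<in> borel_measurable lborel \<and> (AE x in lborel. f x \<bullet> i = h i x)"
    by (intro choice) blast
  then obtain h where h: "\<And>i. h i \<in> borel_measurable lborel"
      "\<And>i. AE x in lborel. f x \<bullet> i = h i x" by blast
  define g where "g x = (\<Sum>i\<in>Basis. h i x *\<^sub>R i)" for x
  have g: "g \<in> borel_measurable lborel" unfolding g_def using h(1) by measurable
  have "AE x in lborel. \<forall>i\<in>Basis. f x \<bullet> i = h i x"
    using h(2) by (intro AE_finite_allI) auto
  then have AE: "AE x in lebesgue. f x = g x"
  proof (intro AE_completion, eventually_elim)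
    case (elim x)
    show ?case by (rule euclidean_eqI) (simp add: g_def elim)
  qed
  have "g \<in> borel_measurable lebesgue" using g by (rule measurable_completion)
  from integrable_cong_AE_imp[OF assms this] AE have "integrable lebesgue g" by (simp add: eq_commute)
  then have "integrable lborel g" using integrable_completion[OF g] by simp
  with AE show ?thesis by (rule that[rotated])
qed

lemma test_function_cont:
  assumes "test_function U \<phi>"
  shows "continuous_on UNIV \<phi>"
  using assms C_k.simps(1) unfolding test_function_def by blast

lemma test_function_borel [measurable_dest]:
  assumes "test_function U \<phi>"
  shows "\<phi> \<in> borel_measurable borel"
  by (rule borel_measurable_continuous_onI[OF test_function_cont[OF assms]])

lemma test_function_eq_0: "x \<notin> closure {x. \<phi> x \<noteq> 0} \<Longrightarrow> \<phi> x = 0"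
  using closure_subset[of "{x. \<phi> x \<noteq> 0}"] by auto

lemma test_function_outside: "test_function U \<phi> \<Longrightarrow> x \<notin> U \<Longrightarrow> \<phi> x = 0"
  unfolding test_function_def using test_function_eq_0 by blast

lemma test_function_bounded:
  assumes "test_function U \<phi>"
  obtains M where "\<And>x. \<bar>\<phi> x\<bar> \<le> M" "M \<ge> 0"
proof -
  let ?K = "closure {x. \<phi> x \<noteq> 0}"
  have "compact (\<phi> ` ?K)"
    using assms test_function_cont[OF assms] unfolding test_function_def
    by (intro compact_continuous_image) (auto intro: continuous_on_subset)
  then obtain M where M: "\<And>x. x \<in> ?K \<Longrightarrow> \<bar>\<phi> x\<bar> \<le> M"
    using compact_imp_bounded bounded_iff by (metis image_eqI real_norm_def)
  have "\<bar>\<phi> x\<bar> \<le> max M 0" for x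
    using M[of x] test_function_eq_0[of x \<phi>] by fastforce
  then show ?thesis using that by (metis max.cobounded2)
qed

lemma test_function_mono: "test_function U \<phi> \<Longrightarrow> U \<subseteq> V \<Longrightarrow> test_function V \<phi>"
  unfolding test_function_def by blast

text \<open>Countability allows a statement proved almost everywhere on each box to be glued to one
  almost everywhere on \<open>U\<close>. The boxes have rational corners.\<close>

lemma countable_cbox_cover:
  fixes U :: "'a::euclidean_space set"
  assumes "open U"
  obtains D :: "('a \<times> 'a) set" where "countable D" "\<And>a b. (a, b) \<in> D \<Longrightarrow> cbox a b \<subseteq> U"
    "\<And>x. x \<in> U \<Longrightarrow> \<exists>(a, b)\<in>D. x \<in> cbox a b"
proof -
  define D where "D = (\<lambda>f :: 'a \<Rightarrow> real \<times> real. 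
        ((\<Sum>i\<in>Basis. fst (f i) *\<^sub>R i) :: 'a, (\<Sum>i\<in>Basis. snd (f i) *\<^sub>R i) :: 'a)) ` 
     {f\<in>Basis \<rightarrow>\<^sub>E \<rat> \<times> \<rat>. cbox (\<Sum>i\<in>Basis. fst (f i) *\<^sub>R i) (\<Sum>i\<in>Basis. snd (f i) *\<^sub>R i) \<subseteq> U}"
  have "countable D" unfolding D_def
    by (intro countable_image countable_Collect countable_PiE countable_SIGMA countable_rat) auto
  moreover have "U = (\<Union>(a, b)\<in>D. cbox a b)"
    using open_UNION_cbox[OF assms] by (simp add: D_def)
  ultimately show ?thesis using that[of D] by blast
qed

text \<open>The fundamental lemma of the calculus of variations. Bumps converge boundedly to
  indicators of boxes, so \<open>w\<close> has zero integral over every box inside a given closed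
  box in \<open>U\<close>; a countable cover by such closed boxes finishes.\<close>

lemma AE_zero_if_test_integrals_zero:
  fixes w :: "'a::euclidean_space \<Rightarrow> 'b::euclidean_space"
  assumes U: "open U" and w: "locally_integrable U w"
    and 0: "\<And>\<phi>. test_function U \<phi> \<Longrightarrow> (LINT x:U|lebesgue. \<phi> x *\<^sub>R w x) = 0"
  shows "AE x in lebesgue. x \<in> U \<longrightarrow> w x = 0"
proof -
  obtain D :: "('a \<times> 'a) set" where D: "countable D" "\<And>a b. (a, b) \<in> D \<Longrightarrow> cbox a b \<subseteq> U"
    "\<And>x. x \<in> U \<Longrightarrow> \<exists>(a, b)\<in>D. x \<in> cbox a b"
    using countable_cbox_cover[OF U] by metis
  have cbox: "AE x in lebesgue. x \<in> cbox a b \<longrightarrow> w x = 0" if "(a, b) \<in> D" for a b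
  proof -
    have ab: "cbox a b \<subseteq> U" by (rule D(2)[OF that])
    have "integrable lebesgue (\<lambda>x. indicator (cbox a b) x *\<^sub>R w x)"
      using w ab unfolding locally_integrable_def set_integrable_def by auto
    then obtain v where v: "integrable lborel v" "AE x in lebesgue. indicator (cbox a b) x *\<^sub>R w x = v x"
      by (rule integrable_lebesgue_ex_borel)
    note [measurable] = borel_measurable_integrable[OF v(1)]
    have int0: "(LINT x:box e f|lborel. v x) = 0" if "cbox e f \<subseteq> cbox a b" for e f
    proof -
      have "(\<lambda>n. LINT x|lborel. bump e f n x *\<^sub>R v x) \<longlonglongrightarrow> (LINT x|lborel. indicator (box e f) x *\<^sub>R v x)"
      proof (rule integral_dominated_convergence)
        show "integrable lborel (\<lambda>x. norm (v x))" using v(1) by simp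
        show "AE x in lborel. (\<lambda>n. bump e f n x *\<^sub>R v x) \<longlonglongrightarrow> indicator (box e f) x *\<^sub>R v x"
          by (auto intro!: tendsto_scaleR bump_tendsto)
        show "AE x in lborel. norm (bump e f n x *\<^sub>R v x) \<le> norm (v x)" for n
          by (auto simp: bump_bounds intro!: mult_left_le_one_le)
        have "bump e f n \<in> borel_measurable borel" for n
          using test_function_borel[OF test_function_bump[OF subset_UNIV]] .
        then show "(\<lambda>x. bump e f n x *\<^sub>R v x) \<in> borel_measurable lborel" for n by simp
      qed auto
      moreover have "(LINT x|lborel. bump e f n x *\<^sub>R v x) = 0" for n
      proof -
        have tf: "test_function U (bump e f n)" using that ab by (intro test_function_bump) auto
        note [measurable] = test_function_borel[OF tf]
        have m: "(\<lambda>x. bump e f n x *\<^sub>R v x) \<in> borel_measurable lborel" by simp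
        \<comment> \<open>Outside \<open>cbox a b\<close> the bump is 0, so the values of
          \<open>w\<close> on the rest of \<open>U\<close> do not enter.\<close>
        have eq: "indicator U x *\<^sub>R bump e f n x *\<^sub>R w x = bump e f n x *\<^sub>R (indicator (cbox a b) x *\<^sub>R w x)" for x
          using bump_eq_0[of x e f n] box_subset_cbox[of e f] that ab by (auto simp: indicator_def)
        have "(LINT x|lborel. bump e f n x *\<^sub>R v x) = (LINT x|lebesgue. bump e f n x *\<^sub>R v x)"
          using integral_completion[OF m] by simp
        also have "\<dots> = (LINT x:U|lebesgue. bump e f n x *\<^sub>R w x)"
          unfolding set_lebesgue_integral_def eq
        proof (rule integral_cong_AE)
          show "(\<lambda>x. bump e f n x *\<^sub>R v x) \<in> borel_measurable lebesgue" 
            using m by (rule measurable_completion)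
          have "bump e f n \<in> borel_measurable lebesgue" by (rule measurable_completion) simp
          moreover have "(\<lambda>x. indicator (cbox a b) x *\<^sub>R w x) \<in> borel_measurable lebesgue"
            using \<open>integrable lebesgue (\<lambda>x. indicator (cbox a b) x *\<^sub>R w x)\<close> by simp
          ultimately show "(\<lambda>x. bump e f n x *\<^sub>R (indicator (cbox a b) x *\<^sub>R w x)) \<in> borel_measurable lebesgue"
            by (rule borel_measurable_scaleR)
          show "AE x in lebesgue. bump e f n x *\<^sub>R v x = bump e f n x *\<^sub>R (indicator (cbox a b) x *\<^sub>R w x)"
            using v(2) by eventually_elim simp
        qed
        finally show ?thesis using 0[OF tf] by simp
      qed
      ultimately show ?thesis by (simp add: set_lebesgue_integral_def LIMSEQ_const_iff)
    qed
    have "AE x in lborel. indicator (box a b) x *\<^sub>R v x = 0"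
    proof (rule AE_zero_if_box_integrals_zero)
      show "integrable lborel (\<lambda>x. indicator (box a b) x *\<^sub>R v x)"
        using v(1) by (intro integrable_mult_indicator) auto
      fix c d :: 'a
      obtain e f where ef: "box c d \<inter> box a b = box e f" by (simp add: box_Int_box)
      have "(LINT x:box c d|lborel. indicator (box a b) x *\<^sub>R v x) = (LINT x:box e f|lborel. v x)"
        unfolding set_lebesgue_integral_def ef[symmetric]
        by (intro Bochner_Integration.integral_cong) (auto simp: indicator_def)
      also have "\<dots> = 0"
      \<comment> \<open>An empty open box can still have a nonempty degenerate closed box that
        leaves \<open>cbox a b\<close>, so an empty intersection is treated apart.\<close>
      proof (cases "box e f = {}")
        case False
        then have "cbox e f \<subseteq> cbox a b"
          using closure_mono[of "box e f" "box a b"] ef by (metis Int_lower2 closure_box closure_empty subset_empty)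
        then show ?thesis by (rule int0)
      qed (simp add: set_lebesgue_integral_def)
      finally show "(LINT x:box c d|lborel. indicator (box a b) x *\<^sub>R v x) = 0" .
    qed
    then have "AE x in lebesgue. indicator (box a b) x *\<^sub>R v x = 0" by (rule AE_completion)
    \<comment> \<open>Only the open box is reached so far; its boundary is a null set.\<close>
    moreover have "AE x in lebesgue. x \<notin> cbox a b - box a b"
      using negligible_frontier_interval[of a b] unfolding negligible_iff_null_sets by (rule AE_not_in)
    ultimately show ?thesis using v(2)
      by eventually_elim (auto simp: indicator_def split: if_splits)
  qed
  have "AE x in lebesgue. \<forall>p\<in>D. x \<in> cbox (fst p) (snd p) \<longrightarrow> w x = 0"
    using D(1) cbox by (subst AE_ball_countable) auto
  then show ?thesis
  proof eventually_elim
    case (elim x)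
    then show ?case using D(3)[of x] by (auto simp: split_beta)
  qed
qed

lemma integrable_test_locally:
  fixes k :: "'a::euclidean_space \<Rightarrow> 'b::euclidean_space"
  assumes \<phi>: "test_function U \<phi>" and k: "locally_integrable U k"
  shows "set_integrable lebesgue U (\<lambda>x. \<phi> x *\<^sub>R k x)"
proof -
  let ?K = "closure {x. \<phi> x \<noteq> 0}"
  have K: "set_integrable lebesgue ?K k"
    using \<phi> k by (auto simp: locally_integrable_def test_function_def)
  obtain M where M: "\<And>x. \<bar>\<phi> x\<bar> \<le> M" "M \<ge> 0" using test_function_bounded[OF \<phi>] by metis
  have [measurable]: "\<phi> \<in> borel_measurable lebesgue"
    using test_function_borel[OF \<phi>] by (intro measurable_completion) simp
  have [measurable]: "(\<lambda>x. indicator ?K x *\<^sub>R k x) \<in> borel_measurable lebesgue"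
    using K unfolding set_integrable_def by simp
  have eq: "indicator U x *\<^sub>R \<phi> x *\<^sub>R k x = \<phi> x *\<^sub>R (indicator ?K x *\<^sub>R k x)" for x
    using \<phi> test_function_eq_0[of x \<phi>] by (auto simp: indicator_def test_function_def)
  show ?thesis
    unfolding set_integrable_def eq
  proof (rule Bochner_Integration.integrable_bound)
    show "integrable lebesgue (\<lambda>x. M * norm (indicator ?K x *\<^sub>R k x))"
      by (intro integrable_mult_right integrable_norm K[unfolded set_integrable_def])
    show "AE x in lebesgue. norm (\<phi> x *\<^sub>R indicator ?K x *\<^sub>R k x) \<le> norm (M * norm (indicator ?K x *\<^sub>R k x))"
      using M by (auto simp: mult.assoc abs_mult intro!: mult_mono)
    show "(\<lambda>x. \<phi> x *\<^sub>R (indicator ?K x *\<^sub>R k x)) \<in> borel_measurable lebesgue" by measurable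
  qed
qed

lemma weak_partial_unique:
  fixes f :: "'a::euclidean_space \<Rightarrow> 'b::euclidean_space"
  assumes U: "open U" and g: "is_weak_partial U b f g" and h: "is_weak_partial U b f h"
  shows "AE x in lebesgue. x \<in> U \<longrightarrow> g x = h x"
proof -
  have loc: "locally_integrable U g" "locally_integrable U h"
    using g h by (auto simp: is_weak_partial_def)
  have "AE x in lebesgue. x \<in> U \<longrightarrow> g x - h x = 0"
  proof (rule AE_zero_if_test_integrals_zero[OF U])
    show "locally_integrable U (\<lambda>x. g x - h x)"
      using loc by (auto simp: locally_integrable_def intro!: set_integral_diff)
    fix \<phi> :: "'a \<Rightarrow> real" assume \<phi>: "test_function U \<phi>"
    show "(LINT x:U|lebesgue. \<phi> x *\<^sub>R (g x - h x)) = 0"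
      using g h \<phi> set_integral_diff(2)[OF integrable_test_locally[OF \<phi> loc(1)] integrable_test_locally[OF \<phi> loc(2)]]
      by (simp add: is_weak_partial_def scaleR_diff_right)
  qed
  then show ?thesis by simp
qed

section \<open>Translations\<close>

lemma
  fixes f :: "'a::euclidean_space \<Rightarrow> 'b::{banach, second_countable_topology}"
  assumes f: "integrable lborel f"
  shows integrable_lborel_translate: "integrable lborel (\<lambda>x. f (x + c))"
    and integral_lborel_translate: "(LINT x|lborel. f (x + c)) = (LINT x|lborel. f x)"
proof -
  have fd: "integrable (distr lborel borel ((+) c)) f"
    using f by (simp add: lborel_distr_plus)
  then show "integrable lborel (\<lambda>x. f (x + c))"
    by (subst (asm) integrable_distr_eq) (use f in \<open>auto simp: add.commute\<close>)
  have "(LINT x|lborel. f x) = (LINT x|distr lborel borel ((+) c). f x)"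
    by (simp add: lborel_distr_plus)
  also have "\<dots> = (LINT x|lborel. f (c + x))"
    by (rule integral_distr) (use f in auto)
  finally show "(LINT x|lborel. f (x + c)) = (LINT x|lborel. f x)"
    by (simp add: add.commute)
qed

definition L1_shift_continuous :: "('a::euclidean_space \<Rightarrow> 'b::{banach, second_countable_topology}) \<Rightarrow> bool" where
  "L1_shift_continuous g \<longleftrightarrow>
     (\<forall>e>0. \<exists>d>0. \<forall>s. norm s < d \<longrightarrow> (LINT x|lborel. norm (g (x + s) - g x)) < e)"

text \<open>The factor 2 in the majorant is the one supplied by the limit case of
  \<open>integrable_induct\<close>, which this lemma settles. It also serves to pass from bounded
  sets to sets of finite measure.\<close>

lemma L1_shift_continuous_lim:
  fixes f :: "'a::euclidean_space \<Rightarrow> 'b::{banach, second_countable_topology}"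
  assumes s: "\<And>i. integrable lborel (s i)" "\<And>i. L1_shift_continuous (s i)"
    and lim: "\<And>x. (\<lambda>i. s i x) \<longlonglongrightarrow> f x"
    and bound: "\<And>i x. norm (s i x) \<le> 2 * norm (f x)" and f: "integrable lborel f"
  shows "L1_shift_continuous f"
  unfolding L1_shift_continuous_def
proof safe
  fix e :: real assume "e > 0"
  have "(\<lambda>i. LINT x|lborel. norm (s i x - f x)) \<longlonglongrightarrow> (LINT x|(lborel :: 'a measure). 0)"
  proof (rule integral_dominated_convergence)
    show "integrable lborel (\<lambda>x. 3 * norm (f x))" using f by simp
    show "AE x in lborel. (\<lambda>i. norm (s i x - f x)) \<longlonglongrightarrow> 0"
      using lim by (auto intro!: tendsto_norm_zero simp: LIM_zero_iff)
    show "AE x in lborel. norm (norm (s i x - f x)) \<le> 3 * norm (f x)" for i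
      using bound norm_triangle_ineq4 by (auto intro!: AE_I2 order.trans[OF norm_triangle_ineq4])
    show "(\<lambda>x. norm (s i x - f x)) \<in> borel_measurable lborel" for i
      using s(1)[of i] f by simp
  qed auto
  then have "eventually (\<lambda>i. (LINT x|lborel. norm (s i x - f x)) < e / 3) sequentially"
    using \<open>e > 0\<close> by (intro order_tendstoD(2)) auto
  then obtain i where i: "(LINT x|lborel. norm (s i x - f x)) < e / 3"
    by (auto simp: eventually_sequentially)
  obtain d where d: "d > 0" "\<And>t. norm t < d \<Longrightarrow> (LINT x|lborel. norm (s i (x + t) - s i x)) < e / 3"
    using s(2)[of i] \<open>e > 0\<close> unfolding L1_shift_continuous_def by (metis divide_pos_pos zero_less_numeral)
  have "(LINT x|lborel. norm (f (x + t) - f x)) < e" if "norm t < d" for t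
  proof -
    note tr = integrable_lborel_translate[of _ t]
    have int: "integrable lborel (\<lambda>x. norm (s i x - f x))" using s(1) f by simp
    have "(LINT x|lborel. norm (f (x + t) - f x)) \<le>
       (LINT x|lborel. norm (s i (x + t) - f (x + t)) + norm (s i (x + t) - s i x) + norm (s i x - f x))"
    proof (rule integral_mono)
      show "norm (f (x + t) - f x) \<le> norm (s i (x + t) - f (x + t)) + norm (s i (x + t) - s i x) + norm (s i x - f x)" for x
        by norm
    qed (auto intro!: Bochner_Integration.integrable_add Bochner_Integration.integrable_diff integrable_norm tr s(1) f)
    also have "\<dots> = (LINT x|lborel. norm (s i (x + t) - f (x + t))) + (LINT x|lborel. norm (s i (x + t) - s i x))
        + (LINT x|lborel. norm (s i x - f x))"
      using tr[OF s(1)[of i]] tr[OF f] s(1)[of i] f by simp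
    also have "(LINT x|lborel. norm (s i (x + t) - f (x + t))) = (LINT x|lborel. norm (s i x - f x))"
      by (rule integral_lborel_translate[OF int])
    finally show ?thesis using i d(2)[OF that] by linarith
  qed
  then show "\<exists>d>0. \<forall>t. norm t < d \<longrightarrow> (LINT x|lborel. norm (f (x + t) - f x)) < e"
    using d(1) by blast
qed

text \<open>Sandwich \<open>A\<close> between a closed \<open>T\<close> and an open \<open>S\<close>
  up to small measure. \<open>T\<close> is compact as \<open>A\<close> is bounded, so all short
  shifts move \<open>T\<close> into \<open>S\<close>; hence the two indicators can differ only if x
  or x + t lies in the small set \<open>D\<close>.\<close>

lemma L1_shift_continuous_indicator:
  fixes c :: "'b::{banach, second_countable_topology}"
  assumes A: "A \<in> sets borel" and bnd: "bounded (A :: 'a::euclidean_space set)"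
  shows "L1_shift_continuous (\<lambda>x. indicator A x *\<^sub>R c)"
  unfolding L1_shift_continuous_def
proof safe
  fix e :: real assume "e > 0"
  \<comment> \<open>\<open>D\<close> has measure at most 2r and occurs twice, once shifted, which
    costs at most 4r times the norm of \<open>c\<close>; the summand 1 keeps the division legal for
    \<open>c = 0\<close>.\<close>
  define r where "r = e / 8 / (norm c + 1)"
  have r: "r > 0" unfolding r_def using \<open>e > 0\<close> by (intro divide_pos_pos) (auto simp: add_nonneg_pos)
  have AL: "A \<in> sets lebesgue" using A by simp
  obtain S where S: "open S" "A \<subseteq> S" "S - A \<in> lmeasurable" "emeasure lebesgue (S - A) < ennreal r"
    using sets_lebesgue_outer_open[OF AL r] by metis
  obtain T where T: "closed T" "T \<subseteq> A" "A - T \<in> lmeasurable" "emeasure lebesgue (A - T) < ennreal r"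
    using sets_lebesgue_inner_closed[OF AL r] by metis
  define D where "D = (S - A) \<union> (A - T)"
  have Dm: "D \<in> lmeasurable" "measure lebesgue D \<le> 2 * r"
  proof -
    show "D \<in> lmeasurable" unfolding D_def using S T by blast
    have "measure lebesgue D \<le> measure lebesgue (S - A) + measure lebesgue (A - T)"
      unfolding D_def using S(3) T(3) by (intro measure_Un_le) auto
    moreover have "measure lebesgue (S - A) < r" "measure lebesgue (A - T) < r"
      using S(3,4) T(3,4) r by (auto simp: emeasure_eq_measure2 ennreal_less_iff)
    ultimately show "measure lebesgue D \<le> 2 * r" by simp
  qed
  have Db: "D \<in> sets borel" unfolding D_def using S(1) T(1) A by auto
  have intD: "integrable lborel (indicator D :: 'a \<Rightarrow> real)"
    using Dm(1) Db by (simp add: fmeasurable_def)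
  have "compact T" using T(1,2) bnd bounded_subset compact_eq_bounded_closed by blast
  then obtain d where d: "d > 0" "(\<Union>x\<in>T. cball x d) \<subseteq> S"
    using compact_subset_open_imp_cball_epsilon_subset[of T S] S(1,2) T(2) by blast
  have "(LINT x|lborel. norm (indicator A (x + t) *\<^sub>R c - indicator A x *\<^sub>R c)) < e" if t: "norm t < d" for t
  proof -
    have TS: "x + t \<in> S" "x - t \<in> S" if "x \<in> T" for x
    proof -
      have "x + t \<in> cball x d" "x - t \<in> cball x d" using t by (auto simp: dist_norm)
      then show "x + t \<in> S" "x - t \<in> S" using d(2) that by blast+
    qed
    have pt: "norm (indicator A (x + t) *\<^sub>R c - indicator A x *\<^sub>R c) \<le> (indicator D x + indicator D (x + t)) * norm c" for x
    proof -
      have "indicator A (x + t) = (indicator A x :: real)" if "x \<notin> D" "x + t \<notin> D"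
        using that TS(1)[of x] TS(2)[of "x + t"] S(2) T(2) by (auto simp: D_def indicator_def)
      then show ?thesis by (auto simp: indicator_def)
    qed
    have "(LINT x|lborel. norm (indicator A (x + t) *\<^sub>R c - indicator A x *\<^sub>R c))
        \<le> (LINT x|lborel. (indicator D x + indicator D (x + t)) * norm c)"
      by (rule integral_mono') (use intD integrable_lborel_translate[OF intD, of t] pt in auto)
    also have "\<dots> = 2 * measure lborel D * norm c"
      using intD integrable_lborel_translate[OF intD, of t] integral_lborel_translate[OF intD, of t] Db by simp
    also have "\<dots> \<le> (4 * r) * norm c"
      using Dm(2) Db by (intro mult_right_mono) (auto simp: measure_completion)
    also have "\<dots> < 8 * r * (norm c + 1)"
    proof -
      have "r * norm c \<ge> 0" using r by simp
      then have "0 < r * 8 + r * (norm c * 4)" using r by linarith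
      then show ?thesis by (simp add: algebra_simps)
    qed
    also have "\<dots> = e"
    proof -
      have "8 * (e / 8 / k) * k = e" if "k \<noteq> 0" for k :: real using that by simp
      moreover have "norm c + 1 \<noteq> 0" using norm_ge_zero[of c] by linarith
      ultimately show ?thesis unfolding r_def by blast
    qed
    finally show ?thesis .
  qed
  then show "\<exists>d>0. \<forall>t. norm t < d \<longrightarrow> (LINT x|lborel. norm (indicator A (x + t) *\<^sub>R c - indicator A x *\<^sub>R c)) < e"
    using d(1) by blast
qed

lemma L1_shift_continuous:
  fixes g :: "'a::euclidean_space \<Rightarrow> 'b::{banach, second_countable_topology}"
  assumes "integrable lborel g"
  shows "L1_shift_continuous g"
  using assms
proof (induction rule: integrable_induct)
  case (base A c)
  show ?case
  \<comment> \<open>A set of finite measure may be unbounded; cutting it with balls reduces it to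
    the bounded case.\<close>
  proof (rule L1_shift_continuous_lim)
    have fin: "emeasure lborel (A \<inter> cball 0 (real i)) < \<infinity>" for i
      by (rule le_less_trans[OF emeasure_mono[of _ A]]) (use base in auto)
    show "integrable lborel (\<lambda>x. indicator (A \<inter> cball 0 (real i)) x *\<^sub>R c)" for i
      using base fin[of i] by (auto intro!: integrable_scaleR_left)
    show "L1_shift_continuous (\<lambda>x. indicator (A \<inter> cball 0 (real i)) x *\<^sub>R c)" for i
      by (rule L1_shift_continuous_indicator) (use base in auto)
    show "(\<lambda>i. indicator (A \<inter> cball 0 (real i)) x *\<^sub>R c) \<longlonglongrightarrow> indicator A x *\<^sub>R c" for x :: 'a
    proof (rule tendsto_eventually)
      obtain n :: nat where "norm x \<le> n" using real_arch_simple by blast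
      then show "\<forall>\<^sub>F i in sequentially. indicator (A \<inter> cball 0 (real i)) x *\<^sub>R c = indicator A x *\<^sub>R c"
        by (intro eventually_sequentiallyI[of n]) (auto simp: indicator_def)
    qed
    show "norm (indicator (A \<inter> cball 0 (real i)) x *\<^sub>R c) \<le> 2 * norm (indicator A x *\<^sub>R c)" for i x
      by (auto simp: indicator_def)
    show "integrable lborel (\<lambda>x. indicator A x *\<^sub>R c)" 
      using base by (auto intro!: integrable_scaleR_left)
  qed
next
  case (add f g)
  show ?case
    unfolding L1_shift_continuous_def
  proof safe
    fix e :: real assume "e > 0"
    then obtain d1 where d1: "d1 > 0" "\<And>t. norm t < d1 \<Longrightarrow> (LINT x|lborel. norm (f (x + t) - f x)) < e / 2"
      using add(3)[unfolded L1_shift_continuous_def, rule_format, of "e / 2"] by auto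
    from \<open>e > 0\<close> obtain d2 where d2: "d2 > 0" "\<And>t. norm t < d2 \<Longrightarrow> (LINT x|lborel. norm (g (x + t) - g x)) < e / 2"
      using add(4)[unfolded L1_shift_continuous_def, rule_format, of "e / 2"] by auto
    have "(LINT x|lborel. norm (f (x + t) + g (x + t) - (f x + g x))) < e" if "norm t < min d1 d2" for t
    proof -
      note tr = integrable_lborel_translate[of _ t]
      have "(LINT x|lborel. norm (f (x + t) + g (x + t) - (f x + g x))) \<le>
         (LINT x|lborel. norm (f (x + t) - f x) + norm (g (x + t) - g x))"
        by (intro integral_mono Bochner_Integration.integrable_add Bochner_Integration.integrable_diff integrable_norm tr add norm_diff_triangle_ineq)
      also have "\<dots> = (LINT x|lborel. norm (f (x + t) - f x)) + (LINT x|lborel. norm (g (x + t) - g x))"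
        by (intro Bochner_Integration.integral_add Bochner_Integration.integrable_diff integrable_norm tr add)
      finally show ?thesis using d1(2)[of t] d2(2)[of t] that by simp
    qed
    then show "\<exists>d>0. \<forall>t. norm t < d \<longrightarrow> (LINT x|lborel. norm (f (x + t) + g (x + t) - (f x + g x))) < e"
      using d1(1) d2(1) by (intro exI[of _ "min d1 d2"]) auto
  qed
next
  case (lim f s)
  show ?case by (rule L1_shift_continuous_lim[of s]) (use lim in auto)
qed

section \<open>Difference quotients of weakly differentiable functions\<close>

lemma test_function_has_derivative:
  assumes "test_function U \<phi>"
  shows "(\<phi> has_derivative frechet_derivative \<phi> (at x)) (at x)"
proof -
  have "C_k (Suc 0) \<phi>" using assms unfolding test_function_def by blast
  then have "\<phi> differentiable (at x)" by simp
  then show ?thesis by (simp add: frechet_derivative_works)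
qed

lemma test_function_line_derivative:
  assumes "test_function U \<phi>"
  shows "((\<lambda>t. \<phi> (x + t *\<^sub>R b)) has_real_derivative partial_deriv b \<phi> (x + t *\<^sub>R b)) (at t)"
proof -
  let ?D = "frechet_derivative \<phi> (at (x + t *\<^sub>R b))"
  have "((\<lambda>t. x + t *\<^sub>R b) has_derivative (\<lambda>s. s *\<^sub>R b)) (at t)"
    by (auto intro!: derivative_eq_intros)
  from has_derivative_compose[OF this test_function_has_derivative[OF assms]]
  have "((\<lambda>t. \<phi> (x + t *\<^sub>R b)) has_derivative (\<lambda>s. ?D (s *\<^sub>R b))) (at t)" .
  moreover have "?D (s *\<^sub>R b) = partial_deriv b \<phi> (x + t *\<^sub>R b) * s" for s
    using linear_cmul[OF has_derivative_linear[OF test_function_has_derivative[OF assms]]]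
    by (simp add: partial_deriv_def)
  ultimately show ?thesis by (simp add: has_field_derivative_def)
qed

lemma test_function_partial:
  assumes \<phi>: "test_function U \<phi>" and b: "b \<in> Basis"
  shows "test_function U (partial_deriv b \<phi>)"
proof -
  let ?K = "closure {x. \<phi> x \<noteq> 0}"
  have "C_k (Suc k) \<phi>" for k using \<phi> unfolding test_function_def by blast
  then have C: "C_k k (partial_deriv b \<phi>)" for k using b by simp
  have "partial_deriv b \<phi> x = 0" if "x \<notin> ?K" for x
  proof -
    have "(\<phi> has_derivative (\<lambda>_. 0)) (at x)"
    proof (rule has_derivative_transform_within_open)
      show "((\<lambda>_. 0) has_derivative (\<lambda>_. 0)) (at x)" by simp
      show "open (- ?K)" "x \<in> - ?K" using that by auto
      show "0 = \<phi> y" if "y \<in> - ?K" for y using that test_function_eq_0[of y \<phi>] by simp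
    qed
    then show ?thesis by (simp add: partial_deriv_def frechet_derivative_at[symmetric])
  qed
  then have sub: "closure {x. partial_deriv b \<phi> x \<noteq> 0} \<subseteq> ?K"
    by (intro closure_minimal) auto
  have K: "compact ?K" "?K \<subseteq> U" using \<phi> unfolding test_function_def by auto
  have "compact (closure {x. partial_deriv b \<phi> x \<noteq> 0})"
    using bounded_subset[OF compact_imp_bounded[OF K(1)] sub] by (simp add: compact_eq_bounded_closed)
  then show ?thesis
    using C sub K(2) unfolding test_function_def by auto
qed

lemma partial_deriv_shift:
  assumes "\<And>x. \<phi> differentiable (at x)"
  shows "partial_deriv b (\<lambda>x. \<phi> (x - c)) = (\<lambda>x. partial_deriv b \<phi> (x - c))"
proof
  fix x
  have "(\<phi> has_derivative frechet_derivative \<phi> (at (x - c))) (at (x - c))"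
    using assms frechet_derivative_works by blast
  moreover have "((\<lambda>x. x - c) has_derivative (\<lambda>y. y)) (at x)"
    by (auto intro!: derivative_eq_intros)
  ultimately have "((\<lambda>x. \<phi> (x - c)) has_derivative frechet_derivative \<phi> (at (x - c))) (at x)"
    using has_derivative_compose by fastforce
  then show "partial_deriv b (\<lambda>x. \<phi> (x - c)) x = partial_deriv b \<phi> (x - c)"
    by (simp add: partial_deriv_def frechet_derivative_at[symmetric])
qed

lemma C_k_shift: "C_k k \<phi> \<Longrightarrow> C_k k (\<lambda>x. \<phi> (x - c))"
proof (induction k arbitrary: \<phi>)
  case 0
  then have "continuous_on UNIV \<phi>" by simp
  then have "continuous_on UNIV (\<lambda>x. \<phi> (x - c))"
    by (rule continuous_on_compose2) (auto intro: continuous_intros)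
  then show ?case by simp
next
  case (Suc k)
  then have d: "\<And>x. \<phi> differentiable (at x)" by simp
  have "(\<lambda>x. \<phi> (x - c)) differentiable (at x)" for x
  proof -
    have "(\<lambda>x. x - c) differentiable (at x)" by (auto intro: derivative_intros)
    then have "(\<phi> \<circ> (\<lambda>x. x - c)) differentiable (at x)"
      using d by (rule differentiable_chain_at)
    then show ?thesis by (simp add: comp_def)
  qed
  with Suc show ?case by (simp add: partial_deriv_shift[OF d])
qed

lemma test_function_shift:
  assumes \<phi>: "test_function U \<phi>" and V: "\<And>x. x \<in> U \<Longrightarrow> x + c \<in> V"
  shows "test_function V (\<lambda>x. \<phi> (x - c))"
proof -
  let ?K = "closure {x. \<phi> x \<noteq> 0}"
  have "{x. \<phi> (x - c) \<noteq> 0} = (+) c ` {x. \<phi> x \<noteq> 0}"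
    by (auto simp: image_iff intro!: exI[of _ "_ - c"])
  then have "closure {x. \<phi> (x - c) \<noteq> 0} = (+) c ` ?K"
    by (simp add: closure_translation)
  moreover have "compact ((+) c ` ?K)"
    using \<phi> by (intro compact_translation) (auto simp: test_function_def)
  moreover have "(+) c ` ?K \<subseteq> V"
    using \<phi> V by (auto simp: test_function_def add.commute)
  moreover have "C_k k (\<lambda>x. \<phi> (x - c))" for k
    using \<phi> by (intro C_k_shift) (simp add: test_function_def)
  ultimately show ?thesis by (simp add: test_function_def)
qed

lemma integrable_test_scaleR:
  fixes w :: "'a::euclidean_space \<Rightarrow> 'b::euclidean_space"
  assumes \<phi>: "test_function U \<phi>" and w: "integrable lborel w"
  shows "integrable lborel (\<lambda>x. \<phi> x *\<^sub>R w x)"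
proof -
  obtain M where M: "\<And>x. \<bar>\<phi> x\<bar> \<le> M" "M \<ge> 0" using test_function_bounded[OF \<phi>] by metis
  show ?thesis
  proof (rule Bochner_Integration.integrable_bound)
    show "integrable lborel (\<lambda>x. M * norm (w x))" using w by simp
    show "(\<lambda>x. \<phi> x *\<^sub>R w x) \<in> borel_measurable lborel"
      using test_function_borel[OF \<phi>] w by simp
    show "AE x in lborel. norm (\<phi> x *\<^sub>R w x) \<le> norm (M * norm (w x))"
      using M by (auto simp: abs_mult intro!: mult_right_mono)
  qed
qed

text \<open>The shift is by -h, which produces the minus sign of integration by parts. The mean
  value theorem bounds the quotients by a bound of the partial derivative, and this gives the
  majorant. The sign of \<open>h n\<close> is left free because right and left quotients are both
  used later.\<close>

lemma test_difference_quotient_tendsto: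
  fixes w :: "'a::euclidean_space \<Rightarrow> 'b::euclidean_space"
  assumes \<phi>: "test_function U \<phi>" and b: "b \<in> Basis" and w: "integrable lborel w"
    and h: "h \<longlonglongrightarrow> 0" "\<And>n. h n \<noteq> 0"
  shows "(\<lambda>n. LINT x|lborel. ((\<phi> (x - h n *\<^sub>R b) - \<phi> x) / h n) *\<^sub>R w x)
           \<longlonglongrightarrow> - (LINT x|lborel. partial_deriv b \<phi> x *\<^sub>R w x)"
proof -
  note \<phi>' = test_function_partial[OF \<phi> b]
  obtain M where M: "\<And>x. \<bar>partial_deriv b \<phi> x\<bar> \<le> M" "M \<ge> 0"
    using test_function_bounded[OF \<phi>'] by metis
  have lip: "\<bar>\<phi> (x - t *\<^sub>R b) - \<phi> x\<bar> \<le> M * \<bar>t\<bar>" for x t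
  proof -
    have "norm (\<phi> (x + (- t) *\<^sub>R b) - \<phi> (x + 0 *\<^sub>R b)) \<le> M * norm (- t - 0)"
      by (rule field_differentiable_bound[of UNIV "\<lambda>t. \<phi> (x + t *\<^sub>R b)" "\<lambda>t. partial_deriv b \<phi> (x + t *\<^sub>R b)"])
        (use M test_function_line_derivative[OF \<phi>] in auto)
    then show ?thesis by simp
  qed
  have "(\<lambda>n. LINT x|lborel. ((\<phi> (x - h n *\<^sub>R b) - \<phi> x) / h n) *\<^sub>R w x)
           \<longlonglongrightarrow> (LINT x|lborel. - (partial_deriv b \<phi> x *\<^sub>R w x))"
  proof (rule integral_dominated_convergence)
    show "integrable lborel (\<lambda>x. M * norm (w x))" using w by simp
    have "\<phi> \<in> borel_measurable borel" by (rule test_function_borel[OF \<phi>])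
    then show "(\<lambda>x. ((\<phi> (x - h n *\<^sub>R b) - \<phi> x) / h n) *\<^sub>R w x) \<in> borel_measurable lborel" for n
      using w by measurable
    show "(\<lambda>x. - (partial_deriv b \<phi> x *\<^sub>R w x)) \<in> borel_measurable lborel"
      using test_function_borel[OF \<phi>'] w by measurable
    show "AE x in lborel. norm (((\<phi> (x - h n *\<^sub>R b) - \<phi> x) / h n) *\<^sub>R w x) \<le> M * norm (w x)" for n
    proof (rule AE_I2)
      fix x
      have "\<bar>(\<phi> (x - h n *\<^sub>R b) - \<phi> x) / h n\<bar> \<le> M"
        using lip[of x "h n"] h(2)[of n] by (simp add: divide_simps)
      then show "norm (((\<phi> (x - h n *\<^sub>R b) - \<phi> x) / h n) *\<^sub>R w x) \<le> M * norm (w x)"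
        unfolding norm_scaleR real_norm_def by (rule mult_right_mono) simp
    qed
    show "AE x in lborel. (\<lambda>n. ((\<phi> (x - h n *\<^sub>R b) - \<phi> x) / h n) *\<^sub>R w x)
        \<longlonglongrightarrow> - (partial_deriv b \<phi> x *\<^sub>R w x)"
    proof (rule AE_I2)
      fix x
      have "((\<lambda>t. (\<phi> (x + t *\<^sub>R b) - \<phi> x) / t) \<longlongrightarrow> partial_deriv b \<phi> x) (at 0)"
        using test_function_line_derivative[OF \<phi>, of x b 0] by (simp add: DERIV_def)
      moreover have "filterlim (\<lambda>n. - h n) (at 0) sequentially"
        using h tendsto_minus[OF h(1)] by (simp add: filterlim_at)
      ultimately have "(\<lambda>n. (\<phi> (x + (- h n) *\<^sub>R b) - \<phi> x) / (- h n)) \<longlonglongrightarrow> partial_deriv b \<phi> x"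
        by (rule filterlim_compose)
      then have "(\<lambda>n. (- ((\<phi> (x + (- h n) *\<^sub>R b) - \<phi> x) / (- h n))) *\<^sub>R w x) \<longlonglongrightarrow> (- partial_deriv b \<phi> x) *\<^sub>R w x"
        by (intro tendsto_scaleR tendsto_minus tendsto_const)
      then show "(\<lambda>n. ((\<phi> (x - h n *\<^sub>R b) - \<phi> x) / h n) *\<^sub>R w x) \<longlonglongrightarrow> - (partial_deriv b \<phi> x *\<^sub>R w x)"
        by simp
    qed
  qed
  then show ?thesis by simp
qed

lemma integral_test_shift:
  fixes w :: "'a::euclidean_space \<Rightarrow> 'b::euclidean_space"
  assumes \<phi>: "test_function U \<phi>" and w: "integrable lborel w"
  shows "(LINT x|lborel. \<phi> (x - c) *\<^sub>R w x) = (LINT x|lborel. \<phi> x *\<^sub>R w (x + c))"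
proof -
  have "integrable lborel (\<lambda>x. \<phi> (x - c) *\<^sub>R w x)"
    using integrable_test_scaleR[OF test_function_shift[OF \<phi>, of c UNIV] w] by simp
  from integral_lborel_translate[OF this, of c] show ?thesis by simp
qed

lemma locally_integrable_lborel:
  assumes "integrable lborel w"
  shows "locally_integrable U w"
  unfolding locally_integrable_def set_integrable_def
proof safe
  fix K :: "'a set" assume "compact K"
  have "integrable lebesgue w"
    using assms integrable_completion[OF borel_measurable_integrable[OF assms]] by simp
  then show "integrable lebesgue (\<lambda>x. indicat_real K x *\<^sub>R w x)"
    using \<open>compact K\<close> by (intro integrable_mult_indicator) (auto simp: compact_imp_closed)
qed

lemma integral_test_lebesgue:
  fixes w :: "'a::euclidean_space \<Rightarrow> 'b::euclidean_space"
  assumes \<phi>: "test_function U \<phi>" and w: "integrable lborel w"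
  shows "(LINT x:U|lebesgue. \<phi> x *\<^sub>R w x) = (LINT x|lborel. \<phi> x *\<^sub>R w x)"
proof -
  have "indicator U x *\<^sub>R \<phi> x *\<^sub>R w x = \<phi> x *\<^sub>R w x" for x
    using test_function_outside[OF \<phi>, of x] by (auto simp: indicator_def)
  then show ?thesis
    unfolding set_lebesgue_integral_def
    using integral_completion[OF borel_measurable_integrable[OF integrable_test_scaleR[OF \<phi> w]]]
    by (simp only:)
qed

text \<open>For t in \<open>{0..1}\<close> all slices have the same L1 norm by translation
  invariance, so averages of \<open>g\<close> along segments are accessible to Fubini.\<close>

lemma integrable_shift_average:
  fixes g :: "'a::euclidean_space \<Rightarrow> 'b::euclidean_space"
  assumes g: "integrable lborel g"
  shows "integrable (lborel \<Otimes>\<^sub>M lborel) (\<lambda>(t::real, x). indicator {0..1} t *\<^sub>R g (x + (t * h) *\<^sub>R b))"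
proof (rule lborel_pair.Fubini_integrable)
  have [measurable]: "g \<in> borel_measurable borel" using g by simp
  show "(\<lambda>(t::real, x). indicator {0..1} t *\<^sub>R g (x + (t * h) *\<^sub>R b)) \<in> borel_measurable (lborel \<Otimes>\<^sub>M lborel)"
    by measurable
  have "(LINT x|lborel. norm (indicator {0..1} t *\<^sub>R g (x + (t * h) *\<^sub>R b))) = indicator {0..1} t * (LINT x|lborel. norm (g x))" for t :: real
    using integral_lborel_translate[of "\<lambda>x. norm (g x)" "(t * h) *\<^sub>R b"] g by simp
  moreover have "integrable lborel (\<lambda>t::real. indicator {0..1} t * (LINT x|lborel. norm (g x)))"
    by (intro integrable_mult_left integrable_real_indicator) auto
  ultimately show "integrable lborel (\<lambda>t::real. LINT x|lborel. norm (case (t, x) of (t, x) \<Rightarrow> indicat_real {0..1} t *\<^sub>R g (x + (t * h) *\<^sub>R b)))"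
    by (simp only: prod.case)
  show "AE t::real in lborel. integrable lborel (\<lambda>x. case (t, x) of (t, x) \<Rightarrow> indicat_real {0..1} t *\<^sub>R g (x + (t * h) *\<^sub>R b))"
    using integrable_lborel_translate[OF g] by auto
qed

text \<open>Both sides are the increment over \<open>[0, h]\<close> of \<open>t \<mapsto> \<integral> \<phi>(x - t b) u(x) dx\<close>, a differentiable
  function because the difference quotients fall on \<open>\<phi>\<close>.\<close>

lemma weak_increment:
  fixes u g :: "'a::euclidean_space \<Rightarrow> 'b::euclidean_space"
  assumes b: "b \<in> Basis" and u: "integrable lborel u" and g: "integrable lborel g"
    and weak: "\<And>\<phi>. test_function W \<phi> \<Longrightarrow>
      (LINT x|lborel. partial_deriv b \<phi> x *\<^sub>R u x) = - (LINT x|lborel. \<phi> x *\<^sub>R g x)"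
    and W': "\<And>x t. x \<in> W' \<Longrightarrow> \<bar>t\<bar> \<le> \<bar>h\<bar> \<Longrightarrow> x + t *\<^sub>R b \<in> W"
    and \<phi>: "test_function W' \<phi>"
  shows "(LINT x|lborel. \<phi> x *\<^sub>R (u (x + h *\<^sub>R b) - u x)) =
     (LINT x|lborel. \<phi> x *\<^sub>R h *\<^sub>R (LINT t|lborel. indicator {0..1} t *\<^sub>R g (x + (t * h) *\<^sub>R b)))"
proof -
  define \<Phi> where "\<Phi> t = (LINT x|lborel. \<phi> (x - t *\<^sub>R b) *\<^sub>R u x)" for t
  define \<Psi> where "\<Psi> t = (LINT x|lborel. \<phi> x *\<^sub>R g (x + t *\<^sub>R b))" for t
  have der: "(\<Phi> has_vector_derivative \<Psi> t) (at t)" if "\<bar>t\<bar> \<le> \<bar>h\<bar>" for t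
  proof -
    \<comment> \<open>The margin between \<open>W'\<close> and \<open>W\<close> keeps the shifted
      test function inside the set where the weak identity is known.\<close>
    have \<phi>t: "test_function W (\<lambda>x. \<phi> (x - t *\<^sub>R b))"
      by (rule test_function_shift[OF \<phi>]) (use W' that in auto)
    have "((\<lambda>s. (\<Phi> (t + s) - \<Phi> t) /\<^sub>R s) \<longlongrightarrow> \<Psi> t) (at 0)"
    proof (subst tendsto_at_iff_sequentially, safe)
      fix s :: "nat \<Rightarrow> real" assume s: "\<forall>i. s i \<in> UNIV - {0}" "s \<longlonglongrightarrow> 0"
      have lim: "(\<lambda>n. LINT x|lborel. ((\<phi> (x - s n *\<^sub>R b - t *\<^sub>R b) - \<phi> (x - t *\<^sub>R b)) / s n) *\<^sub>R u x)
           \<longlonglongrightarrow> - (LINT x|lborel. partial_deriv b (\<lambda>x. \<phi> (x - t *\<^sub>R b)) x *\<^sub>R u x)"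
        using s by (intro test_difference_quotient_tendsto[OF \<phi>t b u]) auto
      have rhs: "- (LINT x|lborel. partial_deriv b (\<lambda>x. \<phi> (x - t *\<^sub>R b)) x *\<^sub>R u x) = \<Psi> t"
        unfolding weak[OF \<phi>t] \<Psi>_def using integral_test_shift[OF \<phi> g] by simp
      have lhs: "(LINT x|lborel. ((\<phi> (x - s n *\<^sub>R b - t *\<^sub>R b) - \<phi> (x - t *\<^sub>R b)) / s n) *\<^sub>R u x) =
          (\<Phi> (t + s n) - \<Phi> t) /\<^sub>R s n" for n
      proof -
        have i: "integrable lborel (\<lambda>x. \<phi> (x - c) *\<^sub>R u x)" for c
          using integrable_test_scaleR[OF test_function_shift[OF \<phi>, of c UNIV] u] by simp
        have "(LINT x|lborel. ((\<phi> (x - s n *\<^sub>R b - t *\<^sub>R b) - \<phi> (x - t *\<^sub>R b)) / s n) *\<^sub>R u x) =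
          (LINT x|lborel. (1 / s n) *\<^sub>R (\<phi> (x - (t + s n) *\<^sub>R b) *\<^sub>R u x - \<phi> (x - t *\<^sub>R b) *\<^sub>R u x))"
          by (intro Bochner_Integration.integral_cong) (auto simp: algebra_simps diff_divide_distrib)
        also have "\<dots> = (\<Phi> (t + s n) - \<Phi> t) /\<^sub>R s n"
          unfolding \<Phi>_def using i by (simp add: divide_inverse)
        finally show ?thesis .
      qed
      show "((\<lambda>s. (\<Phi> (t + s) - \<Phi> t) /\<^sub>R s) \<circ> s) \<longlonglongrightarrow> \<Psi> t"
        using lim unfolding rhs lhs comp_def .
    qed
    then have "((\<lambda>s. norm ((\<Phi> (t + s) - \<Phi> t) /\<^sub>R s - \<Psi> t)) \<longlongrightarrow> 0) (at 0)"
      by (intro tendsto_norm_zero) (simp add: LIM_zero_iff)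
    then have "((\<lambda>s. norm (\<Phi> (t + s) - \<Phi> t - s *\<^sub>R \<Psi> t) / norm s) \<longlongrightarrow> 0) (at 0)"
    proof (rule Lim_transform_eventually)
      have "norm ((\<Phi> (t + s) - \<Phi> t) /\<^sub>R s - \<Psi> t) = norm (\<Phi> (t + s) - \<Phi> t - s *\<^sub>R \<Psi> t) / norm s" if "s \<noteq> 0" for s
      proof -
        have "(\<Phi> (t + s) - \<Phi> t) /\<^sub>R s - \<Psi> t = (\<Phi> (t + s) - \<Phi> t - s *\<^sub>R \<Psi> t) /\<^sub>R s"
          using that by (simp add: scaleR_diff_right)
        then show ?thesis by (simp add: divide_inverse mult.commute)
      qed
      then show "\<forall>\<^sub>F s in at 0. norm ((\<Phi> (t + s) - \<Phi> t) /\<^sub>R s - \<Psi> t) = norm (\<Phi> (t + s) - \<Phi> t - s *\<^sub>R \<Psi> t) / norm s"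
        by (auto simp: eventually_at_filter)
    qed
    then show ?thesis
      unfolding has_vector_derivative_def has_derivative_at by (simp add: bounded_linear_scaleR_left)
  qed
  \<comment> \<open>The parameter runs over \<open>{0..1}\<close> with the point t * h, instead of
    over the interval from 0 to h, so that negative \<open>h\<close> needs no separate
    treatment.\<close>
  have hi: "((\<lambda>t. h *\<^sub>R \<Psi> (t * h)) has_integral (\<Phi> (1 * h) - \<Phi> (0 * h))) {0..1}"
  proof (rule fundamental_theorem_of_calculus)
    fix t :: real assume t: "t \<in> {0..1}"
    have "\<bar>t * h\<bar> \<le> \<bar>h\<bar>" using t by (auto simp: abs_mult intro: mult_left_le_one_le)
    from der[OF this] have "(\<Phi> has_vector_derivative \<Psi> (t * h)) (at (t * h))" .
    moreover have "((\<lambda>t. t * h) has_vector_derivative h) (at t within {0..1})"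
      by (auto intro!: derivative_eq_intros simp: has_real_derivative_iff_has_vector_derivative[symmetric])
    ultimately have "(\<Phi> \<circ> (\<lambda>t. t * h) has_vector_derivative h *\<^sub>R \<Psi> (t * h)) (at t within {0..1})"
      by (rule vector_diff_chain_within[OF _ has_vector_derivative_at_within, rotated])
    then show "((\<lambda>t. \<Phi> (t * h)) has_vector_derivative h *\<^sub>R \<Psi> (t * h)) (at t within {0..1})"
      by (simp add: comp_def)
  qed simp
  have ftc: "integral {0..1} (\<lambda>t. h *\<^sub>R \<Psi> (t * h)) = \<Phi> h - \<Phi> 0"
    using integral_unique[OF hi] by (simp only: mult_1 mult_zero_left)
  let ?F = "\<lambda>t x. indicat_real {0..1} t *\<^sub>R \<phi> x *\<^sub>R g (x + (t * h) *\<^sub>R b)"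
  have intF: "integrable (lborel \<Otimes>\<^sub>M lborel) (case_prod ?F)"
  proof -
    obtain M where M: "\<And>x. \<bar>\<phi> x\<bar> \<le> M" "M \<ge> 0" using test_function_bounded[OF \<phi>] by metis
    note [measurable] = test_function_borel[OF \<phi>] 
    have [measurable]: "g \<in> borel_measurable borel" using g by simp
    show ?thesis
    proof (rule Bochner_Integration.integrable_bound)
      show "integrable (lborel \<Otimes>\<^sub>M lborel) (\<lambda>p. M * norm (case p of (t::real, x) \<Rightarrow> indicat_real {0..1} t *\<^sub>R g (x + (t * h) *\<^sub>R b)))"
        by (intro integrable_mult_right integrable_norm integrable_shift_average g)
      show "AE p in lborel \<Otimes>\<^sub>M lborel. norm (case_prod ?F p) \<le> norm (M * norm (case p of (t::real, x) \<Rightarrow> indicat_real {0..1} t *\<^sub>R g (x + (t * h) *\<^sub>R b)))"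
        using M by (auto simp: abs_mult indicator_def intro!: AE_I2 mult_right_mono)
    qed measurable
  qed
  have in_t: "(LINT x|lborel. ?F t x) = indicat_real {0..1} t *\<^sub>R \<Psi> (t * h)" for t
    by (cases "t \<in> {0..1}") (simp_all add: \<Psi>_def)
  have "integrable lborel (\<lambda>t. indicat_real {0..1} t *\<^sub>R \<Psi> (t * h))"
    using lborel_pair.integrable_fst[OF intF] by (simp only: in_t)
  then have "set_integrable lborel {0..1} (\<lambda>t. \<Psi> (t * h))"
    by (simp add: set_integrable_def)
  from set_borel_integral_eq_integral[OF this]
  have hk: "(LINT t|lborel. indicat_real {0..1} t *\<^sub>R \<Psi> (t * h)) = integral {0..1} (\<lambda>t. \<Psi> (t * h))"
    by (simp add: set_lebesgue_integral_def)
  have av: "(LINT t|lborel. ?F t x) = \<phi> x *\<^sub>R (LINT t|lborel. indicator {0..1} t *\<^sub>R g (x + (t * h) *\<^sub>R b))" for x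
    by (subst integral_scaleR_right[symmetric]) (simp add: mult.commute)
  have "(LINT x|lborel. \<phi> x *\<^sub>R h *\<^sub>R (LINT t|lborel. indicator {0..1} t *\<^sub>R g (x + (t * h) *\<^sub>R b)))
      = h *\<^sub>R (LINT x|lborel. LINT t|lborel. ?F t x)"
    by (simp only: av scaleR_left_commute[of _ h] integral_scaleR_right)
  moreover have "h *\<^sub>R (LINT x|lborel. LINT t|lborel. ?F t x) = \<Phi> h - \<Phi> 0"
    unfolding lborel_pair.Fubini_integral[OF intF] in_t hk ftc[symmetric] by simp
  moreover have "\<Phi> h - \<Phi> 0 = (LINT x|lborel. \<phi> x *\<^sub>R (u (x + h *\<^sub>R b) - u x))"
    unfolding \<Phi>_def integral_test_shift[OF \<phi> u]
    using integrable_test_scaleR[OF \<phi> u] integrable_test_scaleR[OF \<phi> integrable_lborel_translate[OF u]]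
    by (simp add: scaleR_diff_right)
  ultimately show ?thesis by (simp only:)
qed

lemma weak_increment_AE:
  fixes u g :: "'a::euclidean_space \<Rightarrow> 'b::euclidean_space"
  assumes b: "b \<in> Basis" and u: "integrable lborel u" and g: "integrable lborel g"
    and weak: "\<And>\<phi>. test_function W \<phi> \<Longrightarrow>
      (LINT x|lborel. partial_deriv b \<phi> x *\<^sub>R u x) = - (LINT x|lborel. \<phi> x *\<^sub>R g x)"
    and W': "open W'" "\<And>x t. x \<in> W' \<Longrightarrow> \<bar>t\<bar> \<le> \<bar>h\<bar> \<Longrightarrow> x + t *\<^sub>R b \<in> W"
  shows "AE x in lborel. x \<in> W' \<longrightarrow>
    u (x + h *\<^sub>R b) - u x = h *\<^sub>R (LINT t|lborel. indicator {0..1} t *\<^sub>R g (x + (t * h) *\<^sub>R b))"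
proof -
  let ?G = "\<lambda>x. LINT t|lborel. indicator {0..1} t *\<^sub>R g (x + (t * h) *\<^sub>R b)"
  have G: "integrable lborel ?G"
    using lborel_pair.integrable_snd[OF integrable_shift_average[OF g, of h b]] by simp
  have int: "integrable lborel (\<lambda>x. u (x + h *\<^sub>R b) - u x)" "integrable lborel (\<lambda>x. h *\<^sub>R ?G x)"
    using integrable_lborel_translate[OF u] u G by auto
  have "AE x in lebesgue. x \<in> W' \<longrightarrow> u (x + h *\<^sub>R b) - u x - h *\<^sub>R ?G x = 0"
  proof (rule AE_zero_if_test_integrals_zero[OF W'(1)])
    have i: "integrable lborel (\<lambda>x. u (x + h *\<^sub>R b) - u x - h *\<^sub>R ?G x)"
      using int by (rule Bochner_Integration.integrable_diff)
    then show "locally_integrable W' (\<lambda>x. u (x + h *\<^sub>R b) - u x - h *\<^sub>R ?G x)"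
      by (rule locally_integrable_lborel)
    fix \<phi> :: "'a \<Rightarrow> real" assume \<phi>: "test_function W' \<phi>"
    have "(LINT x|lborel. \<phi> x *\<^sub>R (u (x + h *\<^sub>R b) - u x - h *\<^sub>R ?G x)) =
       (LINT x|lborel. \<phi> x *\<^sub>R (u (x + h *\<^sub>R b) - u x)) - (LINT x|lborel. \<phi> x *\<^sub>R h *\<^sub>R ?G x)"
      unfolding scaleR_diff_right[of "\<phi> _" "u _ - u _"]
      by (intro Bochner_Integration.integral_diff integrable_test_scaleR[OF \<phi>] int)
    also have "\<dots> = 0"
      using weak_increment[OF b u g weak W'(2) \<phi>] by simp
    finally show "(LINT x:W'|lebesgue. \<phi> x *\<^sub>R (u (x + h *\<^sub>R b) - u x - h *\<^sub>R ?G x)) = 0"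
      using integral_test_lebesgue[OF \<phi> i] by simp
  qed
  then show ?thesis unfolding AE_completion_iff by simp
qed

text \<open>By \<open>weak_increment_AE\<close> the increment is h times the mean of
  \<open>g\<close> over the segment from x to x + h b, and L1 continuity of translations makes this
  mean close to \<open>g x\<close>. The factor \<open>\<bar>h\<bar>\<close> on the right later
  cancels the division in the difference quotients.\<close>

lemma weak_difference_quotient_L1:
  fixes u g :: "'a::euclidean_space \<Rightarrow> 'b::euclidean_space"
  assumes b: "b \<in> Basis" and u: "integrable lborel u" and g: "integrable lborel g"
    and W: "open W" and weak: "\<And>\<phi>. test_function W \<phi> \<Longrightarrow>
      (LINT x|lborel. partial_deriv b \<phi> x *\<^sub>R u x) = - (LINT x|lborel. \<phi> x *\<^sub>R g x)"
    and K: "compact K" "K \<subseteq> W" and e: "e > 0"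
  shows "\<exists>d>0. \<forall>h. \<bar>h\<bar> < d \<longrightarrow>
    (LINT x|lborel. indicator K x * norm (u (x + h *\<^sub>R b) - u x - h *\<^sub>R g x)) \<le> \<bar>h\<bar> * e"
proof -
  obtain r where r: "r > 0" "(\<Union>x\<in>K. cball x r) \<subseteq> W"
    using compact_subset_open_imp_cball_epsilon_subset[OF K(1) W K(2)] by blast
  obtain d where d: "d > 0" "\<And>s. norm s < d \<Longrightarrow> (LINT x|lborel. norm (g (x + s) - g x)) < e"
    using L1_shift_continuous[OF g] e unfolding L1_shift_continuous_def by blast
  \<comment> \<open>Half of the radius is spent on the neighbourhood of \<open>K\<close> and half on
    the shift, so shifted points stay in \<open>W\<close>.\<close>
  define W' where "W' = (\<Union>x\<in>K. ball x (r / 2))"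
  have W': "open W'" "K \<subseteq> W'" unfolding W'_def using r(1) by auto
  have W'W: "x + t *\<^sub>R b \<in> W" if x: "x \<in> W'" and t: "\<bar>t\<bar> \<le> r / 2" for x t
  proof -
    obtain y where y: "y \<in> K" "dist y x < r / 2" using x by (auto simp: W'_def)
    have "dist x (x + t *\<^sub>R b) \<le> r / 2" using t b by (simp add: dist_norm)
    with y(2) have "x + t *\<^sub>R b \<in> cball y r" using dist_triangle[of y "x + t *\<^sub>R b" x] by simp
    then show ?thesis using r(2) y(1) by blast
  qed
  have "(LINT x|lborel. indicator K x * norm (u (x + h *\<^sub>R b) - u x - h *\<^sub>R g x)) \<le> \<bar>h\<bar> * e"
    if h: "\<bar>h\<bar> < min d (r / 2)" for h
  proof -
    let ?A = "\<lambda>t x. indicat_real {0..1} t *\<^sub>R g (x + (t * h) *\<^sub>R b)"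
    let ?B = "\<lambda>(t::real) x. indicat_real {0..1} t *\<^sub>R g x"
    let ?C = "\<lambda>t x. norm (?A t x - ?B t x)"
    have iA: "integrable (lborel \<Otimes>\<^sub>M lborel) (case_prod ?A)"
      by (rule integrable_shift_average[OF g])
    have iB: "integrable (lborel \<Otimes>\<^sub>M lborel) (case_prod ?B)"
      using integrable_shift_average[OF g, of 0 b] by simp
    have iC: "integrable (lborel \<Otimes>\<^sub>M lborel) (case_prod ?C)"
      using integrable_norm[OF Bochner_Integration.integrable_diff[OF iA iB]] by (simp add: case_prod_unfold)
    have "AE x in lborel. x \<in> W' \<longrightarrow> u (x + h *\<^sub>R b) - u x = h *\<^sub>R (LINT t|lborel. ?A t x)"
    proof (rule weak_increment_AE[OF b u g weak W'(1)])
      show "x + t *\<^sub>R b \<in> W" if "x \<in> W'" "\<bar>t\<bar> \<le> \<bar>h\<bar>" for x t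
        using that h by (intro W'W) auto
    qed
    moreover have "AE x in lborel. integrable lborel (\<lambda>t. ?A t x)"
      using lborel_pair.AE_integrable_snd[OF iA] .
    ultimately have "AE x in lborel. indicator K x * norm (u (x + h *\<^sub>R b) - u x - h *\<^sub>R g x) \<le> \<bar>h\<bar> * (LINT t|lborel. ?C t x)"
    proof eventually_elim
      case (elim x)
      show ?case
      proof (cases "x \<in> K")
        case True
        \<comment> \<open>\<open>g x\<close> is written as its own average over
          \<open>{0..1}\<close>, so that the remainder becomes a single integral over t.\<close>
        have B: "has_bochner_integral lborel (\<lambda>t. ?B t x) (g x)"
          using has_bochner_integral_scaleR_left[OF has_bochner_integral_real_indicator[of "{0..1::real}" lborel], of "g x"]
          by simp
        have "u (x + h *\<^sub>R b) - u x - h *\<^sub>R g x = h *\<^sub>R (LINT t|lborel. ?A t x - ?B t x)"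
          using elim True W'(2) has_bochner_integral_integral_eq[OF B] integrable.intros[OF B]
          by (subst Bochner_Integration.integral_diff) (auto simp: scaleR_diff_right)
        then show ?thesis using True
          by (simp add: mult_left_mono integral_norm_bound)
      qed (simp add: mult_nonneg_nonneg)
    qed
    moreover have "integrable lborel (\<lambda>x. \<bar>h\<bar> * (LINT t|lborel. ?C t x))"
      by (rule integrable_mult_right[OF lborel_pair.integrable_snd[OF iC]])
    ultimately have "(LINT x|lborel. indicator K x * norm (u (x + h *\<^sub>R b) - u x - h *\<^sub>R g x)) \<le>
        (LINT x|lborel. \<bar>h\<bar> * (LINT t|lborel. ?C t x))"
      using integrable_mult_indicator[of K lborel "\<lambda>x. norm (u (x + h *\<^sub>R b) - u x - h *\<^sub>R g x)"] 
        integrable_lborel_translate[OF u] u g K(1)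
      by (intro integral_mono_AE) (auto simp: compact_imp_closed)
    also have "\<dots> = \<bar>h\<bar> * (LINT t|lborel. LINT x|lborel. ?C t x)"
      using lborel_pair.Fubini_integral[OF iC] by simp
    also have "(LINT t|lborel. LINT x|lborel. ?C t x) \<le> (LINT t|(lborel :: real measure). indicator {0..1} t * e)"
    proof (rule integral_mono)
      show "integrable lborel (\<lambda>t. LINT x|lborel. ?C t x)"
        using lborel_pair.integrable_fst[OF iC] .
      show "integrable lborel (\<lambda>t::real. indicator {0..1} t * e)" 
        by (intro integrable_mult_left integrable_real_indicator) auto
      show "(LINT x|lborel. ?C t x) \<le> indicator {0..1} t * e" for t :: real
      proof (cases "t \<in> {0..1}")
        case True
        have "\<bar>t\<bar> * \<bar>h\<bar> \<le> \<bar>h\<bar>" using True by (intro mult_left_le_one_le) auto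
        then have "norm ((t * h) *\<^sub>R b) < d" using h b by (simp add: abs_mult)
        from d(2)[OF this] True show ?thesis by simp
      qed simp
    qed
    also have "(LINT t|(lborel :: real measure). indicator {0..1} t * e) = e"
      by simp
    finally show ?thesis by (simp add: mult_left_mono)
  qed
  then show ?thesis using d(1) r(1) by (intro exI[of _ "min d (r / 2)"]) auto
qed

section \<open>Weak derivative of a composition\<close>

lemma integrable_lipschitz_compose:
  fixes u :: "'a \<Rightarrow> 'b::euclidean_space" and f :: "'b \<Rightarrow> real"
  assumes lip: "\<And>x y. \<bar>f x - f y\<bar> \<le> L * norm (x - y)" and L: "L \<ge> 0" and f0: "f 0 = 0" and u: "integrable M u"
  shows "integrable M (\<lambda>x. f (u x))"
proof (rule Bochner_Integration.integrable_bound)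
  have "L-lipschitz_on UNIV f"
  proof (rule lipschitz_onI)
    show "0 \<le> L" by (rule L)
  qed (use lip in \<open>auto simp: dist_norm\<close>)
  then have "f \<in> borel_measurable borel"
    by (intro borel_measurable_continuous_onI lipschitz_on_continuous_on)
  then show "(\<lambda>x. f (u x)) \<in> borel_measurable M" using u by measurable
  show "integrable M (\<lambda>x. L * norm (u x))" using u by simp
  show "AE x in M. norm (f (u x)) \<le> norm (L * norm (u x))"
  proof (rule AE_I2)
    fix x show "norm (f (u x)) \<le> norm (L * norm (u x))" using lip[of "u x" 0] f0 by simp
  qed
qed

text \<open>\<open>h\<close> has no prescribed sign and \<open>Df x\<close> need not be linear: the
  locale is instantiated once with positive and once with negative steps, giving the two one-sided
  derivatives. \<open>f 0 = 0\<close> lets cut-offs by indicators commute with \<open>f\<close> and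
  keeps the composition with an integrable map integrable.\<close>

locale directional_derivative =
  fixes f :: "'b::euclidean_space \<Rightarrow> real" and L :: real and h :: "nat \<Rightarrow> real" and Df :: "'b \<Rightarrow> 'b \<Rightarrow> real"
  assumes lip: "\<bar>f x - f y\<bar> \<le> L * norm (x - y)" and L: "L \<ge> 0" and f0: "f 0 = 0"
    and h: "h \<longlonglongrightarrow> 0" "h n \<noteq> 0"
    and Df: "(\<lambda>n. (f (x + h n *\<^sub>R v) - f x) / h n) \<longlonglongrightarrow> Df x v"
begin

lemma continuous_on_f: "continuous_on UNIV f"
proof -
  have "L-lipschitz_on UNIV f" using lip L by (intro lipschitz_onI) (auto simp: dist_norm)
  then show ?thesis by (rule lipschitz_on_continuous_on)
qed

lemma borel_f [measurable]: "f \<in> borel_measurable borel"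
  by (rule borel_measurable_continuous_onI[OF continuous_on_f])

lemma quotient_bound: "\<bar>(f (x + h n *\<^sub>R v) - f x) / h n\<bar> \<le> L * norm v"
proof -
  have "\<bar>f (x + h n *\<^sub>R v) - f x\<bar> \<le> L * norm v * \<bar>h n\<bar>"
    using lip[of "x + h n *\<^sub>R v" x] by (simp add: mult_ac)
  then show ?thesis using h(2)[of n] by (simp add: abs_divide divide_simps)
qed

lemma Df_bound: "\<bar>Df x v\<bar> \<le> L * norm v"
  by (rule tendsto_upperbound[OF tendsto_rabs[OF Df[of x v]]]) (use quotient_bound in auto)

lemma Df_0: "Df 0 0 = 0"
  using Df_bound[of 0 0] by simp

lemma measurable_Df:
  assumes [measurable]: "u \<in> borel_measurable M" "g \<in> borel_measurable M"
  shows "(\<lambda>x. Df (u x) (g x)) \<in> borel_measurable M"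
  by (rule borel_measurable_LIMSEQ_real[OF Df]) measurable

lemma integrable_Df:
  assumes u: "u \<in> borel_measurable M" and g: "integrable M g"
  shows "integrable M (\<lambda>x. Df (u x) (g x))"
proof (rule Bochner_Integration.integrable_bound)
  show "integrable M (\<lambda>x. L * norm (g x))" using g by simp
  show "(\<lambda>x. Df (u x) (g x)) \<in> borel_measurable M" using u g by (intro measurable_Df) auto
  show "AE x in M. norm (Df (u x) (g x)) \<le> norm (L * norm (g x))"
    using Df_bound L by (auto simp: abs_mult)
qed

text \<open>\<open>p n\<close> and \<open>q n\<close> test the difference quotients of
  \<open>f\<close> formed with u(x + h b) and with u(x) + h g(x). The first converges because the
  quotient can be moved to \<open>\<phi>\<close>, the second by the definition of \<open>Df\<close>.
  Their difference vanishes because \<open>f\<close> is Lipschitz and the quotients of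
  \<open>u\<close> converge to \<open>g\<close> in L1 on the support of
  \<open>\<phi>\<close>.\<close>

lemma chain_rule_lborel:
  fixes u g :: "'a::euclidean_space \<Rightarrow> 'b"
  assumes b: "b \<in> Basis" and u: "integrable lborel u" and g: "integrable lborel g"
    and W: "open W" and weak: "\<And>\<phi>. test_function W \<phi> \<Longrightarrow>
      (LINT x|lborel. partial_deriv b \<phi> x *\<^sub>R u x) = - (LINT x|lborel. \<phi> x *\<^sub>R g x)"
    and \<phi>: "test_function W \<phi>"
  shows "(LINT x|lborel. partial_deriv b \<phi> x *\<^sub>R f (u x)) = - (LINT x|lborel. \<phi> x *\<^sub>R Df (u x) (g x))"
proof -
  let ?K = "closure {x. \<phi> x \<noteq> 0}"
  have K: "compact ?K" "?K \<subseteq> W" using \<phi> by (auto simp: test_function_def)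
  obtain M where M: "\<And>x. \<bar>\<phi> x\<bar> \<le> M" "M \<ge> 0" using test_function_bounded[OF \<phi>] by metis
  have fu: "integrable lborel (\<lambda>x. f (u x))"
    by (rule integrable_lipschitz_compose[OF lip L f0 u])
  have fus: "integrable lborel (\<lambda>x. f (u (x + c)))" for c
    by (rule integrable_lborel_translate[OF fu])
  have [measurable]: "u \<in> borel_measurable borel" "g \<in> borel_measurable borel" "\<phi> \<in> borel_measurable borel"
    using u g test_function_borel[OF \<phi>] by auto
  define p where "p n = (LINT x|lborel. \<phi> x *\<^sub>R ((f (u (x + h n *\<^sub>R b)) - f (u x)) / h n))" for n
  define q where "q n = (LINT x|lborel. \<phi> x *\<^sub>R ((f (u x + h n *\<^sub>R g x) - f (u x)) / h n))" for n
  have ip: "integrable lborel (\<lambda>x. \<phi> x *\<^sub>R ((f (u (x + h n *\<^sub>R b)) - f (u x)) / h n))" for n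
    by (intro integrable_test_scaleR[OF \<phi>] integrable_divide Bochner_Integration.integrable_diff fu fus)
  have iq: "integrable lborel (\<lambda>x. \<phi> x *\<^sub>R ((f (u x + h n *\<^sub>R g x) - f (u x)) / h n))" for n
  proof -
    have "integrable lborel (\<lambda>x. f (u x + h n *\<^sub>R g x))"
      by (rule integrable_lipschitz_compose[OF lip L f0]) (use u g in simp)
    then show ?thesis
      by (intro integrable_test_scaleR[OF \<phi>] integrable_divide Bochner_Integration.integrable_diff fu)
  qed
  have p: "p \<longlonglongrightarrow> - (LINT x|lborel. partial_deriv b \<phi> x *\<^sub>R f (u x))"
  proof -
    have "p n = (LINT x|lborel. ((\<phi> (x - h n *\<^sub>R b) - \<phi> x) / h n) *\<^sub>R f (u x))" for n
    proof -
      have i1: "integrable lborel (\<lambda>x. \<phi> x *\<^sub>R f (u (x + c)))" for c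
        by (rule integrable_test_scaleR[OF \<phi> fus])
      have i2: "integrable lborel (\<lambda>x. \<phi> (x - c) *\<^sub>R f (u x))" for c
        using integrable_test_scaleR[OF test_function_shift[OF \<phi>, of c UNIV] fu] by simp
      have "p n = (LINT x|lborel. (\<phi> x *\<^sub>R f (u (x + h n *\<^sub>R b)) - \<phi> x *\<^sub>R f (u (x + 0))) / h n)"
        unfolding p_def by (intro Bochner_Integration.integral_cong) (auto simp: right_diff_distrib diff_divide_distrib)
      also have "\<dots> = ((LINT x|lborel. \<phi> x *\<^sub>R f (u (x + h n *\<^sub>R b))) - (LINT x|lborel. \<phi> x *\<^sub>R f (u (x + 0)))) / h n"
        using i1[of "h n *\<^sub>R b"] i1[of 0] by (simp del: real_scaleR_def)
      also have "\<dots> = ((LINT x|lborel. \<phi> (x - h n *\<^sub>R b) *\<^sub>R f (u x)) - (LINT x|lborel. \<phi> (x - 0) *\<^sub>R f (u x))) / h n"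
        unfolding integral_test_shift[OF \<phi> fu] ..
      also have "\<dots> = (LINT x|lborel. (\<phi> (x - h n *\<^sub>R b) *\<^sub>R f (u x) - \<phi> (x - 0) *\<^sub>R f (u x)) / h n)"
        using i2[of "h n *\<^sub>R b"] i2[of 0] by (simp del: real_scaleR_def)
      also have "\<dots> = (LINT x|lborel. ((\<phi> (x - h n *\<^sub>R b) - \<phi> x) / h n) *\<^sub>R f (u x))"
        by (intro Bochner_Integration.integral_cong) (auto simp: left_diff_distrib diff_divide_distrib)
      finally show ?thesis .
    qed
    then show ?thesis using test_difference_quotient_tendsto[OF \<phi> b fu h] by presburger
  qed
  have q: "q \<longlonglongrightarrow> (LINT x|lborel. \<phi> x *\<^sub>R Df (u x) (g x))"
    unfolding q_def
  proof (rule integral_dominated_convergence)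
    show "integrable lborel (\<lambda>x. M * (L * norm (g x)))" using g by simp
    show "AE x in lborel. (\<lambda>n. \<phi> x *\<^sub>R ((f (u x + h n *\<^sub>R g x) - f (u x)) / h n)) \<longlonglongrightarrow> \<phi> x *\<^sub>R Df (u x) (g x)"
      by (intro AE_I2 tendsto_scaleR tendsto_const Df)
    show "AE x in lborel. norm (\<phi> x *\<^sub>R ((f (u x + h n *\<^sub>R g x) - f (u x)) / h n)) \<le> M * (L * norm (g x))" for n
      unfolding norm_scaleR unfolding real_norm_def
      by (intro AE_I2 mult_mono quotient_bound M) auto
    show "(\<lambda>x. \<phi> x *\<^sub>R Df (u x) (g x)) \<in> borel_measurable lborel"
      using measurable_Df[of u lborel g] by measurable
    show "(\<lambda>x. \<phi> x *\<^sub>R ((f (u x + h n *\<^sub>R g x) - f (u x)) / h n)) \<in> borel_measurable lborel" for n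
      by measurable
  qed
  have "(\<lambda>n. p n - q n) \<longlonglongrightarrow> 0"
  proof (rule LIMSEQ_I)
    fix e :: real assume "e > 0"
    \<comment> \<open>\<open>M * L\<close> may be 0, hence the summand 1; the factor 1/2 makes the
      final inequality strict.\<close>
    define e' where "e' = e / 2 / (M * L + 1)"
    have Mpos: "M * L + 1 > 0" using M(2) L by (simp add: add_nonneg_pos)
    then have e': "e' > 0" using \<open>e > 0\<close> by (simp add: e'_def)
    obtain d where d: "d > 0" "\<And>t. \<bar>t\<bar> < d \<Longrightarrow>
        (LINT x|lborel. indicator ?K x * norm (u (x + t *\<^sub>R b) - u x - t *\<^sub>R g x)) \<le> \<bar>t\<bar> * e'"
      using weak_difference_quotient_L1[OF b u g W weak K e'] by blast
    obtain N where N: "\<And>n. n \<ge> N \<Longrightarrow> \<bar>h n\<bar> < d"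
      using LIMSEQ_D[OF h(1) d(1)] by auto
    have "norm (p n - q n - 0) < e" if "n \<ge> N" for n
    proof -
      let ?r = "\<lambda>x. indicator ?K x * norm (u (x + h n *\<^sub>R b) - u x - h n *\<^sub>R g x)"
      have ir: "integrable lborel ?r"
      proof -
        have "integrable lborel (\<lambda>x. norm (u (x + h n *\<^sub>R b) - u x - h n *\<^sub>R g x))"
          using integrable_lborel_translate[OF u] u g by simp
        from integrable_mult_indicator[OF _ this, of ?K] show ?thesis by simp
      qed
      have pt: "norm (\<phi> x *\<^sub>R ((f (u (x + h n *\<^sub>R b)) - f (u x)) / h n) - \<phi> x *\<^sub>R ((f (u x + h n *\<^sub>R g x) - f (u x)) / h n))
          \<le> M * L / \<bar>h n\<bar> * ?r x" for x
      proof (cases "x \<in> ?K")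
        case True
        have "norm (\<phi> x *\<^sub>R ((f (u (x + h n *\<^sub>R b)) - f (u x)) / h n) - \<phi> x *\<^sub>R ((f (u x + h n *\<^sub>R g x) - f (u x)) / h n))
          = \<bar>\<phi> x\<bar> * (\<bar>f (u (x + h n *\<^sub>R b)) - f (u x + h n *\<^sub>R g x)\<bar> / \<bar>h n\<bar>)"
        proof -
          have "p *\<^sub>R ((A - F) / k) - p *\<^sub>R ((B - F) / k) = p * ((A - B) / k)" for p A B F k :: real
            by (simp add: diff_divide_distrib right_diff_distrib)
          then show ?thesis by (simp only: real_norm_def abs_mult abs_divide)
        qed
        also have "\<dots> \<le> M * ((L * norm (u (x + h n *\<^sub>R b) - (u x + h n *\<^sub>R g x))) / \<bar>h n\<bar>)"
          by (intro mult_mono M divide_right_mono lip) auto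
        finally show ?thesis using True by (simp add: algebra_simps)
      next
        case False
        then show ?thesis using test_function_eq_0[of x \<phi>] by simp
      qed
      have "norm (p n - q n) = norm (LINT x|lborel. \<phi> x *\<^sub>R ((f (u (x + h n *\<^sub>R b)) - f (u x)) / h n) - \<phi> x *\<^sub>R ((f (u x + h n *\<^sub>R g x) - f (u x)) / h n))"
        unfolding p_def q_def by (subst Bochner_Integration.integral_diff[OF ip iq]) simp
      also have "\<dots> \<le> (LINT x|lborel. M * L / \<bar>h n\<bar> * ?r x)"
        by (intro Bochner_Integration.integral_norm_bound_integral Bochner_Integration.integrable_diff ip iq integrable_mult_right ir pt)
      also have "\<dots> = M * L / \<bar>h n\<bar> * (LINT x|lborel. ?r x)" by simp
      also have "\<dots> \<le> M * L / \<bar>h n\<bar> * (\<bar>h n\<bar> * e')"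
        using M(2) L by (intro mult_left_mono d(2) N that) auto
      also have "\<dots> = M * L * e'" using h(2)[of n] by simp
      also have "\<dots> \<le> (M * L + 1) * e'" using e' by (intro mult_right_mono) auto
      also have "\<dots> = e / 2"
      proof -
        have "k * (e / 2 / k) = e / 2" if "k \<noteq> 0" for k :: real using that by simp
        moreover have "M * L + 1 \<noteq> 0" using Mpos by simp
        ultimately show ?thesis unfolding e'_def by blast
      qed
      finally show ?thesis using \<open>e > 0\<close> by simp
    qed
    then show "\<exists>N. \<forall>n\<ge>N. norm (p n - q n - 0) < e" by blast
  qed
  from tendsto_diff[OF p this] have "q \<longlonglongrightarrow> - (LINT x|lborel. partial_deriv b \<phi> x *\<^sub>R f (u x))"
    by simp
  from LIMSEQ_unique[OF q this] show ?thesis by simp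
qed

end

text \<open>Replaces the integrals over \<open>U\<close> in the definition of weak derivatives by
  Borel integrals, when the representative agrees only on a smaller set \<open>W\<close> that
  carries the support of \<open>\<phi>\<close>.\<close>

lemma integral_test_AE_eq:
  fixes k l :: "'a::euclidean_space \<Rightarrow> 'b::euclidean_space"
  assumes \<phi>: "test_function W \<phi>" and W: "W \<subseteq> U" and l: "integrable lborel l"
    and eq: "AE x in lebesgue. x \<in> W \<longrightarrow> k x = l x"
  shows "(LINT x:U|lebesgue. \<phi> x *\<^sub>R k x) = (LINT x|lborel. \<phi> x *\<^sub>R l x)"
proof -
  have AE: "AE x in lebesgue. \<phi> x *\<^sub>R l x = indicator U x *\<^sub>R \<phi> x *\<^sub>R k x"
    using eq
  proof eventually_elim
    case (elim x)
    then show ?case using test_function_outside[OF \<phi>, of x] W by (cases "x \<in> W") auto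
  qed
  have m: "(\<lambda>x. \<phi> x *\<^sub>R l x) \<in> borel_measurable lborel"
    using integrable_test_scaleR[OF \<phi> l] by simp
  then have m': "(\<lambda>x. \<phi> x *\<^sub>R l x) \<in> borel_measurable lebesgue" by (rule measurable_completion)
  have "(LINT x|lebesgue. \<phi> x *\<^sub>R l x) = (LINT x:U|lebesgue. \<phi> x *\<^sub>R k x)"
    unfolding set_lebesgue_integral_def
    by (rule integral_cong_AE[OF m' borel_measurable_AE[OF m' AE] AE])
  then show ?thesis using integral_completion[OF m] by simp
qed

context directional_derivative
begin

text \<open>Integrability is only local, so each test function is handled on a neighbourhood of its
  support, where \<open>u\<close> and \<open>g\<close> agree almost everywhere with globally
  integrable Borel functions \<open>v\<close> and \<open>k\<close>.\<close>

lemma chain_rule: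
  fixes u g :: "'a::euclidean_space \<Rightarrow> 'b"
  assumes b: "b \<in> Basis" and U: "open U" and weak: "is_weak_partial U b u g"
  shows "is_weak_partial U b (\<lambda>x. f (u x)) (\<lambda>x. Df (u x) (g x))"
proof -
  have u: "set_integrable lebesgue K u" and g: "set_integrable lebesgue K g" if "compact K" "K \<subseteq> U" for K
    using weak that by (auto simp: is_weak_partial_def locally_integrable_def)
  have "locally_integrable U (\<lambda>x. f (u x))"
    unfolding locally_integrable_def set_integrable_def
  proof safe
    fix K assume K: "compact K" "K \<subseteq> U"
    have "indicator K x *\<^sub>R f (u x) = f (indicator K x *\<^sub>R u x)" for x by (simp add: indicator_def f0)
    then show "integrable lebesgue (\<lambda>x. indicat_real K x *\<^sub>R f (u x))"
      using integrable_lipschitz_compose[OF lip L f0 u[OF K, unfolded set_integrable_def]] by simp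
  qed
  moreover have "locally_integrable U (\<lambda>x. Df (u x) (g x))"
    unfolding locally_integrable_def set_integrable_def
  proof safe
    fix K assume K: "compact K" "K \<subseteq> U"
    have "indicator K x *\<^sub>R Df (u x) (g x) = Df (indicator K x *\<^sub>R u x) (indicator K x *\<^sub>R g x)" for x
      by (simp add: indicator_def Df_0)
    then show "integrable lebesgue (\<lambda>x. indicat_real K x *\<^sub>R Df (u x) (g x))"
      using integrable_Df[OF borel_measurable_integrable[OF u[OF K, unfolded set_integrable_def]] g[OF K, unfolded set_integrable_def]] by simp
  qed
  moreover have "(LINT x:U|lebesgue. partial_deriv b \<phi> x *\<^sub>R f (u x)) = - (LINT x:U|lebesgue. \<phi> x *\<^sub>R Df (u x) (g x))"
    if \<phi>: "test_function U \<phi>" for \<phi>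
  proof -
    let ?K = "closure {x. \<phi> x \<noteq> 0}"
    have K: "compact ?K" "?K \<subseteq> U" using \<phi> by (auto simp: test_function_def)
    obtain r where r: "r > 0" "(\<Union>x\<in>?K. cball x r) \<subseteq> U"
      using compact_subset_open_imp_cball_epsilon_subset[OF K(1) U K(2)] by blast
    define W where "W = (\<Union>x\<in>?K. ball x r)"
    \<comment> \<open>\<open>C\<close> is the closed r-neighbourhood of the support, written as a
      sum of two compact sets to see that it is compact; the open \<open>W\<close> fits between the
      support and \<open>C\<close>.\<close>
    define C where "C = (\<Union>x\<in>?K. \<Union>y\<in>cball 0 r. {x + y})"
    have W: "open W" "?K \<subseteq> W" unfolding W_def using r(1) by auto
    have C: "compact C" unfolding C_def by (intro compact_sums' K(1) compact_cball)
    have "x + y \<in> cball x r" if "norm y \<le> r" for x y :: 'a using that by (simp add: dist_norm)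
    then have CU: "C \<subseteq> U" using r(2) by (fastforce simp: C_def)
    have WC: "W \<subseteq> C"
    proof
      fix y assume "y \<in> W"
      then obtain x where x: "x \<in> ?K" "dist x y < r" by (auto simp: W_def)
      have "y = x + (y - x)" "y - x \<in> cball 0 r" using x(2) by (auto simp: dist_norm norm_minus_commute)
      with x(1) show "y \<in> C" unfolding C_def by blast
    qed
    have WU: "W \<subseteq> U" using WC CU by simp
    have \<phi>W: "test_function W \<phi>" using \<phi> W(2) by (auto simp: test_function_def)
    obtain v where v: "integrable lborel v" "AE x in lebesgue. indicator C x *\<^sub>R u x = v x"
      using integrable_lebesgue_ex_borel[OF u[OF C CU, unfolded set_integrable_def]] .
    obtain k where k: "integrable lborel k" "AE x in lebesgue. indicator C x *\<^sub>R g x = k x"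
      using integrable_lebesgue_ex_borel[OF g[OF C CU, unfolded set_integrable_def]] .
    have uv: "AE x in lebesgue. x \<in> W \<longrightarrow> u x = v x"
      using v(2) by eventually_elim (use WC in auto)
    have gk: "AE x in lebesgue. x \<in> W \<longrightarrow> g x = k x"
      using k(2) by eventually_elim (use WC in auto)
    have "(LINT x|lborel. partial_deriv b \<psi> x *\<^sub>R v x) = - (LINT x|lborel. \<psi> x *\<^sub>R k x)"
      if \<psi>: "test_function W \<psi>" for \<psi>
    proof -
      have "(LINT x:U|lebesgue. partial_deriv b \<psi> x *\<^sub>R u x) = - (LINT x:U|lebesgue. \<psi> x *\<^sub>R g x)"
        using weak test_function_mono[OF \<psi> WU] by (auto simp: is_weak_partial_def)
      then show ?thesis
        unfolding integral_test_AE_eq[OF \<psi> WU k(1) gk]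
          integral_test_AE_eq[OF test_function_partial[OF \<psi> b] WU v(1) uv] .
    qed
    from chain_rule_lborel[OF b v(1) k(1) W(1) this \<phi>W]
    have *: "(LINT x|lborel. partial_deriv b \<phi> x *\<^sub>R f (v x)) = - (LINT x|lborel. \<phi> x *\<^sub>R Df (v x) (k x))" .
    have fv: "integrable lborel (\<lambda>x. f (v x))" by (rule integrable_lipschitz_compose[OF lip L f0 v(1)])
    have Dvk: "integrable lborel (\<lambda>x. Df (v x) (k x))"
      by (rule integrable_Df[OF borel_measurable_integrable[OF v(1)] k(1)])
    have fuv: "AE x in lebesgue. x \<in> W \<longrightarrow> f (u x) = f (v x)" using uv by eventually_elim simp
    have Dgk: "AE x in lebesgue. x \<in> W \<longrightarrow> Df (u x) (g x) = Df (v x) (k x)"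
      using uv gk by eventually_elim simp
    show ?thesis
      unfolding integral_test_AE_eq[OF \<phi>W WU Dvk Dgk]
        integral_test_AE_eq[OF test_function_partial[OF \<phi>W b] WU fv fuv] by (rule *)
  qed
  ultimately show ?thesis by (simp add: is_weak_partial_def)
qed

end

section \<open>Convex Lipschitz functions\<close>

locale convex_lipschitz =
  fixes f :: "'b::euclidean_space \<Rightarrow> real" and L :: real
  assumes conv: "convex_on UNIV f"
    and lip: "\<bar>f x - f y\<bar> \<le> L * norm (x - y)" and L: "L \<ge> 0" and f0: "f 0 = 0"
begin

text \<open>An infimum instead of a limit: every single quotient is then an upper bound, which is
  the source of upper semicontinuity. By \<open>quotient_mono\<close> it is also the limit from the
  right.\<close>

definition dd :: "'b \<Rightarrow> 'b \<Rightarrow> real" where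
  "dd x v = (INF h\<in>{0<..}. (f (x + h *\<^sub>R v) - f x) / h)"

text \<open>The point x + s v lies on the segment from x to x + t v, at weight s/t.\<close>

lemma quotient_mono:
  assumes "0 < s" "s \<le> t"
  shows "(f (x + s *\<^sub>R v) - f x) / s \<le> (f (x + t *\<^sub>R v) - f x) / t"
proof -
  have "f ((1 - s / t) *\<^sub>R x + (s / t) *\<^sub>R (x + t *\<^sub>R v)) \<le> (1 - s / t) * f x + (s / t) * f (x + t *\<^sub>R v)"
    using assms by (intro convex_onD[OF conv]) (auto simp: divide_simps)
  also have "(1 - s / t) *\<^sub>R x + (s / t) *\<^sub>R (x + t *\<^sub>R v) = x + s *\<^sub>R v"
    using assms by (simp add: algebra_simps)
  finally have "f (x + s *\<^sub>R v) - f x \<le> (s / t) * (f (x + t *\<^sub>R v) - f x)"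
    by (simp add: algebra_simps)
  then show ?thesis using assms by (simp add: divide_simps mult_ac)
qed

lemma quotient_lower: "0 < s \<Longrightarrow> - (L * norm v) \<le> (f (x + s *\<^sub>R v) - f x) / s"
  using lip[of "x + s *\<^sub>R v" x] by (simp add: divide_simps abs_le_iff mult_ac)

lemma dd_le: "0 < s \<Longrightarrow> dd x v \<le> (f (x + s *\<^sub>R v) - f x) / s"
  unfolding dd_def by (rule cINF_lower) (auto intro!: bdd_belowI2 quotient_lower)

lemma dd_approx:
  assumes "e > 0"
  shows "\<exists>t>0. (f (x + t *\<^sub>R v) - f x) / t < dd x v + e"
proof -
  have "\<exists>t\<in>{0<..}. (f (x + t *\<^sub>R v) - f x) / t < dd x v + e"
  proof (subst cINF_less_iff[symmetric])
    show "bdd_below ((\<lambda>h. (f (x + h *\<^sub>R v) - f x) / h) ` {0<..})"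
      by (auto intro!: bdd_belowI2 quotient_lower)
    show "(INF h\<in>{0<..}. (f (x + h *\<^sub>R v) - f x) / h) < dd x v + e"
      using \<open>e > 0\<close> by (simp add: dd_def)
  qed auto
  then show ?thesis by auto
qed

lemma dd_tendsto:
  assumes h: "h \<longlonglongrightarrow> 0" "\<And>n. h n > 0"
  shows "(\<lambda>n. (f (x + h n *\<^sub>R v) - f x) / h n) \<longlonglongrightarrow> dd x v"
proof (rule LIMSEQ_I)
  fix e :: real assume "e > 0"
  obtain t where t: "t > 0" "(f (x + t *\<^sub>R v) - f x) / t < dd x v + e"
    using dd_approx[OF \<open>e > 0\<close>] by blast
  obtain N where N: "\<And>n. n \<ge> N \<Longrightarrow> h n < t"
    using LIMSEQ_D[OF h(1) t(1)] h(2) by (metis abs_of_pos diff_zero real_norm_def)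
  have "norm ((f (x + h n *\<^sub>R v) - f x) / h n - dd x v) < e" if "n \<ge> N" for n
    using quotient_mono[OF h(2), of n t x v] N[OF that] t(2) dd_le[OF h(2), of x v n] by simp
  then show "\<exists>N. \<forall>n\<ge>N. norm ((f (x + h n *\<^sub>R v) - f x) / h n - dd x v) < e" by blast
qed

sublocale right: directional_derivative f L "\<lambda>n. 1 / real (Suc n)" dd
proof unfold_locales
  show h: "(\<lambda>n. 1 / real (Suc n)) \<longlonglongrightarrow> 0"
    using LIMSEQ_inverse_real_of_nat by (simp only: inverse_eq_divide)
  show "(\<lambda>n. (f (x + (1 / real (Suc n)) *\<^sub>R v) - f x) / (1 / real (Suc n))) \<longlonglongrightarrow> dd x v" for x v
    by (rule dd_tendsto[OF h]) simp
qed (use lip L f0 in auto)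

text \<open>A step -h in direction v is a step h in direction -v with the sign of the quotient
  reversed; hence the limit \<open>- dd x (- v)\<close>.\<close>

sublocale left: directional_derivative f L "\<lambda>n. - (1 / real (Suc n))" "\<lambda>x v. - dd x (- v)"
proof unfold_locales
  have h: "(\<lambda>n. 1 / real (Suc n)) \<longlonglongrightarrow> 0" using right.h(1) .
  from tendsto_minus[OF h] show "(\<lambda>n. - (1 / real (Suc n))) \<longlonglongrightarrow> 0" by simp
  fix x v
  have "(\<lambda>n. (f (x + (1 / real (Suc n)) *\<^sub>R (- v)) - f x) / (1 / real (Suc n))) \<longlonglongrightarrow> dd x (- v)"
    by (rule dd_tendsto[OF h]) simp
  from tendsto_minus[OF this]
  show "(\<lambda>n. (f (x + (- (1 / real (Suc n))) *\<^sub>R v) - f x) / (- (1 / real (Suc n)))) \<longlonglongrightarrow> - dd x (- v)"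
    by (simp del: of_nat_Suc)
qed (use lip L f0 in auto)

lemma dd_antisym_AE:
  fixes u g :: "'a::euclidean_space \<Rightarrow> 'b"
  assumes "b \<in> Basis" "open U" "is_weak_partial U b u g"
  shows "AE x in lebesgue. x \<in> U \<longrightarrow> dd (u x) (- g x) = - dd (u x) (g x)"
  using weak_partial_unique[OF assms(2) right.chain_rule[OF assms] left.chain_rule[OF assms]]
  by eventually_elim auto

text \<open>The directional derivative of a convex function is upper semicontinuous in point and
  direction jointly; at pairs where it is odd in the direction it is therefore continuous.\<close>

lemma dd_upper:
  assumes x: "x \<longlonglongrightarrow> x'" and v: "v \<longlonglongrightarrow> v'" and "e > 0"
  shows "\<forall>\<^sub>F n in sequentially. dd (x n) (v n) < dd x' v' + e"
proof -
  obtain t where t: "t > 0" "(f (x' + t *\<^sub>R v') - f x') / t < dd x' v' + e"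
    using dd_approx[OF \<open>e > 0\<close>] by blast
  have cf: "isCont f y" for y using right.continuous_on_f by (simp add: continuous_on_eq_continuous_at)
  have "(\<lambda>n. (f (x n + t *\<^sub>R v n) - f (x n)) / t) \<longlonglongrightarrow> (f (x' + t *\<^sub>R v') - f x') / t"
    using t(1) by (intro tendsto_intros isCont_tendsto_compose[OF cf] x v) auto
  from order_tendstoD(2)[OF this t(2)] show ?thesis
    by eventually_elim (rule le_less_trans[OF dd_le[OF t(1)]])
qed

lemma dd_tendsto_antisym:
  assumes x: "x \<longlonglongrightarrow> x'" and v: "v \<longlonglongrightarrow> v'"
    and anti: "dd x' (- v') = - dd x' v'" "\<And>n. dd (x n) (- v n) = - dd (x n) (v n)"
  shows "(\<lambda>n. dd (x n) (v n)) \<longlonglongrightarrow> dd x' v'"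
proof (rule order_tendstoI)
  fix a assume "dd x' v' < a"
  then show "\<forall>\<^sub>F n in sequentially. dd (x n) (v n) < a"
    using dd_upper[OF x v, of "a - dd x' v'"] by simp
next
  fix a assume "a < dd x' v'"
  \<comment> \<open>Oddness turns an upper bound in direction -v into a lower bound in direction v;
    it enters both at the limit and along the sequence.\<close>
  then show "\<forall>\<^sub>F n in sequentially. a < dd (x n) (v n)"
    using dd_upper[OF x tendsto_minus[OF v], of "dd x' v' - a"] by (simp add: anti)
qed

end

section \<open>Continuity of composition on Sobolev spaces\<close>

text \<open>The q-th power of the norm, with the indicator inside, so that estimates avoid roots and
  all functions live on the whole space.\<close>

definition Lq_int :: "real \<Rightarrow> 'a::euclidean_space set \<Rightarrow> ('a \<Rightarrow> 'b::euclidean_space) \<Rightarrow> real" where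
  "Lq_int q U f = (LINT x|lebesgue. norm (indicator U x *\<^sub>R f x) powr q)"

lemma Lq_norm_eq: "Lq_norm q U f = Lq_int q U f powr (1 / q)"
proof -
  have "indicator U x *\<^sub>R norm (f x) powr q = norm (indicator U x *\<^sub>R f x) powr q" for x
    by (simp add: indicator_def)
  then show ?thesis by (simp only: Lq_norm_def Lq_int_def set_lebesgue_integral_def)
qed

lemma Lq_space_iff:
  "f \<in> Lq_space q U \<longleftrightarrow> (\<lambda>x. indicator U x *\<^sub>R f x) \<in> borel_measurable lebesgue \<and>
     integrable lebesgue (\<lambda>x. norm (indicator U x *\<^sub>R f x) powr q)"
proof -
  have "indicator U x *\<^sub>R norm (f x) powr q = norm (indicator U x *\<^sub>R f x) powr q" for x
    by (simp add: indicator_def)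
  then show ?thesis
    by (simp only: Lq_space_def set_borel_measurable_def set_integrable_def mem_Collect_eq)
qed

lemma Lq_int_nonneg: "Lq_int q U f \<ge> 0"
  by (simp add: Lq_int_def integral_nonneg)

lemma Lq_cong_AE:
  assumes f: "f \<in> Lq_space q U" and eq: "AE x in lebesgue. x \<in> U \<longrightarrow> f x = g x"
  shows "g \<in> Lq_space q U" "Lq_int q U g = Lq_int q U f"
proof -
  have ae: "AE x in lebesgue. indicator U x *\<^sub>R f x = indicator U x *\<^sub>R g x"
    using eq by eventually_elim (auto simp: indicator_def)
  have [measurable]: "(\<lambda>x. indicator U x *\<^sub>R f x) \<in> borel_measurable lebesgue" using f by (simp add: Lq_space_iff)
  have [measurable]: "(\<lambda>x. indicator U x *\<^sub>R g x) \<in> borel_measurable lebesgue"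
    by (rule borel_measurable_AE[OF _ ae]) measurable
  have ae': "AE x in lebesgue. norm (indicator U x *\<^sub>R f x) powr q = norm (indicator U x *\<^sub>R g x) powr q"
    using ae by eventually_elim (simp only:)
  have mf: "(\<lambda>x. norm (indicator U x *\<^sub>R f x) powr q) \<in> borel_measurable lebesgue"
    and mg: "(\<lambda>x. norm (indicator U x *\<^sub>R g x) powr q) \<in> borel_measurable lebesgue" by measurable
  show "g \<in> Lq_space q U"
    using integrable_cong_AE_imp[OF _ mg ae'] f by (simp add: Lq_space_iff)
  show "Lq_int q U g = Lq_int q U f"
    unfolding Lq_int_def by (rule integral_cong_AE[OF mf mg ae', symmetric])
qed

lemma powr_add_le:
  fixes a b q :: real
  assumes "a \<ge> 0" "b \<ge> 0" "q \<ge> 0"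
  shows "(a + b) powr q \<le> 2 powr q * (a powr q + b powr q)"
proof -
  have "(a + b) powr q \<le> (2 * max a b) powr q"
    using assms by (intro powr_mono2) auto
  also have "\<dots> = 2 powr q * max a b powr q" using assms by (simp add: powr_mult)
  also have "\<dots> \<le> 2 powr q * (a powr q + b powr q)"
    by (intro mult_left_mono) (auto simp: max_def)
  finally show ?thesis .
qed

lemma Lq_dominated:
  assumes q: "q \<ge> 0" and C: "C \<ge> 0"
    and m: "(\<lambda>x. indicator U x *\<^sub>R f x) \<in> borel_measurable lebesgue" and g: "g \<in> Lq_space q U"
    and le: "\<And>x. x \<in> U \<Longrightarrow> norm (f x) \<le> C * norm (g x)"
  shows "f \<in> Lq_space q U" "Lq_int q U f \<le> C powr q * Lq_int q U g"
proof -
  have pt: "norm (indicator U x *\<^sub>R f x) powr q \<le> C powr q * norm (indicator U x *\<^sub>R g x) powr q" for x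
  proof (cases "x \<in> U")
    case True
    have "norm (f x) powr q \<le> (C * norm (g x)) powr q" using le[OF True] q by (intro powr_mono2) auto
    then show ?thesis using True C by (simp add: powr_mult)
  qed simp
  have i: "integrable lebesgue (\<lambda>x. C powr q * norm (indicator U x *\<^sub>R g x) powr q)"
    using g by (intro integrable_mult_right) (simp add: Lq_space_iff)
  have int: "integrable lebesgue (\<lambda>x. norm (indicator U x *\<^sub>R f x) powr q)"
  proof (rule Bochner_Integration.integrable_bound[OF i])
    show "(\<lambda>x. norm (indicator U x *\<^sub>R f x) powr q) \<in> borel_measurable lebesgue" using m by measurable
    show "AE x in lebesgue. norm (norm (indicator U x *\<^sub>R f x) powr q) \<le> norm (C powr q * norm (indicator U x *\<^sub>R g x) powr q)"
    proof (rule AE_I2)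
      fix x show "norm (norm (indicator U x *\<^sub>R f x) powr q) \<le> norm (C powr q * norm (indicator U x *\<^sub>R g x) powr q)"
        using pt[of x] by (simp only: real_norm_def abs_mult powr_ge_zero abs_of_nonneg)
    qed
  qed
  then show "f \<in> Lq_space q U" using m by (simp only: Lq_space_iff)
  have "Lq_int q U f \<le> (LINT x|lebesgue. C powr q * norm (indicator U x *\<^sub>R g x) powr q)"
    unfolding Lq_int_def by (rule integral_mono[OF int i pt])
  then show "Lq_int q U f \<le> C powr q * Lq_int q U g" by (simp add: Lq_int_def)
qed

lemma Lq_diff:
  assumes q: "q \<ge> 0" and f: "f \<in> Lq_space q U" and g: "g \<in> Lq_space q U"
  shows "(\<lambda>x. f x - g x) \<in> Lq_space q U"
proof -
  have [measurable]: "(\<lambda>x. indicator U x *\<^sub>R f x) \<in> borel_measurable lebesgue"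
    "(\<lambda>x. indicator U x *\<^sub>R g x) \<in> borel_measurable lebesgue" using f g by (auto simp: Lq_space_iff)
  have m: "(\<lambda>x. indicator U x *\<^sub>R (f x - g x)) \<in> borel_measurable lebesgue"
    unfolding scaleR_diff_right by measurable
  have "integrable lebesgue (\<lambda>x. norm (indicator U x *\<^sub>R (f x - g x)) powr q)"
  proof (rule Bochner_Integration.integrable_bound)
    show "integrable lebesgue (\<lambda>x. 2 powr q * (norm (indicator U x *\<^sub>R f x) powr q + norm (indicator U x *\<^sub>R g x) powr q))"
      using f g by (intro integrable_mult_right Bochner_Integration.integrable_add) (auto simp: Lq_space_iff)
    show "(\<lambda>x. norm (indicator U x *\<^sub>R (f x - g x)) powr q) \<in> borel_measurable lebesgue" using m by measurable
    show "AE x in lebesgue. norm (norm (indicator U x *\<^sub>R (f x - g x)) powr q) \<le>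
        norm (2 powr q * (norm (indicator U x *\<^sub>R f x) powr q + norm (indicator U x *\<^sub>R g x) powr q))"
    proof (rule AE_I2)
      fix x
      have "norm (indicator U x *\<^sub>R (f x - g x)) powr q \<le> (norm (indicator U x *\<^sub>R f x) + norm (indicator U x *\<^sub>R g x)) powr q"
        unfolding scaleR_diff_right by (intro powr_mono2 norm_triangle_ineq4) (use q in auto)
      also have "\<dots> \<le> 2 powr q * (norm (indicator U x *\<^sub>R f x) powr q + norm (indicator U x *\<^sub>R g x) powr q)"
        by (rule powr_add_le) (use q in auto)
      finally show "norm (norm (indicator U x *\<^sub>R (f x - g x)) powr q) \<le>
        norm (2 powr q * (norm (indicator U x *\<^sub>R f x) powr q + norm (indicator U x *\<^sub>R g x) powr q))"
        by (simp only: real_norm_def abs_mult powr_ge_zero abs_of_nonneg add_nonneg_nonneg)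
    qed
  qed
  with m show ?thesis by (simp only: Lq_space_iff)
qed

lemma Lq_norm_tendsto_iff:
  assumes q: "q > 0"
  shows "(\<lambda>n. Lq_norm q U (f n)) \<longlonglongrightarrow> 0 \<longleftrightarrow> (\<lambda>n. Lq_int q U (f n)) \<longlonglongrightarrow> 0"
proof
  assume "(\<lambda>n. Lq_int q U (f n)) \<longlonglongrightarrow> 0"
  then have "(\<lambda>n. Lq_int q U (f n) powr (1 / q)) \<longlonglongrightarrow> 0 powr (1 / q)"
    using q Lq_int_nonneg by (intro tendsto_powr') (auto intro!: always_eventually)
  then show "(\<lambda>n. Lq_norm q U (f n)) \<longlonglongrightarrow> 0" by (simp add: Lq_norm_eq)
next
  assume "(\<lambda>n. Lq_norm q U (f n)) \<longlonglongrightarrow> 0"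
  then have "(\<lambda>n. Lq_norm q U (f n) powr q) \<longlonglongrightarrow> 0 powr q"
    using q by (intro tendsto_powr') (auto simp: Lq_norm_def intro!: always_eventually)
  moreover have "Lq_norm q U (f n) powr q = Lq_int q U (f n)" for n
    using q Lq_int_nonneg[of q U "f n"] by (simp add: Lq_norm_eq powr_powr)
  ultimately show "(\<lambda>n. Lq_int q U (f n)) \<longlonglongrightarrow> 0" by simp
qed

text \<open>Dominated convergence with the varying majorant \<open>norm g + norm (p n)\<close>: the part below
  \<open>norm g\<close> is handled by truncation, the rest is bounded by \<open>norm (p n)\<close>.\<close>

lemma Lq_int_tendsto_0:
  fixes d :: "nat \<Rightarrow> 'a::euclidean_space \<Rightarrow> 'b::euclidean_space" and g :: "'a \<Rightarrow> 'c::euclidean_space"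
    and p :: "nat \<Rightarrow> 'a \<Rightarrow> 'c"
  assumes q: "q > 0" and C: "C \<ge> 0" and g: "g \<in> Lq_space q U" and p: "\<And>n. p n \<in> Lq_space q U"
    and d: "\<And>n. d n \<in> Lq_space q U"
    and le: "\<And>n x. x \<in> U \<Longrightarrow> norm (d n x) \<le> C * (norm (g x) + norm (p n x))"
    and d0: "AE x in lebesgue. x \<in> U \<longrightarrow> (\<lambda>n. d n x) \<longlonglongrightarrow> 0"
    and p0: "(\<lambda>n. Lq_int q U (p n)) \<longlonglongrightarrow> 0"
  shows "(\<lambda>n. Lq_int q U (d n)) \<longlonglongrightarrow> 0"
proof -
  \<comment> \<open>The factor \<open>C powr q\<close> comes from the majorant, the factor
    \<open>2 powr q\<close> from \<open>powr_add_le\<close>.\<close>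
  define A where "A = C powr q * 2 powr q"
  have A: "A \<ge> 0" by (simp add: A_def)
  let ?d = "\<lambda>n x. norm (indicator U x *\<^sub>R d n x) powr q"
  let ?g = "\<lambda>x. A * norm (indicator U x *\<^sub>R g x) powr q"
  let ?p = "\<lambda>n x. A * norm (indicator U x *\<^sub>R p n x) powr q"
  have id: "integrable lebesgue (?d n)" for n using d[of n] by (simp only: Lq_space_iff)
  have ig: "integrable lebesgue ?g" using g by (intro integrable_mult_right) (simp only: Lq_space_iff)
  have ip: "integrable lebesgue (?p n)" for n using p[of n] by (intro integrable_mult_right) (simp only: Lq_space_iff)
  have pt: "?d n x \<le> ?g x + ?p n x" for n x
  proof (cases "x \<in> U")
    case True
    have "norm (d n x) powr q \<le> (C * (norm (g x) + norm (p n x))) powr q"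
      using le[OF True] q by (intro powr_mono2) auto
    also have "\<dots> = C powr q * (norm (g x) + norm (p n x)) powr q" using C by (simp add: powr_mult)
    also have "\<dots> \<le> C powr q * (2 powr q * (norm (g x) powr q + norm (p n x) powr q))"
      using q by (intro mult_left_mono powr_add_le) auto
    finally show ?thesis using True by (simp add: A_def algebra_simps)
  qed simp
  have im: "integrable lebesgue (\<lambda>x. min (?d n x) (?g x))" for n
    using id ig by (rule integrable_min)
  have lim: "(\<lambda>n. LINT x|lebesgue. min (?d n x) (?g x)) \<longlonglongrightarrow> (LINT x|(lebesgue :: 'a measure). 0)"
  proof (rule integral_dominated_convergence[OF _ _ ig])
    show "(\<lambda>x. min (?d n x) (?g x)) \<in> borel_measurable lebesgue" for n using im by auto
    show "AE x in lebesgue. norm (min (?d n x) (?g x)) \<le> ?g x" for n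
      using A by (intro AE_I2) (auto simp: min_def)
    show "AE x in lebesgue. (\<lambda>n. min (?d n x) (?g x)) \<longlonglongrightarrow> 0"
      using d0
    proof eventually_elim
      case (elim x)
      have "(\<lambda>n. ?d n x) \<longlonglongrightarrow> 0 powr q"
      proof (cases "x \<in> U")
        case True
        then show ?thesis using elim q by (intro tendsto_powr') (auto intro: tendsto_norm_zero)
      qed simp
      then have "(\<lambda>n. min (?d n x) (?g x)) \<longlonglongrightarrow> min 0 (?g x)" by (intro tendsto_min) simp_all
      then show ?case using A by (simp add: min_def)
    qed
  qed simp
  have "Lq_int q U (d n) \<le> (LINT x|lebesgue. min (?d n x) (?g x)) + A * Lq_int q U (p n)" for n
  proof -
    have "?d n x \<le> min (?d n x) (?g x) + ?p n x" for x
      using pt[of x n] A by (auto simp: min_def)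
    then have "Lq_int q U (d n) \<le> (LINT x|lebesgue. min (?d n x) (?g x) + ?p n x)"
      unfolding Lq_int_def by (intro integral_mono id Bochner_Integration.integrable_add im ip)
    also have "\<dots> = (LINT x|lebesgue. min (?d n x) (?g x)) + (LINT x|lebesgue. ?p n x)"
      by (rule Bochner_Integration.integral_add[OF im ip])
    finally show ?thesis by (simp add: Lq_int_def)
  qed
  moreover have "(\<lambda>n. (LINT x|lebesgue. min (?d n x) (?g x)) + A * Lq_int q U (p n)) \<longlonglongrightarrow> 0"
    using tendsto_add[OF lim tendsto_mult_left[OF p0, where c = A]] by simp
  ultimately show ?thesis
    by (rule tendsto_sandwich[OF eventuallyI eventuallyI tendsto_const, rotated]) (rule Lq_int_nonneg)
qed

section \<open>Linearity of weak derivatives, and independence of values outside the domain\<close>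

lemma locally_integrable_add:
  "locally_integrable U f \<Longrightarrow> locally_integrable U g \<Longrightarrow> locally_integrable U (\<lambda>x. f x + g x)"
  by (auto simp: locally_integrable_def intro!: set_integral_add)

lemma is_weak_partial_zero: "is_weak_partial U b (\<lambda>x. 0) (\<lambda>x. 0)"
  by (simp add: is_weak_partial_def locally_integrable_def set_integrable_def set_lebesgue_integral_def)

lemma is_weak_partial_add:
  fixes f f' g g' :: "'a::euclidean_space \<Rightarrow> 'b::euclidean_space"
  assumes b: "b \<in> Basis" and f: "is_weak_partial U b f f'" and g: "is_weak_partial U b g g'"
  shows "is_weak_partial U b (\<lambda>x. f x + g x) (\<lambda>x. f' x + g' x)"
proof -
  have loc: "locally_integrable U f" "locally_integrable U f'" "locally_integrable U g" "locally_integrable U g'"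
    using f g by (auto simp: is_weak_partial_def)
  show ?thesis unfolding is_weak_partial_def
  proof (intro conjI allI impI)
    fix \<phi> :: "'a \<Rightarrow> real" assume \<phi>: "test_function U \<phi>"
    note \<phi>' = test_function_partial[OF \<phi> b]
    show "(LINT x:U|lebesgue. partial_deriv b \<phi> x *\<^sub>R (f x + g x)) = - (LINT x:U|lebesgue. \<phi> x *\<^sub>R (f' x + g' x))"
      unfolding scaleR_add_right
        set_integral_add(2)[OF integrable_test_locally[OF \<phi>' loc(1)] integrable_test_locally[OF \<phi>' loc(3)]]
        set_integral_add(2)[OF integrable_test_locally[OF \<phi> loc(2)] integrable_test_locally[OF \<phi> loc(4)]]
      using f g \<phi> by (simp add: is_weak_partial_def)
  qed (auto intro: locally_integrable_add loc)
qed

lemma is_weak_partial_scaleR: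
  fixes f f' :: "'a::euclidean_space \<Rightarrow> real" and c :: "'b::euclidean_space"
  assumes b: "b \<in> Basis" and f: "is_weak_partial U b f f'"
  shows "is_weak_partial U b (\<lambda>x. f x *\<^sub>R c) (\<lambda>x. f' x *\<^sub>R c)"
proof -
  have loc: "locally_integrable U (\<lambda>x. k x *\<^sub>R c)" if "locally_integrable U k" for k :: "'a \<Rightarrow> real"
    unfolding locally_integrable_def set_integrable_def
  proof safe
    fix K assume "compact K" "K \<subseteq> U"
    with that have "integrable lebesgue (\<lambda>x. indicator K x *\<^sub>R k x)"
      by (simp add: locally_integrable_def set_integrable_def)
    from integrable_scaleR_left[OF this, of c] show "integrable lebesgue (\<lambda>x. indicat_real K x *\<^sub>R k x *\<^sub>R c)"
      by simp
  qed
  have int: "(LINT x:U|lebesgue. \<psi> x *\<^sub>R k x *\<^sub>R c) = (LINT x:U|lebesgue. \<psi> x *\<^sub>R k x) *\<^sub>R c"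
    if "test_function U \<psi>" "locally_integrable U k" for \<psi> k :: "'a \<Rightarrow> real"
    using integral_scaleR_left[of c lebesgue "\<lambda>x. indicator U x *\<^sub>R \<psi> x *\<^sub>R k x"] integrable_test_locally[OF that]
    by (simp add: set_lebesgue_integral_def set_integrable_def)
  show ?thesis
    unfolding is_weak_partial_def
  proof (intro conjI allI impI)
    fix \<phi> :: "'a \<Rightarrow> real" assume \<phi>: "test_function U \<phi>"
    show "(LINT x:U|lebesgue. partial_deriv b \<phi> x *\<^sub>R f x *\<^sub>R c) = - (LINT x:U|lebesgue. \<phi> x *\<^sub>R f' x *\<^sub>R c)"
      using f \<phi> int[OF \<phi>] int[OF test_function_partial[OF \<phi> b]]
      by (simp add: is_weak_partial_def del: scaleR_scaleR real_scaleR_def)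
  qed (use f in \<open>auto simp: is_weak_partial_def intro!: loc\<close>)
qed

lemma is_weak_partial_sum:
  fixes f f' :: "'k \<Rightarrow> 'a::euclidean_space \<Rightarrow> 'b::euclidean_space"
  assumes b: "b \<in> Basis" and "finite I" "\<And>k. k \<in> I \<Longrightarrow> is_weak_partial U b (f k) (f' k)"
  shows "is_weak_partial U b (\<lambda>x. \<Sum>k\<in>I. f k x) (\<lambda>x. \<Sum>k\<in>I. f' k x)"
  using assms(2,3)
  by (induction I rule: finite_induct) (simp_all add: is_weak_partial_zero is_weak_partial_add[OF b])

lemma is_weak_partial_minus:
  fixes f f' :: "'a::euclidean_space \<Rightarrow> 'b::euclidean_space"
  assumes "is_weak_partial U b f f'"
  shows "is_weak_partial U b (\<lambda>x. - f x) (\<lambda>x. - f' x)"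
  using assms
  by (auto simp: is_weak_partial_def locally_integrable_def set_integrable_def set_lebesgue_integral_def)

lemma is_weak_partial_diff:
  fixes f f' g g' :: "'a::euclidean_space \<Rightarrow> 'b::euclidean_space"
  assumes "b \<in> Basis" "is_weak_partial U b f f'" "is_weak_partial U b g g'"
  shows "is_weak_partial U b (\<lambda>x. f x - g x) (\<lambda>x. f' x - g' x)"
  using is_weak_partial_add[OF assms(1,2) is_weak_partial_minus[OF assms(3)]] by simp

lemma weak_partial_AE:
  assumes "open U" "is_weak_partial U b f g"
  shows "AE x in lebesgue. x \<in> U \<longrightarrow> g x = weak_partial U b f x"
proof -
  have "is_weak_partial U b f (weak_partial U b f)"
    unfolding weak_partial_def by (rule someI[of "is_weak_partial U b f", OF assms(2)])
  from weak_partial_unique[OF assms this] show ?thesis .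
qed

lemma sobolev_weak_partial:
  assumes U: "open U" and u: "u \<in> sobolev q U" and b: "b \<in> Basis"
  shows "is_weak_partial U b u (weak_partial U b u)" "weak_partial U b u \<in> Lq_space q U"
proof -
  obtain g where g: "g \<in> Lq_space q U" "is_weak_partial U b u g" using u b by (auto simp: sobolev_def)
  show "is_weak_partial U b u (weak_partial U b u)" 
    unfolding weak_partial_def by (rule someI[of "is_weak_partial U b u", OF g(2)])
  show "weak_partial U b u \<in> Lq_space q U" by (rule Lq_cong_AE(1)[OF g(1) weak_partial_AE[OF U g(2)]])
qed

text \<open>The extension of the spectral map to all matrices agrees with it only at normal ones,
  hence along a given Sobolev map only on \<open>U\<close>; this carries membership and norms
  over.\<close>

lemma sobolev_cong:
  fixes f g :: "'a::euclidean_space \<Rightarrow> 'b::euclidean_space"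
  assumes "\<And>x. x \<in> U \<Longrightarrow> f x = g x"
  shows "f \<in> sobolev q U \<longleftrightarrow> g \<in> sobolev q U" "sobolev_norm q U f = sobolev_norm q U g"
proof -
  have ind: "(\<lambda>x. indicat_real K x *\<^sub>R f x) = (\<lambda>x. indicat_real K x *\<^sub>R g x)" if "K \<subseteq> U" for K
    using assms that by (auto simp: indicator_def fun_eq_iff)
  have Lq: "f \<in> Lq_space q U \<longleftrightarrow> g \<in> Lq_space q U" "Lq_norm q U f = Lq_norm q U g"
    unfolding Lq_space_iff Lq_norm_eq Lq_int_def by (simp_all only: fun_cong[OF ind[OF subset_refl]])
  have loc: "locally_integrable U f \<longleftrightarrow> locally_integrable U g"
    unfolding locally_integrable_def set_integrable_def using ind by auto
  have "(LINT x:U|lebesgue. \<phi> x *\<^sub>R f x) = (LINT x:U|lebesgue. \<phi> x *\<^sub>R g x)" for \<phi>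
    unfolding set_lebesgue_integral_def
    by (intro Bochner_Integration.integral_cong) (auto simp: indicator_def assms)
  then have weak: "is_weak_partial U b f = is_weak_partial U b g" for b
    by (simp add: is_weak_partial_def loc fun_eq_iff)
  show "f \<in> sobolev q U \<longleftrightarrow> g \<in> sobolev q U" "sobolev_norm q U f = sobolev_norm q U g"
    by (simp_all add: sobolev_def sobolev_norm_def weak_partial_def Lq weak)
qed

section \<open>Composition with vector-valued differences of convex Lipschitz functions\<close>

text \<open>Signs are absorbed in the vector coefficients \<open>c\<close>, so differences of convex
  functions and all target coordinates are covered by one finite sum.\<close>

locale dc_map =
  fixes I :: "'k set" and f :: "'k \<Rightarrow> 'v::euclidean_space \<Rightarrow> real" and L :: "'k \<Rightarrow> real"
    and c :: "'k \<Rightarrow> 'w::euclidean_space"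
  assumes fin: "finite I" and cl: "convex_lipschitz (f k) (L k)"
begin

definition F :: "'v \<Rightarrow> 'w" where
  "F x = (\<Sum>k\<in>I. f k x *\<^sub>R c k)"

text \<open>By the right chain rule this everywhere defined, possibly nonlinear expression yields a
  representative of the weak derivative of the composition.\<close>

definition DF :: "'v \<Rightarrow> 'v \<Rightarrow> 'w" where
  "DF x v = (\<Sum>k\<in>I. convex_lipschitz.dd (f k) x v *\<^sub>R c k)"

definition C :: real where
  "C = (\<Sum>k\<in>I. L k * norm (c k))"

lemma C_nonneg: "C \<ge> 0"
  unfolding C_def using convex_lipschitz.L[OF cl] by (auto intro!: sum_nonneg)

lemma F_lipschitz: "norm (F x - F y) \<le> C * norm (x - y)"
proof -
  have "norm (F x - F y) = norm (\<Sum>k\<in>I. (f k x - f k y) *\<^sub>R c k)"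
    by (simp add: F_def sum_subtractf scaleR_diff_left)
  also have "\<dots> \<le> (\<Sum>k\<in>I. (L k * norm (x - y)) * norm (c k))"
    using convex_lipschitz.lip[OF cl] by (intro sum_norm_le) (auto intro!: mult_right_mono)
  also have "\<dots> = C * norm (x - y)" by (simp add: C_def sum_distrib_right sum_distrib_left mult_ac)
  finally show ?thesis .
qed

lemma F_0: "F 0 = 0"
  using convex_lipschitz.f0[OF cl] by (simp add: F_def)

lemma DF_bound: "norm (DF x v) \<le> C * norm v"
proof -
  interpret k: convex_lipschitz "f k" "L k" for k by (rule cl)
  have "norm (DF x v) \<le> (\<Sum>k\<in>I. (L k * norm v) * norm (c k))"
    unfolding DF_def using k.right.Df_bound by (intro sum_norm_le) (auto intro!: mult_right_mono)
  also have "\<dots> = C * norm v" by (simp add: C_def sum_distrib_right sum_distrib_left mult_ac)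
  finally show ?thesis .
qed

lemma borel_F: "F \<in> borel_measurable borel"
proof -
  interpret k: convex_lipschitz "f k" "L k" for k by (rule cl)
  show ?thesis unfolding F_def using k.right.borel_f by measurable
qed

lemma borel_DF:
  assumes "u \<in> borel_measurable M" "g \<in> borel_measurable M"
  shows "(\<lambda>x. DF (u x) (g x)) \<in> borel_measurable M"
proof -
  interpret k: convex_lipschitz "f k" "L k" for k by (rule cl)
  show ?thesis unfolding DF_def using k.right.measurable_Df[OF assms] by measurable
qed

lemma F_weak_partial:
  assumes "b \<in> Basis" "open U" "is_weak_partial U b u g"
  shows "is_weak_partial U b (\<lambda>x. F (u x)) (\<lambda>x. DF (u x) (g x))"
proof -
  interpret k: convex_lipschitz "f k" "L k" for k by (rule cl)
  show ?thesis unfolding F_def DF_def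
    by (intro is_weak_partial_sum is_weak_partial_scaleR k.right.chain_rule assms fin)
qed

lemma indicator_F: "indicator U x *\<^sub>R F y = F (indicator U x *\<^sub>R y)"
  by (simp add: indicator_def F_0)

lemma indicator_DF: "indicator U x *\<^sub>R DF y v = DF (indicator U x *\<^sub>R y) (indicator U x *\<^sub>R v)"
proof -
  have "DF 0 0 = 0" using DF_bound[of 0 0] by simp
  then show ?thesis by (simp add: indicator_def)
qed

lemma F_Lq:
  assumes q: "q \<ge> 1" and u: "u \<in> Lq_space q U"
  shows "(\<lambda>x. F (u x)) \<in> Lq_space q U"
proof (rule Lq_dominated(1)[OF _ C_nonneg _ u])
  have "(\<lambda>x. indicator U x *\<^sub>R u x) \<in> borel_measurable lebesgue" using u by (simp add: Lq_space_iff)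
  then show "(\<lambda>x. indicator U x *\<^sub>R F (u x)) \<in> borel_measurable lebesgue"
    unfolding indicator_F using borel_F by measurable
  show "norm (F (u x)) \<le> C * norm (u x)" for x using F_lipschitz[of "u x" 0] by (simp add: F_0)
qed (use q in simp)

lemma DF_Lq:
  assumes q: "q \<ge> 1" and u: "u \<in> Lq_space q U" and g: "g \<in> Lq_space q U"
  shows "(\<lambda>x. DF (u x) (g x)) \<in> Lq_space q U"
proof (rule Lq_dominated(1)[OF _ C_nonneg _ g])
  show "(\<lambda>x. indicator U x *\<^sub>R DF (u x) (g x)) \<in> borel_measurable lebesgue"
    unfolding indicator_DF using u g by (intro borel_DF) (auto simp: Lq_space_iff)
qed (use q DF_bound in auto)

lemma F_sobolev:
  assumes q: "q \<ge> 1" and U: "open U" and u: "u \<in> sobolev q U"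
  shows "(\<lambda>x. F (u x)) \<in> sobolev q U"
proof -
  have uL: "u \<in> Lq_space q U" using u by (simp add: sobolev_def)
  have "\<exists>g\<in>Lq_space q U. is_weak_partial U b (\<lambda>x. F (u x)) g" if b: "b \<in> Basis" for b
    using F_weak_partial[OF b U sobolev_weak_partial(1)[OF U u b]] DF_Lq[OF q uL sobolev_weak_partial(2)[OF U u b]]
    by blast
  then show ?thesis using F_Lq[OF q uL] by (simp add: sobolev_def)
qed

lemma DF_tendsto:
  assumes "x \<longlonglongrightarrow> x'" "v \<longlonglongrightarrow> v'"
    and "\<And>k. k \<in> I \<Longrightarrow> convex_lipschitz.dd (f k) x' (- v') = - convex_lipschitz.dd (f k) x' v'"
    and "\<And>k n. k \<in> I \<Longrightarrow> convex_lipschitz.dd (f k) (x n) (- v n) = - convex_lipschitz.dd (f k) (x n) (v n)"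
  shows "(\<lambda>n. DF (x n) (v n)) \<longlonglongrightarrow> DF x' v'"
  unfolding DF_def
  by (intro tendsto_sum tendsto_scaleR tendsto_const convex_lipschitz.dd_tendsto_antisym[OF cl] assms)

text \<open>Finiteness of \<open>I\<close> gives a single null set for all components.\<close>

lemma antisym_AE:
  fixes u g :: "'a::euclidean_space \<Rightarrow> 'v"
  assumes "b \<in> Basis" "open U" "is_weak_partial U b u g"
  shows "AE x in lebesgue. x \<in> U \<longrightarrow>
    (\<forall>k\<in>I. convex_lipschitz.dd (f k) (u x) (- g x) = - convex_lipschitz.dd (f k) (u x) (g x))"
proof -
  have "AE x in lebesgue. \<forall>k\<in>I. x \<in> U \<longrightarrow>
    convex_lipschitz.dd (f k) (u x) (- g x) = - convex_lipschitz.dd (f k) (u x) (g x)"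
    using fin convex_lipschitz.dd_antisym_AE[OF cl assms] by (intro AE_finite_allI) auto
  then show ?thesis by eventually_elim blast
qed

text \<open>L^q convergence gives pointwise convergence only along a subsequence, and pointwise
  convergence is what \<open>DF_tendsto\<close> needs. \<open>Lq_int_tendsto_0\<close> then returns
  to L^q.\<close>

lemma sobolev_norm_tendsto_subseq:
  fixes u :: "'a::euclidean_space \<Rightarrow> 'v" and w :: "nat \<Rightarrow> 'a \<Rightarrow> 'v"
  assumes q: "q \<ge> 1" and U: "open U" and u: "u \<in> sobolev q U" and w: "\<And>n. w n \<in> sobolev q U"
    and lim: "(\<lambda>n. sobolev_norm q U (\<lambda>x. u x - w n x)) \<longlonglongrightarrow> 0"
  shows "\<exists>r. strict_mono r \<and> (\<lambda>n. sobolev_norm q U (\<lambda>x. F (u x) - F (w (r n) x))) \<longlonglongrightarrow> 0"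
proof -
  have q0: "q > 0" "q \<ge> 0" using q by auto
  have uL: "u \<in> Lq_space q U" and wL: "\<And>n. w n \<in> Lq_space q U" using u w by (auto simp: sobolev_def)
  define D where "D b = weak_partial U b u" for b
  define E where "E b n = weak_partial U b (w n)" for b n
  have D: "is_weak_partial U b u (D b)" "D b \<in> Lq_space q U" if "b \<in> Basis" for b
    unfolding D_def using sobolev_weak_partial[OF U u that] by auto
  have E: "is_weak_partial U b (w n) (E b n)" "E b n \<in> Lq_space q U" if "b \<in> Basis" for b n
    unfolding E_def using sobolev_weak_partial[OF U w that] by auto
  define p where "p n x = u x - w n x" for n x
  define P where "P b n x = D b x - E b n x" for b n x
  have pL: "p n \<in> Lq_space q U" for n unfolding p_def by (rule Lq_diff[OF q0(2) uL wL])
  have PL: "P b n \<in> Lq_space q U" if "b \<in> Basis" for b n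
    unfolding P_def using that by (intro Lq_diff[OF q0(2)] D E)
  \<comment> \<open>\<open>weak_partial\<close> is an arbitrary choice, so the chosen derivative of
    u - w n is known to equal \<open>P b n\<close> only almost everywhere on
    \<open>U\<close>.\<close>
  have Pn: "Lq_int q U (weak_partial U b (p n)) = Lq_int q U (P b n)" if b: "b \<in> Basis" for b n
  proof (rule Lq_cong_AE(2)[OF PL[OF b]])
    show "AE x in lebesgue. x \<in> U \<longrightarrow> P b n x = weak_partial U b (p n) x"
      using weak_partial_AE[OF U is_weak_partial_diff[OF b D(1)[OF b] E(1)[OF b]]]
      unfolding p_def P_def .
  qed
  have nonneg: "Lq_norm q U k \<ge> 0" for k :: "'a \<Rightarrow> 'v" by (simp add: Lq_norm_def)
  have p0: "(\<lambda>n. Lq_int q U (p n)) \<longlonglongrightarrow> 0"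
  proof -
    have "(\<lambda>n. Lq_norm q U (p n)) \<longlonglongrightarrow> 0"
    proof (rule tendsto_sandwich[OF eventuallyI eventuallyI tendsto_const lim])
      show "Lq_norm q U (p n) \<le> sobolev_norm q U (\<lambda>x. u x - w n x)" for n
        unfolding sobolev_norm_def p_def using nonneg by (simp add: sum_nonneg)
    qed (rule nonneg)
    then show ?thesis by (simp add: Lq_norm_tendsto_iff[OF q0(1)])
  qed
  have P0: "(\<lambda>n. Lq_int q U (P b n)) \<longlonglongrightarrow> 0" if b: "b \<in> Basis" for b
  proof -
    have "(\<lambda>n. Lq_norm q U (weak_partial U b (p n))) \<longlonglongrightarrow> 0"
    proof (rule tendsto_sandwich[OF eventuallyI eventuallyI tendsto_const lim])
      fix n
      have "Lq_norm q U (weak_partial U b (p n)) \<le> (\<Sum>b\<in>Basis. Lq_norm q U (weak_partial U b (p n)))"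
        using b nonneg by (intro member_le_sum) auto
      then show "Lq_norm q U (weak_partial U b (p n)) \<le> sobolev_norm q U (\<lambda>x. u x - w n x)"
        unfolding sobolev_norm_def using nonneg[of "p n"] by (simp add: p_def[abs_def])
    qed (rule nonneg)
    then show ?thesis by (simp add: Lq_norm_tendsto_iff[OF q0(1)] Pn[OF b])
  qed
  \<comment> \<open>All q-th powers are collected in one function, so that one subsequence serves
    the maps and all their partial derivatives.\<close>
  define S where "S n x = norm (indicator U x *\<^sub>R p n x) powr q + (\<Sum>b\<in>Basis. norm (indicator U x *\<^sub>R P b n x) powr q)" for n x
  have Sint: "integrable lebesgue (S n)" for n
    unfolding S_def using pL[of n] PL[of _ n]
    by (intro Bochner_Integration.integrable_add Bochner_Integration.integrable_sum) (simp_all only: Lq_space_iff)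
  have Snonneg: "S n x \<ge> 0" for n x by (auto simp: S_def intro!: add_nonneg_nonneg sum_nonneg)
  have "(\<lambda>n. LINT x|lebesgue. norm (S n x)) \<longlonglongrightarrow> 0"
  proof -
    have "(LINT x|lebesgue. norm (S n x)) = Lq_int q U (p n) + (\<Sum>b\<in>Basis. Lq_int q U (P b n))" for n
    proof -
      have ip: "integrable lebesgue (\<lambda>x. norm (indicator U x *\<^sub>R p n x) powr q)"
        using pL[of n] by (simp only: Lq_space_iff)
      have iP: "integrable lebesgue (\<lambda>x. norm (indicator U x *\<^sub>R P b n x) powr q)" if "b \<in> Basis" for b
        using PL[OF that, of n] by (simp only: Lq_space_iff)
      have "(LINT x|lebesgue. norm (S n x)) = (LINT x|lebesgue. S n x)"
        using Snonneg by (simp only: real_norm_def abs_of_nonneg)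
      also have "\<dots> = (LINT x|lebesgue. norm (indicator U x *\<^sub>R p n x) powr q) + 
          (\<Sum>b\<in>Basis. LINT x|lebesgue. norm (indicator U x *\<^sub>R P b n x) powr q)"
        unfolding S_def
        by (subst Bochner_Integration.integral_add[OF ip Bochner_Integration.integrable_sum[OF iP]])
          (simp_all only: Bochner_Integration.integral_sum[OF iP])
      finally show ?thesis by (simp only: Lq_int_def)
    qed
    moreover have "(\<lambda>n. Lq_int q U (p n) + (\<Sum>b\<in>(Basis::'a set). Lq_int q U (P b n))) \<longlonglongrightarrow> 0 + (\<Sum>b\<in>(Basis::'a set). 0)"
      by (intro tendsto_add tendsto_sum p0 P0)
    ultimately show ?thesis by simp
  qed
  from tendsto_L1_AE_subseq[OF Sint this] obtain r where
    r: "strict_mono r" and S0: "AE x in lebesgue. (\<lambda>n. S (r n) x) \<longlonglongrightarrow> 0" by auto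
  have root: "(\<lambda>n. a n) \<longlonglongrightarrow> 0"
    if "S' \<longlonglongrightarrow> 0" "\<And>n. norm (a n) powr q \<le> S' n" for a :: "nat \<Rightarrow> 'v" and S' :: "nat \<Rightarrow> real"
  proof -
    have "(\<lambda>n. norm (a n) powr q) \<longlonglongrightarrow> 0"
      by (rule tendsto_sandwich[OF eventuallyI eventuallyI tendsto_const that(1)]) (use that(2) in auto)
    then have "(\<lambda>n. (norm (a n) powr q) powr (1 / q)) \<longlonglongrightarrow> 0 powr (1 / q)"
      using q0 by (intro tendsto_powr') auto
    then show ?thesis using q0 by (simp add: powr_powr tendsto_norm_zero_iff)
  qed
  have ulim: "AE x in lebesgue. x \<in> U \<longrightarrow> (\<lambda>n. w (r n) x) \<longlonglongrightarrow> u x"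
    using S0
  proof eventually_elim
    case (elim x)
    show ?case
    proof
      assume x: "x \<in> U"
      have "(\<lambda>n. p (r n) x) \<longlonglongrightarrow> 0"
      proof (rule root[OF elim])
        show "norm (p (r n) x) powr q \<le> S (r n) x" for n
          using x by (auto simp: S_def intro!: sum_nonneg)
      qed
      from tendsto_diff[OF tendsto_const this, of "u x"] show "(\<lambda>n. w (r n) x) \<longlonglongrightarrow> u x"
        by (simp add: p_def)
    qed
  qed
  have Dlim: "AE x in lebesgue. x \<in> U \<longrightarrow> (\<lambda>n. E b (r n) x) \<longlonglongrightarrow> D b x" if b: "b \<in> Basis" for b
    using S0
  proof eventually_elim
    case (elim x)
    show ?case
    proof
      assume x: "x \<in> U"
      have "(\<lambda>n. P b (r n) x) \<longlonglongrightarrow> 0"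
      proof (rule root[OF elim])
        fix n
        have "norm (indicator U x *\<^sub>R P b (r n) x) powr q \<le> (\<Sum>b\<in>Basis. norm (indicator U x *\<^sub>R P b (r n) x) powr q)"
          using b by (intro member_le_sum[of b Basis "\<lambda>b. norm (indicator U x *\<^sub>R P b (r n) x) powr q"]) auto
        then show "norm (P b (r n) x) powr q \<le> S (r n) x"
          using x by (simp add: S_def add_increasing)
      qed
      from tendsto_diff[OF tendsto_const this, of "D b x"] show "(\<lambda>n. E b (r n) x) \<longlonglongrightarrow> D b x"
        by (simp add: P_def)
    qed
  qed
  define G where "G b n x = DF (u x) (D b x) - DF (w n x) (E b n x)" for b n x
  have GL: "G b n \<in> Lq_space q U" if b: "b \<in> Basis" for b n
    unfolding G_def by (intro Lq_diff[OF q0(2)] DF_Lq[OF q] uL wL D(2)[OF b] E(2)[OF b])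
  \<comment> \<open>\<open>E b n\<close> is bounded by \<open>D b\<close> plus \<open>P b n\<close>,
    so the majorant consists of a fixed function and one that tends to 0 in L^q.\<close>
  have Gbound: "norm (G b n x) \<le> (2 * C) * (norm (D b x) + norm (P b n x))" for b n x
  proof -
    have "norm (G b n x) \<le> C * norm (D b x) + C * norm (E b n x)"
      unfolding G_def by (rule order.trans[OF norm_triangle_ineq4 add_mono[OF DF_bound DF_bound]])
    also have "norm (E b n x) \<le> norm (D b x) + norm (P b n x)" 
      unfolding P_def by (metis add.commute norm_minus_commute norm_triangle_sub)
    finally have "norm (G b n x) \<le> C * norm (D b x) + C * (norm (D b x) + norm (P b n x))"
      using C_nonneg by (simp add: mult_left_mono)
    also have "\<dots> \<le> (2 * C) * (norm (D b x) + norm (P b n x))"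
      using C_nonneg by (simp add: algebra_simps)
    finally show ?thesis .
  qed
  have G0: "AE x in lebesgue. x \<in> U \<longrightarrow> (\<lambda>n. G b (r n) x) \<longlonglongrightarrow> 0" if b: "b \<in> Basis" for b
  proof -
    \<comment> \<open>The exceptional null set of \<open>w n\<close> depends on \<open>n\<close>;
      countably many of them are joined here.\<close>
    have "AE x in lebesgue. \<forall>n. x \<in> U \<longrightarrow>
      (\<forall>k\<in>I. convex_lipschitz.dd (f k) (w n x) (- E b n x) = - convex_lipschitz.dd (f k) (w n x) (E b n x))"
      unfolding AE_all_countable using antisym_AE[OF b U E(1)[OF b]] by blast
    with antisym_AE[OF b U D(1)[OF b]] ulim Dlim[OF b] show ?thesis
    proof eventually_elim
      case (elim x)
      show ?case
      proof
        assume x: "x \<in> U"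
        have "(\<lambda>n. DF (w (r n) x) (E b (r n) x)) \<longlonglongrightarrow> DF (u x) (D b x)"
          by (rule DF_tendsto) (use elim x in auto)
        from tendsto_diff[OF tendsto_const this, of "DF (u x) (D b x)"]
        show "(\<lambda>n. G b (r n) x) \<longlonglongrightarrow> 0" by (simp add: G_def)
      qed
    qed
  qed
  have Gint: "(\<lambda>n. Lq_norm q U (weak_partial U b (\<lambda>x. F (u x) - F (w (r n) x)))) \<longlonglongrightarrow> 0" if b: "b \<in> Basis" for b
  proof -
    have eq: "Lq_int q U (weak_partial U b (\<lambda>x. F (u x) - F (w n x))) = Lq_int q U (G b n)" for n
    proof (rule Lq_cong_AE(2)[OF GL[OF b]])
      show "AE x in lebesgue. x \<in> U \<longrightarrow> G b n x = weak_partial U b (\<lambda>x. F (u x) - F (w n x)) x"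
        using weak_partial_AE[OF U is_weak_partial_diff[OF b F_weak_partial[OF b U D(1)[OF b]] F_weak_partial[OF b U E(1)[OF b]]]]
        unfolding G_def .
    qed
    have "(\<lambda>n. Lq_int q U (G b (r n))) \<longlonglongrightarrow> 0"
    proof (rule Lq_int_tendsto_0[OF q0(1) _ D(2)[OF b] PL[OF b] GL[OF b] Gbound G0[OF b]])
      show "0 \<le> 2 * C" using C_nonneg by simp
      show "(\<lambda>n. Lq_int q U (P b (r n))) \<longlonglongrightarrow> 0"
        using LIMSEQ_subseq_LIMSEQ[OF P0[OF b] r] by (simp add: comp_def)
    qed
    then show ?thesis by (simp add: Lq_norm_tendsto_iff[OF q0(1)] eq)
  qed
  have "(\<lambda>n. Lq_norm q U (\<lambda>x. F (u x) - F (w (r n) x))) \<longlonglongrightarrow> 0"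
    unfolding Lq_norm_tendsto_iff[OF q0(1)]
  proof (rule tendsto_sandwich[OF eventuallyI eventuallyI tendsto_const])
    have "(\<lambda>n. Lq_int q U (p (r n))) \<longlonglongrightarrow> 0"
      using LIMSEQ_subseq_LIMSEQ[OF p0 r] by (simp add: comp_def)
    from tendsto_mult_left[OF this, where c = "C powr q"]
    show "(\<lambda>n. C powr q * Lq_int q U (p (r n))) \<longlonglongrightarrow> 0" by simp
    show "0 \<le> Lq_int q U (\<lambda>x. F (u x) - F (w (r n) x))" for n by (rule Lq_int_nonneg)
    show "Lq_int q U (\<lambda>x. F (u x) - F (w (r n) x)) \<le> C powr q * Lq_int q U (p (r n))" for n
    proof (rule Lq_dominated(2)[OF q0(2) C_nonneg _ pL])
      show "(\<lambda>x. indicator U x *\<^sub>R (F (u x) - F (w (r n) x))) \<in> borel_measurable lebesgue"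
        using Lq_diff[OF q0(2) F_Lq[OF q uL] F_Lq[OF q wL[of "r n"]]] by (simp only: Lq_space_iff)
      show "norm (F (u x) - F (w (r n) x)) \<le> C * norm (p (r n) x)" for x
        unfolding p_def by (rule F_lipschitz)
    qed
  qed
  then have "(\<lambda>n. sobolev_norm q U (\<lambda>x. F (u x) - F (w (r n) x))) \<longlonglongrightarrow> 0 + (\<Sum>b\<in>(Basis :: 'a set). 0)"
    unfolding sobolev_norm_def by (intro tendsto_add tendsto_sum Gint)
  with r show ?thesis by auto
qed

text \<open>By contradiction: maps within 1/(n+1) of \<open>u\<close> whose images stay at distance
  at least \<open>e\<close> would keep that distance along the subsequence on which the images
  converge.\<close>

lemma sobolev_continuous:
  fixes u :: "'a::euclidean_space \<Rightarrow> 'v"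
  assumes q: "q \<ge> 1" and U: "open U" and u: "u \<in> sobolev q U" and e: "e > 0"
  shows "\<exists>d>0. \<forall>w\<in>sobolev q U. sobolev_norm q U (\<lambda>x. u x - w x) < d \<longrightarrow>
    sobolev_norm q U (\<lambda>x. F (u x) - F (w x)) < e"
proof (rule ccontr)
  assume "\<not> ?thesis"
  then have *: "\<exists>w\<in>sobolev q U. sobolev_norm q U (\<lambda>x. u x - w x) < d \<and>
    sobolev_norm q U (\<lambda>x. F (u x) - F (w x)) \<ge> e" if "d > 0" for d
    using that by (meson not_less)
  have "\<exists>w. \<forall>n. w n \<in> sobolev q U \<and> sobolev_norm q U (\<lambda>x. u x - w n x) < 1 / real (Suc n) \<and>
    sobolev_norm q U (\<lambda>x. F (u x) - F (w n x)) \<ge> e"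
    using *[of "1 / real (Suc _)"] by (intro choice) (auto simp del: of_nat_Suc)
  then obtain w where w: "\<And>n. w n \<in> sobolev q U" "\<And>n. sobolev_norm q U (\<lambda>x. u x - w n x) < 1 / real (Suc n)"
    "\<And>n. sobolev_norm q U (\<lambda>x. F (u x) - F (w n x)) \<ge> e" by blast
  have "(\<lambda>n. sobolev_norm q U (\<lambda>x. u x - w n x)) \<longlonglongrightarrow> 0"
  proof (rule tendsto_sandwich[OF eventuallyI eventuallyI tendsto_const])
    show "(\<lambda>n. 1 / real (Suc n)) \<longlonglongrightarrow> 0" using LIMSEQ_inverse_real_of_nat by (simp only: inverse_eq_divide)
    show "0 \<le> sobolev_norm q U (\<lambda>x. u x - w n x)" for n
      by (auto simp: sobolev_norm_def Lq_norm_def intro!: add_nonneg_nonneg sum_nonneg)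
    show "sobolev_norm q U (\<lambda>x. u x - w n x) \<le> 1 / real (Suc n)" for n using w(2)[of n] by (rule less_imp_le)
  qed
  from sobolev_norm_tendsto_subseq[OF q U u w(1) this] obtain r where
    "(\<lambda>n. sobolev_norm q U (\<lambda>x. F (u x) - F (w (r n) x))) \<longlonglongrightarrow> 0" by blast
  from LIMSEQ_le_const[OF this, of e] w(3) have "e \<le> 0" by blast
  with e show False by simp
qed

end

section \<open>Spectral theorem for normal matrices\<close>

text \<open>Conjugate-linear in the first argument; its real part is the Euclidean inner
  product.\<close>

definition cinner :: "complex ^ 'd \<Rightarrow> complex ^ 'd \<Rightarrow> complex" where
  "cinner x y = (\<Sum>i\<in>UNIV. cnj (x $ i) * y $ i)"

lemma cinner_add_right: "cinner x (y + z) = cinner x y + cinner x z"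
  by (simp add: cinner_def distrib_left sum.distrib)

lemma cinner_diff_right: "cinner x (y - z) = cinner x y - cinner x z"
  by (simp add: cinner_def right_diff_distrib sum_subtractf)

lemma cinner_diff_left: "cinner (x - y) z = cinner x z - cinner y z"
  by (simp add: cinner_def left_diff_distrib sum_subtractf)

lemma cinner_scale_right: "cinner x (c *s y) = c * cinner x y"
  by (simp add: cinner_def sum_distrib_left mult_ac)

lemma cinner_scale_left: "cinner (c *s x) y = cnj c * cinner x y"
  by (simp add: cinner_def sum_distrib_left mult_ac)

lemma cinner_zero_right [simp]: "cinner x 0 = 0"
  by (simp add: cinner_def)

lemma cnj_cinner: "cnj (cinner x y) = cinner y x"
  by (simp add: cinner_def mult.commute)

lemma cinner_self: "cinner x x = of_real ((norm x)\<^sup>2)"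
proof -
  have "(norm x)\<^sup>2 = (\<Sum>i\<in>UNIV. (cmod (x $ i))\<^sup>2)"
    by (simp add: norm_vec_def L2_set_def sum_nonneg)
  then show ?thesis by (simp add: cinner_def complex_norm_square mult.commute del: of_real_power)
qed

lemma cinner_adjoint: "cinner x (A *v y) = cinner (conj_transpose A *v x) y"
proof -
  have "cinner x (A *v y) = (\<Sum>i\<in>UNIV. \<Sum>j\<in>UNIV. cnj (x $ i) * A $ i $ j * y $ j)"
    by (simp add: cinner_def matrix_vector_mult_def sum_distrib_left mult_ac)
  also have "\<dots> = (\<Sum>j\<in>UNIV. \<Sum>i\<in>UNIV. cnj (x $ i) * A $ i $ j * y $ j)" by (rule sum.swap)
  also have "\<dots> = cinner (conj_transpose A *v x) y"
    by (simp add: cinner_def matrix_vector_mult_def conj_transpose_def sum_distrib_left mult_ac)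
  finally show ?thesis .
qed

lemma conj_transpose_conj_transpose [simp]: "conj_transpose (conj_transpose A) = A"
  by (simp add: conj_transpose_def vec_eq_iff)

lemma conj_transpose_mult: "conj_transpose (A ** B) = conj_transpose B ** conj_transpose A"
  by (simp add: conj_transpose_def matrix_matrix_mult_def vec_eq_iff mult.commute)

text \<open>Normality makes the images of \<open>x\<close> under \<open>A\<close> and under its
  adjoint equally long; with this, the squared norm of the defect \<open>?y\<close> expands to
  0.\<close>

lemma normal_adjoint_eigenvector:
  assumes A: "A \<in> Norm_mat" and x: "A *v x = c *s x"
  shows "conj_transpose A *v x = cnj c *s x"
proof -
  let ?B = "conj_transpose A"
  let ?y = "?B *v x - cnj c *s x"
  have "cinner (?B *v x) (?B *v x) = cinner x (A *v (?B *v x))"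
    using cinner_adjoint[of x A "?B *v x"] by simp
  also have "\<dots> = cinner x (?B *v (A *v x))"
    using A by (simp add: Norm_mat_def matrix_vector_mul_assoc)
  also have "\<dots> = cinner (A *v x) (A *v x)"
    using cinner_adjoint[of x ?B "A *v x"] by simp
  finally have 1: "cinner (?B *v x) (?B *v x) = cnj c * c * cinner x x"
    by (simp add: x cinner_scale_left cinner_scale_right)
  have 2: "cinner (?B *v x) x = c * cinner x x"
    using cinner_adjoint[of x A x] by (simp add: x cinner_scale_right)
  have 3: "cinner x (?B *v x) = cnj c * cinner x x"
    using cinner_adjoint[of x ?B x] by (simp add: x cinner_scale_left)
  have "cinner ?y ?y = 0"
    by (simp add: cinner_diff_left cinner_diff_right cinner_scale_left cinner_scale_right 1 2 3 algebra_simps)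
  then show ?thesis by (simp add: cinner_self)
qed

section \<open>Eigenvectors in invariant subspaces and orthonormal eigenbases\<close>

text \<open>One more iterate of \<open>w\<close> than the real dimension of the space forces a
  linear relation, with real coefficients. The bound \<open>K\<close> fixes a common summation range
  for all polynomials used afterwards.\<close>

lemma annihilating_poly:
  fixes A :: "complex ^ 'd ^ 'd"
  obtains p :: "complex poly" and K where "p \<noteq> 0" "degree p < K"
    "(\<Sum>i<K. coeff p i *s (((*v) A ^^ i) w)) = 0"
proof -
  define v where "v i = ((*v) A ^^ i) w" for i
  define K where "K = Suc (DIM(complex ^ 'd))"
  show ?thesis
  proof (cases "inj_on v {..<K}")
    case True
    have "\<not> independent (v ` {..<K})"
      using independent_bound[of "v ` {..<K}"] card_image[OF True] by (auto simp: K_def)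
    then obtain a where a: "\<exists>x\<in>v ` {..<K}. a x \<noteq> 0" "(\<Sum>x\<in>v ` {..<K}. a x *\<^sub>R x) = 0"
      using real_vector.dependent_finite[of "v ` {..<K}"] by auto
    define p :: "complex poly" where "p = Poly (map (\<lambda>i. of_real (a (v i))) [0..<K])"
    have c: "coeff p i = of_real (a (v i))" if "i < K" for i
      using that by (simp add: p_def nth_default_def)
    show ?thesis
    proof (rule that[of p K])
      show "p \<noteq> 0" using a(1) c by force
      have "coeff p i = 0" if "i \<ge> K" for i
        using that by (simp add: p_def nth_default_def)
      then show "degree p < K"
        using \<open>p \<noteq> 0\<close> by (meson leading_coeff_0_iff not_le)
      have "(\<Sum>i<K. coeff p i *s v i) = (\<Sum>i<K. a (v i) *\<^sub>R v i)"
      proof (intro sum.cong refl)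
        fix i assume "i \<in> {..<K}"
        then have "coeff p i = of_real (a (v i))" using c by simp
        then show "coeff p i *s v i = a (v i) *\<^sub>R v i"
          by (simp only: vec_eq_iff vector_smult_component vector_scaleR_component scaleR_conv_of_real[where 'a = complex] simp_thms)
      qed
      also have "\<dots> = 0" using a(2) by (simp add: sum.reindex[OF True])
      finally show "(\<Sum>i<K. coeff p i *s (((*v) A ^^ i) w)) = 0" by (simp add: v_def)
    qed
  next
    \<comment> \<open>A repeated iterate is invisible to linear independence of the set of iterates,
      so it is treated apart; its relation is X^i - X^j.\<close>
    case False
    then obtain i j where ij: "i < K" "j < K" "i \<noteq> j" "v i = v j" by (auto simp: inj_on_def)
    let ?p = "monom 1 i - monom 1 j :: complex poly"
    show ?thesis
    proof (rule that[of ?p K])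
      have "coeff ?p i = 1" using ij by simp
      then show "?p \<noteq> 0" by force
      have "degree ?p \<le> max i j"
        by (rule degree_diff_le) (auto intro: order.trans[OF degree_monom_le])
      then show "degree ?p < K" using ij by linarith
      have "(\<Sum>k<K. coeff ?p k *s v k) = (\<Sum>k<K. (if k = i then v k else 0) - (if k = j then v k else 0))"
        by (intro sum.cong) (auto simp: vec_eq_iff)
      also have "\<dots> = 0" using ij by (simp add: sum_subtractf)
      finally show "(\<Sum>k<K. coeff ?p k *s (((*v) A ^^ k) w)) = 0" by (simp add: v_def)
    qed
  qed
qed

text \<open>Take an annihilating polynomial of least degree for \<open>w\<close> and split off a
  root, p = (X - a) r. Then r(A) w is nonzero by minimality and is killed by A - a.\<close>

lemma eigenvector_in_invariant_subspace:
  fixes A :: "complex ^ 'd ^ 'd"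
  assumes add: "\<And>x y. x \<in> W \<Longrightarrow> y \<in> W \<Longrightarrow> x + y \<in> W"
    and scale: "\<And>c x. x \<in> W \<Longrightarrow> c *s x \<in> W"
    and inv: "\<And>x. x \<in> W \<Longrightarrow> A *v x \<in> W"
    and w: "w \<in> W" "w \<noteq> 0"
  obtains x c where "x \<in> W" "x \<noteq> 0" "A *v x = c *s x"
proof -
  define v where "v i = ((*v) A ^^ i) w" for i
  have v_Suc: "v (Suc i) = A *v v i" for i by (simp add: v_def)
  have vW: "v i \<in> W" for i by (induction i) (auto simp: v_def w inv)
  have "0 \<in> W" using scale[OF w(1), of 0] by simp
  then have sumW: "(\<Sum>i<K. coeff p i *s v i) \<in> W" for K :: nat and p
    by (induction K) (auto intro: add scale vW)
  obtain p0 :: "complex poly" and K where p0: "p0 \<noteq> 0" "degree p0 < K" "(\<Sum>i<K. coeff p0 i *s v i) = 0"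
    using annihilating_poly[of A w] unfolding v_def by metis
  define P where "P p \<longleftrightarrow> p \<noteq> 0 \<and> degree p < K \<and> (\<Sum>i<K. coeff p i *s v i) = 0" for p
  have "P p0" using p0 unfolding P_def by blast
  from ex_has_least_nat[of P, OF this, of degree]
  obtain p where p: "P p" and least: "\<And>r. P r \<Longrightarrow> degree p \<le> degree r" by blast
  have min: "\<not> P r" if "degree r < degree p" for r using least[of r] that by auto
  have "degree p \<noteq> 0"
  proof
    assume d: "degree p = 0"
    then obtain c where c: "p = [:c:]" by (metis degree_eq_zeroE)
    have "(\<Sum>i<K. coeff p i *s v i) = (\<Sum>i<K. if i = 0 then c *s w else 0)"
      unfolding c by (intro sum.cong) (auto simp: v_def coeff_pCons split: nat.splits)
    also have "\<dots> = c *s w" using p0(2) by simp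
    finally show False using p w(2) c by (auto simp: P_def)
  qed
  then have "\<not> constant (poly p)" by (simp add: constant_degree)
  then obtain a where "poly p a = 0" using fundamental_theorem_of_algebra by blast
  then obtain r where r: "p = [:- a, 1:] * r" by (auto simp: poly_eq_0_iff_dvd)
  have r0: "r \<noteq> 0" using p r by (auto simp: P_def)
  then have deg: "degree p = Suc (degree r)" unfolding r by (subst degree_mult_eq) auto
  define x where "x = (\<Sum>i<K. coeff r i *s v i)"
  have "x \<noteq> 0" using min[of r] deg r0 p by (auto simp: P_def x_def)
  moreover have "x \<in> W" unfolding x_def by (rule sumW)
  moreover have "A *v x = a *s x"
  proof -
    obtain K' where K': "K = Suc K'" using p0(2) by (cases K) auto
    \<comment> \<open>The last coefficient in the range vanishes, so multiplication by X stays
      within the first \<open>K\<close> coefficients.\<close>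
    have "coeff r K' = 0" using p deg K' by (intro coeff_eq_0) (simp add: P_def)
    then have xK': "x = (\<Sum>i<K'. coeff r i *s v i)" by (simp add: x_def K')
    have "A *v x = (\<Sum>i<K'. coeff r i *s v (Suc i))"
      unfolding xK' v_Suc
      by (induction K') (simp_all add: matrix_vector_right_distrib vector_scalar_commute)
    also have "\<dots> = (\<Sum>i<K. coeff (pCons 0 r) i *s v i)"
      unfolding K' by (subst sum.lessThan_Suc_shift) simp
    finally have Ax: "A *v x = (\<Sum>i<K. coeff (pCons 0 r) i *s v i)" .
    have "coeff p i = coeff (pCons 0 r) i - a * coeff r i" for i by (simp add: r)
    then have "(\<Sum>i<K. coeff p i *s v i) = (\<Sum>i<K. coeff (pCons 0 r) i *s v i) - (\<Sum>i<K. a *s (coeff r i *s v i))"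
      by (simp only: vec.scale_left_diff_distrib sum_subtractf vec.scale_scale)
    then have "A *v x - a *s x = (\<Sum>i<K. coeff p i *s v i)"
      unfolding Ax by (simp only: x_def vec.scale_sum_right)
    then show ?thesis using p by (simp add: P_def)
  qed
  ultimately show ?thesis using that by blast
qed

text \<open>The conditions for i in \<open>S\<close> are rows of a square matrix whose row
  \<open>j\<close> can be set to zero, so the matrix is singular.\<close>

lemma orthogonal_vector_exists:
  fixes e :: "'d::finite \<Rightarrow> complex ^ 'd"
  assumes "j \<notin> S"
  shows "\<exists>x. x \<noteq> 0 \<and> (\<forall>i\<in>S. cinner (e i) x = 0)"
proof -
  define M :: "complex ^ 'd ^ 'd" where "M = (\<chi> i. if i \<in> S then (\<chi> k. cnj (e i $ k)) else 0)"
  have "row j M = 0" using assms by (simp add: M_def row_def vec_eq_iff)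
  then have "det M = 0" by (rule det_zero_row)
  then have "\<not> invertible M" by (simp add: invertible_det_nz)
  then obtain x where x: "x \<noteq> 0" "M *v x = 0"
    by (auto simp: invertible_left_inverse matrix_left_invertible_ker)
  have "cinner (e i) x = 0" if "i \<in> S" for i
  proof -
    have "cinner (e i) x = (M *v x) $ i"
      using that by (simp add: M_def matrix_vector_mult_def cinner_def)
    then show ?thesis using x(2) by simp
  qed
  with x(1) show ?thesis by blast
qed

text \<open>Induction over the set of indices. The orthogonal complement of the eigenvectors found
  so far is invariant because they are also eigenvectors of the adjoint, so it contains a further
  eigenvector.\<close>

lemma normal_orthonormal_eigenvectors:
  fixes A :: "complex ^ 'd ^ 'd"
  assumes A: "A \<in> Norm_mat"
  shows "\<exists>e lam. (\<forall>i\<in>S. \<forall>j\<in>S. cinner (e i) (e j) = (if i = j then 1 else 0)) \<and>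
    (\<forall>i\<in>S. A *v e i = lam i *s e (i :: 'd))"
  using finite[of S]
proof (induction S rule: finite_induct)
  case empty
  then show ?case by simp
next
  case (insert j S)
  then obtain e lam where
    el: "(\<forall>i\<in>S. \<forall>j\<in>S. cinner (e i) (e j) = (if i = j then 1 else 0)) \<and> (\<forall>i\<in>S. A *v e i = lam i *s e i)"
    by blast
  have e: "cinner (e i) (e k) = (if i = k then 1 else 0)" if "i \<in> S" "k \<in> S" for i k
    using el that by blast
  have lam: "A *v e i = lam i *s e i" if "i \<in> S" for i using el that by blast
  define W where "W = {x. \<forall>i\<in>S. cinner (e i) x = 0}"
  obtain w where w: "w \<noteq> 0" "\<And>i. i \<in> S \<Longrightarrow> cinner (e i) w = 0"
    using orthogonal_vector_exists[OF insert(2), of e] by blast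
  have inv: "A *v x \<in> W" if "x \<in> W" for x
    using that by (auto simp: W_def cinner_adjoint normal_adjoint_eigenvector[OF A lam] cinner_scale_left)
  obtain x c where x: "x \<in> W" "x \<noteq> 0" "A *v x = c *s x"
    by (rule eigenvector_in_invariant_subspace[of W A w])
      (use inv w in \<open>auto simp: W_def cinner_add_right cinner_scale_right\<close>)
  define y where "y = of_real (1 / norm x) *s x"
  have yy: "cinner y y = 1"
    unfolding y_def cinner_scale_left cinner_scale_right
    using x(2) by (simp add: cinner_self[of x] power2_eq_square)
  have Ay: "A *v y = c *s y"
    unfolding y_def vector_scalar_commute x(3) by (rule vec.scale_left_commute)
  have ey: "cinner (e i) y = 0" "cinner y (e i) = 0" if "i \<in> S" for i
  proof -
    show "cinner (e i) y = 0" using x(1) that by (simp add: y_def W_def cinner_scale_right)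
    then show "cinner y (e i) = 0" using cnj_cinner[of "e i" y] by simp
  qed
  show ?case
    by (intro exI[of _ "e(j := y)"] exI[of _ "lam(j := c)"]) (use e lam ey yy Ay insert(2) in auto)
qed

section \<open>Unitary matrices and sorted diagonalization\<close>

lemma matrix_add_rdistrib: "(A + B) ** C = A ** C + B ** C"
  by (simp add: vec_eq_iff matrix_matrix_mult_def distrib_right sum.distrib)

lemma matrix_diff_ldistrib: "A ** (B - C) = A ** B - A ** (C :: 'a::ring_1 ^ 'n ^ 'm)"
  by (simp add: vec_eq_iff matrix_matrix_mult_def right_diff_distrib sum_subtractf)

lemma matrix_diff_rdistrib: "(A - B) ** C = A ** C - (B :: 'a::ring_1 ^ 'n ^ 'm) ** C"
  by (simp add: vec_eq_iff matrix_matrix_mult_def left_diff_distrib sum_subtractf)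

definition unitary :: "complex ^ 'd ^ 'd \<Rightarrow> bool" where
  "unitary Q \<longleftrightarrow> conj_transpose Q ** Q = mat 1"

definition diag :: "('d \<Rightarrow> 'a::zero) \<Rightarrow> 'a ^ 'd ^ 'd" where
  "diag lam = (\<chi> i j. if i = j then lam i else 0)"

lemma unitary_right: "unitary Q \<Longrightarrow> Q ** conj_transpose Q = mat 1"
  by (simp add: unitary_def matrix_left_right_inverse)

lemma unitary_conj_transpose_mult:
  assumes "unitary E" "unitary Q"
  shows "unitary (conj_transpose E ** Q)"
proof -
  have "conj_transpose (conj_transpose E ** Q) ** (conj_transpose E ** Q) =
      conj_transpose Q ** (E ** conj_transpose E) ** Q"
    by (simp add: conj_transpose_mult matrix_mul_assoc)
  then show ?thesis using assms by (simp add: unitary_right unitary_def)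
qed

lemma conj_transpose_mat_1 [simp]: "conj_transpose (mat 1) = mat 1"
  by (simp add: conj_transpose_def mat_def vec_eq_iff)

lemma unitary_mat_1: "unitary (mat 1)"
  by (simp add: unitary_def)

lemma unitary_column_sum:
  fixes Q :: "complex ^ 'd ^ 'd"
  assumes "unitary Q"
  shows "(\<Sum>k\<in>UNIV. (cmod (Q $ k $ i))\<^sup>2) = 1"
proof -
  have "complex_of_real (\<Sum>k\<in>UNIV. (cmod (Q $ k $ i))\<^sup>2) = (conj_transpose Q ** Q) $ i $ i"
    by (simp add: conj_transpose_def matrix_matrix_mult_def complex_norm_square mult.commute del: of_real_power)
  also have "\<dots> = 1" using assms by (simp add: unitary_def mat_def)
  finally show ?thesis by (metis of_real_eq_1_iff)
qed

lemma unitary_row_sum: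
  fixes Q :: "complex ^ 'd ^ 'd"
  assumes "unitary Q"
  shows "(\<Sum>i\<in>UNIV. (cmod (Q $ k $ i))\<^sup>2) = 1"
proof -
  have "complex_of_real (\<Sum>i\<in>UNIV. (cmod (Q $ k $ i))\<^sup>2) = (Q ** conj_transpose Q) $ k $ k"
    by (simp add: conj_transpose_def matrix_matrix_mult_def complex_norm_square del: of_real_power)
  also have "\<dots> = 1" using unitary_right[OF assms] by (simp add: mat_def)
  finally show ?thesis by (metis of_real_eq_1_iff)
qed

lemma unitary_entry_le:
  fixes Q :: "complex ^ 'd ^ 'd"
  assumes "unitary Q"
  shows "cmod (Q $ k $ i) \<le> 1"
proof -
  have "(cmod (Q $ k $ i))\<^sup>2 \<le> (\<Sum>k\<in>UNIV. (cmod (Q $ k $ i))\<^sup>2)"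
    by (rule member_le_sum) auto
  then show ?thesis using unitary_column_sum[OF assms, of i] by (simp add: power2_le_iff_abs_le abs_square_le_1)
qed

text \<open>Relabelling along a sorted list of the index type makes the eigenvalues increase with respect to
  \<open>\<mu>\<close> in the numbering used by \<^const>\<open>sorted_projection\<close>.\<close>

lemma sorting_permutation:
  fixes \<mu> :: "'d::finite \<Rightarrow> real"
  obtains \<pi> where "bij \<pi>"
    "\<And>i j. to_nat_on (UNIV :: 'd set) i \<le> to_nat_on UNIV j \<Longrightarrow> \<mu> (\<pi> i) \<le> \<mu> (\<pi> j)"
proof -
  let ?nat = "to_nat_on (UNIV :: 'd set)"
  have bn: "bij_betw ?nat UNIV {..<CARD('d)}" using to_nat_on_finite[of "UNIV :: 'd set"] by simp
  obtain ys :: "'d list" where ys: "set ys = UNIV" "distinct ys" using finite_distinct_list[OF finite] by blast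
  define xs where "xs = sort_key \<mu> ys"
  have xs: "set xs = UNIV" "distinct xs" "sorted (map \<mu> xs)" using ys by (auto simp: xs_def)
  then have len: "length xs = CARD('d)" using distinct_card by metis
  have "bij_betw ((!) xs) {..<CARD('d)} UNIV" using bij_betw_nth[OF xs(2), of "{..<CARD('d)}" UNIV] xs len by auto
  then have "bij ((!) xs \<circ> ?nat)" using bn bij_betw_trans by blast
  moreover have "\<mu> (((!) xs \<circ> ?nat) i) \<le> \<mu> (((!) xs \<circ> ?nat) j)" if "?nat i \<le> ?nat j" for i j
  proof -
    have "?nat j < length xs" using bn len by (auto simp: bij_betw_def)
    with sorted_nth_mono[OF xs(3) that] that show ?thesis by simp
  qed
  ultimately show ?thesis by (rule that)
qed

text \<open>The order by \<open>Re (\<theta> * lam i)\<close> depends on \<open>\<theta>\<close>, so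
  the eigenbasis is renumbered for each \<open>\<theta>\<close>.\<close>

lemma normal_diagonalization:
  fixes A :: "complex ^ 'd ^ 'd" and \<theta> :: complex
  assumes A: "A \<in> Norm_mat"
  obtains E lam where "unitary E" "A = E ** diag lam ** conj_transpose E"
    "\<And>i j. to_nat_on (UNIV :: 'd set) i \<le> to_nat_on UNIV j \<Longrightarrow> Re (\<theta> * lam i) \<le> Re (\<theta> * lam j)"
proof -
  obtain e lam where e: "\<And>i j. cinner (e i) (e j) = (if i = j then 1 else 0)"
    and lam: "\<And>i. A *v e i = lam i *s e (i :: 'd)"
    using normal_orthonormal_eigenvectors[OF A, of UNIV] by auto
  obtain \<pi> where \<pi>: "bij \<pi>"
    "\<And>i j. to_nat_on (UNIV :: 'd set) i \<le> to_nat_on UNIV j \<Longrightarrow> Re (\<theta> * lam (\<pi> i)) \<le> Re (\<theta> * lam (\<pi> j))"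
    using sorting_permutation[of "\<lambda>i. Re (\<theta> * lam i)"] by blast
  define E where "E = (\<chi> r i. e (\<pi> i) $ r)"
  have "(conj_transpose E ** E) $ i $ j = cinner (e (\<pi> i)) (e (\<pi> j))" for i j
    by (simp add: E_def conj_transpose_def matrix_matrix_mult_def cinner_def)
  then have E: "unitary E"
    using e bij_is_inj[OF \<pi>(1)] by (simp add: unitary_def vec_eq_iff mat_def inj_eq)
  have "A ** E = E ** diag (\<lambda>i. lam (\<pi> i))"
  proof -
    have "(A ** E) $ r $ i = (A *v e (\<pi> i)) $ r" for r i
      by (simp add: E_def matrix_matrix_mult_def matrix_vector_mult_def)
    then show ?thesis
      by (simp add: vec_eq_iff lam) (simp add: E_def diag_def matrix_matrix_mult_def if_distrib cong: if_cong)
  qed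
  then have "A = E ** diag (\<lambda>i. lam (\<pi> i)) ** conj_transpose E"
    using unitary_right[OF E] by (metis matrix_mul_assoc matrix_mul_rid)
  with E show ?thesis using \<pi>(2) that by blast
qed

section \<open>Eigenvalues of a normal matrix\<close>

definition const_mat :: "'a::comm_ring_1 ^ 'd ^ 'd \<Rightarrow> 'a poly ^ 'd ^ 'd" where
  "const_mat A = (\<chi> i j. [:A $ i $ j:])"

lemma const_mat_mult: "const_mat (A ** B) = const_mat A ** const_mat B"
proof -
  have "[:\<Sum>k\<in>S. f k:] = (\<Sum>k\<in>S. [:f k:])" for S :: "'b set" and f :: "'b \<Rightarrow> 'a"
  proof (induction S rule: infinite_finite_induct)
    case (insert x F)
    then show ?case by (simp add: insert.IH[symmetric])
  qed auto
  then show ?thesis by (simp add: const_mat_def matrix_matrix_mult_def vec_eq_iff mult.commute)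
qed

lemma const_mat_1: "const_mat (mat 1) = mat 1"
  by (simp add: const_mat_def mat_def vec_eq_iff one_pCons)

lemma mat_commute:
  fixes B :: "'a::comm_semiring_1 ^ 'd ^ 'd"
  shows "mat c ** B = B ** mat c"
  by (simp add: mat_def matrix_matrix_mult_def vec_eq_iff if_distrib if_distribR mult.commute cong: if_cong)

lemma charpoly_alt: "charpoly A = det (mat [:0, 1:] - const_mat A)"
  unfolding charpoly_def by (rule arg_cong[of _ _ det]) (simp add: vec_eq_iff mat_def const_mat_def)

text \<open>The similarity is carried out over polynomials: X times the identity is central there
  and \<open>det\<close> is multiplicative over a commutative ring, so the characteristic polynomial
  is that of the diagonal matrix.\<close>

lemma eigenvalues_similar_diag:
  fixes A :: "complex ^ 'd ^ 'd"
  assumes E: "unitary E" and A: "A = E ** diag lam ** conj_transpose E"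
  shows "eigenvalues A = image_mset lam (mset_set UNIV)"
proof -
  let ?X = "mat [:0, 1:] :: complex poly ^ 'd ^ 'd"
  let ?E = "const_mat E" and ?F = "const_mat (conj_transpose E)" and ?D = "const_mat (diag lam)"
  have EF: "?E ** ?F = mat 1"
    using unitary_right[OF E] by (simp add: const_mat_mult[symmetric] const_mat_1)
  have "?X - const_mat A = ?E ** (?X - ?D) ** ?F"
  proof -
    have "?E ** (?X - ?D) ** ?F = ?E ** ?X ** ?F - ?E ** ?D ** ?F"
      by (simp add: matrix_diff_ldistrib matrix_diff_rdistrib)
    also have "?E ** ?X ** ?F = ?X ** (?E ** ?F)" by (simp add: mat_commute matrix_mul_assoc)
    also have "?E ** ?D ** ?F = const_mat A" by (simp add: A const_mat_mult)
    finally show ?thesis by (simp add: EF)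
  qed
  then have "charpoly A = det ?E * det (?X - ?D) * det ?F"
    by (simp add: charpoly_alt det_mul)
  also have "\<dots> = det (?X - ?D) * det (?E ** ?F)" by (simp add: det_mul mult_ac)
  also have "\<dots> = det (?X - ?D)" by (simp add: EF)
  also have "\<dots> = (\<Prod>i\<in>UNIV. (?X - ?D) $ i $ i)"
    by (rule det_diagonal) (simp add: mat_def const_mat_def diag_def)
  also have "\<dots> = (\<Prod>i\<in>UNIV. [:- lam i, 1:])"
    by (simp add: mat_def const_mat_def diag_def)
  finally have "charpoly A = (\<Prod>i\<in>UNIV. [:- lam i, 1:])" .
  then have "eigenvalues A = (\<Sum>i\<in>UNIV. {#lam i#})"
    by (simp add: eigenvalues_def proots_prod)
  then show ?thesis by (simp add: sum_unfold_sum_mset)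
qed

section \<open>Partial sums of sorted eigenvalues\<close>

text \<open>Each functional is linear and obeys the same bound \<open>L\<close>, so convexity and
  the Lipschitz estimate pass to the supremum; at 0 all functionals vanish.\<close>

lemma convex_lipschitz_SUP:
  fixes l :: "'i \<Rightarrow> 'b::euclidean_space \<Rightarrow> real"
  assumes ne: "S \<noteq> {}" and lin: "\<And>i. i \<in> S \<Longrightarrow> linear (l i)"
    and bound: "\<And>i x. i \<in> S \<Longrightarrow> \<bar>l i x\<bar> \<le> L * norm x" and L: "L \<ge> 0"
  shows "convex_lipschitz (\<lambda>x. SUP i\<in>S. l i x) L"
proof
  have bdd: "bdd_above ((\<lambda>i. l i x) ` S)" for x
    using bound by (intro bdd_aboveI2[of _ _ "L * norm x"]) (auto simp: abs_le_iff)
  show "convex_on UNIV (\<lambda>x. SUP i\<in>S. l i x)"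
  proof (rule convex_onI)
    fix t :: real and x y :: 'b assume t: "0 < t" "t < 1"
    show "(SUP i\<in>S. l i ((1 - t) *\<^sub>R x + t *\<^sub>R y)) \<le> (1 - t) * (SUP i\<in>S. l i x) + t * (SUP i\<in>S. l i y)"
    proof (rule cSUP_least[OF ne])
      fix i assume i: "i \<in> S"
      have "l i ((1 - t) *\<^sub>R x + t *\<^sub>R y) = (1 - t) * l i x + t * l i y"
        using lin[OF i] by (simp add: linear_add linear_scale)
      also have "\<dots> \<le> (1 - t) * (SUP i\<in>S. l i x) + t * (SUP i\<in>S. l i y)"
        using t by (intro add_mono mult_left_mono cSUP_upper i bdd) auto
      finally show "l i ((1 - t) *\<^sub>R x + t *\<^sub>R y) \<le> (1 - t) * (SUP i\<in>S. l i x) + t * (SUP i\<in>S. l i y)" .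
    qed
  qed simp
  have le: "(SUP i\<in>S. l i x) \<le> (SUP i\<in>S. l i y) + L * norm (x - y)" for x y
  proof (rule cSUP_least[OF ne])
    fix i assume i: "i \<in> S"
    have "l i x = l i y + l i (x - y)" using lin[OF i] by (simp add: linear_diff)
    also have "\<dots> \<le> (SUP i\<in>S. l i y) + L * norm (x - y)"
      using bound[OF i, of "x - y"] by (intro add_mono cSUP_upper i bdd) auto
    finally show "l i x \<le> (SUP i\<in>S. l i y) + L * norm (x - y)" .
  qed
  show "\<bar>(SUP i\<in>S. l i x) - (SUP i\<in>S. l i y)\<bar> \<le> L * norm (x - y)" for x y
    using le[of x y] le[of y x] by (simp add: abs_le_iff norm_minus_commute)
  show "(SUP i\<in>S. l i 0) = 0"
    using ne lin by (simp add: linear_0 cong: SUP_cong)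
qed (rule L)

text \<open>Ky Fan: minus the sum of the \<open>n\<close> smallest values \<open>Re (\<theta> \<lambda>)\<close>, as a supremum of
  linear functionals over orthonormal bases.\<close>

definition frame_sum :: "complex \<Rightarrow> nat \<Rightarrow> complex ^ 'd ^ 'd \<Rightarrow> complex ^ 'd ^ 'd \<Rightarrow> real" where
  "frame_sum \<theta> n Q A = - Re (\<theta> * (\<Sum>i | to_nat_on (UNIV :: 'd set) i < n. (conj_transpose Q ** A ** Q) $ i $ i))"

definition ky_fan :: "complex \<Rightarrow> nat \<Rightarrow> complex ^ 'd ^ 'd \<Rightarrow> real" where
  "ky_fan \<theta> n A = (SUP Q\<in>{Q. unitary Q}. frame_sum \<theta> n Q A)"

lemma linear_frame_sum: "linear (frame_sum \<theta> n Q)"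
proof (rule linearI)
  fix A B
  show "frame_sum \<theta> n Q (A + B) = frame_sum \<theta> n Q A + frame_sum \<theta> n Q B"
    by (simp add: frame_sum_def matrix_add_ldistrib matrix_add_rdistrib sum.distrib distrib_left)
next
  fix c A
  have "conj_transpose Q ** (c *\<^sub>R A) ** Q = c *\<^sub>R (conj_transpose Q ** A ** Q)"
    by (simp add: vec_eq_iff matrix_matrix_mult_def scaleR_sum_right sum_distrib_left sum_distrib_right)
  then show "frame_sum \<theta> n Q (c *\<^sub>R A) = c *\<^sub>R frame_sum \<theta> n Q A"
    by (simp add: frame_sum_def scaleR_sum_right[symmetric] algebra_simps)
qed

text \<open>A crude count: at most d diagonal entries, each a sum of d^2 terms bounded by
  \<open>norm A\<close>, as the entries of a unitary matrix have modulus at most 1.\<close>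

lemma frame_sum_bound:
  fixes Q :: "complex ^ 'd ^ 'd"
  assumes Q: "unitary Q"
  shows "\<bar>frame_sum \<theta> n Q A\<bar> \<le> (cmod \<theta> * real (CARD('d)) ^ 3) * norm A"
proof -
  let ?T = "{i. to_nat_on (UNIV :: 'd set) i < n}"
  have entry: "cmod ((conj_transpose Q ** A ** Q) $ i $ i) \<le> real (CARD('d)) * (real (CARD('d)) * norm A)" for i
  proof -
    have "cmod ((conj_transpose Q ** A ** Q) $ i $ i) = cmod (\<Sum>s\<in>UNIV. \<Sum>r\<in>UNIV. cnj (Q $ r $ i) * A $ r $ s * Q $ s $ i)"
      by (simp add: matrix_matrix_mult_def conj_transpose_def sum_distrib_right)
    also have "\<dots> \<le> (\<Sum>s\<in>(UNIV::'d set). \<Sum>r\<in>(UNIV::'d set). norm A)"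
    proof (intro sum_norm_le)
      fix s r :: 'd
      have "cmod (A $ r $ s) \<le> norm A" using Finite_Cartesian_Product.norm_nth_le[of A r] Finite_Cartesian_Product.norm_nth_le[of "A $ r" s] by linarith
      then have "cmod (cnj (Q $ r $ i)) * cmod (A $ r $ s) * cmod (Q $ s $ i) \<le> 1 * norm A * 1"
        using unitary_entry_le[OF Q] by (intro mult_mono) auto
      then show "cmod (cnj (Q $ r $ i) * A $ r $ s * Q $ s $ i) \<le> norm A" by (simp add: norm_mult)
    qed
    finally show ?thesis by simp
  qed
  have "\<bar>frame_sum \<theta> n Q A\<bar> \<le> cmod (\<theta> * (\<Sum>i\<in>?T. (conj_transpose Q ** A ** Q) $ i $ i))"
    unfolding frame_sum_def by (simp only: abs_minus_cancel abs_Re_le_cmod)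
  also have "\<dots> = cmod \<theta> * cmod (\<Sum>i\<in>?T. (conj_transpose Q ** A ** Q) $ i $ i)" by (rule norm_mult)
  also have "\<dots> \<le> cmod \<theta> * (\<Sum>i\<in>?T. real (CARD('d)) * (real (CARD('d)) * norm A))"
    by (intro mult_left_mono sum_norm_le entry) auto
  also have "\<dots> \<le> cmod \<theta> * (\<Sum>i\<in>(UNIV :: 'd set). real (CARD('d)) * (real (CARD('d)) * norm A))"
    by (intro mult_left_mono sum_mono2) auto
  also have "\<dots> = (cmod \<theta> * real (CARD('d)) ^ 3) * norm A" by (simp add: power3_eq_cube)
  finally show ?thesis .
qed

lemma convex_lipschitz_ky_fan:
  "convex_lipschitz (ky_fan \<theta> n :: complex ^ 'd ^ 'd \<Rightarrow> real) (cmod \<theta> * real (CARD('d)) ^ 3)"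
  unfolding ky_fan_def
  by (rule convex_lipschitz_SUP) (use unitary_mat_1 linear_frame_sum frame_sum_bound in auto)

text \<open>Relative to the eigenbasis, an orthonormal frame distributes the chosen positions as
  weights \<open>p k\<close> in [0, 1] of total mass \<open>card ?T\<close>. The weighted sum of
  increasing numbers is least when the mass sits on the first positions, and the frame
  \<open>E\<close> attains this.\<close>

lemma ky_fan_normal:
  fixes A :: "complex ^ 'd ^ 'd"
  assumes E: "unitary E" and A: "A = E ** diag lam ** conj_transpose E"
    and sorted: "\<And>i j. to_nat_on (UNIV :: 'd set) i \<le> to_nat_on UNIV j \<Longrightarrow> Re (\<theta> * lam i) \<le> Re (\<theta> * lam j)"
  shows "ky_fan \<theta> n A = - (\<Sum>i | to_nat_on (UNIV :: 'd set) i < n. Re (\<theta> * lam i))"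
proof -
  let ?nat = "to_nat_on (UNIV :: 'd set)"
  let ?T = "{i. ?nat i < n}"
  define \<mu> where "\<mu> i = Re (\<theta> * lam i)" for i
  have eq: "conj_transpose Q ** A ** Q =
      conj_transpose (conj_transpose E ** Q) ** diag lam ** (conj_transpose E ** Q)" for Q
    by (simp add: A conj_transpose_mult matrix_mul_assoc)
  have entry: "(conj_transpose R ** diag lam ** R) $ i $ i = (\<Sum>k\<in>UNIV. of_real ((cmod (R $ k $ i))\<^sup>2) * lam k)" for R i
    by (simp add: matrix_matrix_mult_def conj_transpose_def diag_def if_distrib complex_norm_square mult_ac
        del: of_real_power cong: if_cong)
  have le: "frame_sum \<theta> n Q A \<le> - (\<Sum>i\<in>?T. \<mu> i)" if Q: "unitary Q" for Q
  proof -
    define R where "R = conj_transpose E ** Q"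
    have R: "unitary R" unfolding R_def by (rule unitary_conj_transpose_mult[OF E Q])
    define p where "p k = (\<Sum>i\<in>?T. (cmod (R $ k $ i))\<^sup>2)" for k
    have p0: "p k \<ge> 0" for k by (simp add: p_def sum_nonneg)
    have p1: "p k \<le> 1" for k
      unfolding p_def unitary_row_sum[OF R, of k, symmetric] by (rule sum_mono2) auto
    have psum: "(\<Sum>k\<in>UNIV. p k) = real (card ?T)"
      unfolding p_def by (subst sum.swap) (simp add: unitary_column_sum[OF R])
    have "\<theta> * (\<Sum>i\<in>?T. (conj_transpose Q ** A ** Q) $ i $ i) = (\<Sum>k\<in>UNIV. of_real (p k) * (\<theta> * lam k))"
      unfolding eq R_def[symmetric] entry p_def
      by (subst sum.swap) (simp add: sum_distrib_left sum_distrib_right mult_ac)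
    then have fs: "frame_sum \<theta> n Q A = - (\<Sum>k\<in>UNIV. p k * \<mu> k)"
      by (simp add: frame_sum_def \<mu>_def)
    have "(\<Sum>i\<in>?T. \<mu> i) \<le> (\<Sum>k\<in>UNIV. p k * \<mu> k)"
    proof -
      \<comment> \<open>\<open>m\<close> is a level separating the values inside \<open>?T\<close>
        from those outside; sortedness provides it, and the minimum of all values serves if
        \<open>?T\<close> is empty.\<close>
      obtain m where m: "\<And>i. i \<in> ?T \<Longrightarrow> \<mu> i \<le> m" "\<And>i. i \<notin> ?T \<Longrightarrow> m \<le> \<mu> i"
      proof (cases "?T = {}")
        case True
        have "Min (range \<mu>) \<le> \<mu> i" for i by simp
        then show ?thesis using that True by blast
      next
        case False
        have "\<mu> i \<le> Max (\<mu> ` ?T)" if "i \<in> ?T" for i using that by simp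
        moreover have "Max (\<mu> ` ?T) \<le> \<mu> j" if "j \<notin> ?T" for j
          using that False sorted[of _ j] by (subst Max_le_iff) (auto simp: \<mu>_def)
        ultimately show ?thesis using that by blast
      qed
      \<comment> \<open>The weights \<open>p\<close> and the indicator of \<open>?T\<close> have
        equal mass, so the constant \<open>m\<close> contributes 0. On \<open>?T\<close> both
        \<open>p k - 1\<close> and \<open>\<mu> k - m\<close> are at most 0, elsewhere both
        \<open>p k\<close> and \<open>\<mu> k - m\<close> are at least 0, which gives the termwise
        inequality.\<close>
      have "0 = (\<Sum>k\<in>UNIV. (p k - (if k \<in> ?T then 1 else 0)) * m)"
        by (simp add: sum_distrib_right[symmetric] sum_subtractf psum sum.If_cases)
      also have "\<dots> \<le> (\<Sum>k\<in>UNIV. (p k - (if k \<in> ?T then 1 else 0)) * \<mu> k)"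
      proof (rule sum_mono)
        fix k
        show "(p k - (if k \<in> ?T then 1 else 0)) * m \<le> (p k - (if k \<in> ?T then 1 else 0)) * \<mu> k"
        proof (cases "k \<in> ?T")
          case True
          then show ?thesis using m(1)[OF True] p1[of k] by (simp add: mult_left_mono_neg)
        next
          case False
          then show ?thesis using m(2)[OF False] p0[of k] by (simp add: mult_left_mono)
        qed
      qed
      also have "\<dots> = (\<Sum>k\<in>UNIV. p k * \<mu> k) - (\<Sum>k\<in>UNIV. if k \<in> ?T then \<mu> k else 0)"
        unfolding sum_subtractf[symmetric] by (intro sum.cong) (auto simp: left_diff_distrib)
      also have "(\<Sum>k\<in>UNIV. if k \<in> ?T then \<mu> k else 0) = (\<Sum>i\<in>?T. \<mu> i)"
        by (subst sum.inter_filter[symmetric]) auto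
      finally show ?thesis by simp
    qed
    then show ?thesis by (simp add: fs)
  qed
  have "frame_sum \<theta> n E A = - (\<Sum>i\<in>?T. \<mu> i)"
  proof -
    have "conj_transpose E ** A ** E = diag lam"
    proof -
      have "conj_transpose E ** E = mat 1" using E by (simp add: unitary_def)
      then show ?thesis unfolding eq by simp
    qed
    then show ?thesis by (simp add: frame_sum_def diag_def sum_distrib_left \<mu>_def)
  qed
  then show ?thesis
    unfolding ky_fan_def \<mu>_def[symmetric]
    by (intro cSup_eq_maximum) (use E le in \<open>auto intro!: image_eqI[of _ _ E]\<close>)
qed

text \<open>Consecutive Ky Fan sums differ by one eigenvalue. Positions count from 0, so the first
  sum stops just before position \<open>j\<close> and \<open>Suc\<close> includes it; the minus sign
  in \<open>ky_fan\<close> decides the order of the difference.\<close>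

lemma sorted_projection_normal:
  fixes A :: "complex ^ 'd ^ 'd"
  assumes A: "A \<in> Norm_mat"
  shows "sorted_projection \<theta> (eigenvalues A) $ j =
     ky_fan \<theta> (to_nat_on (UNIV :: 'd set) j) A - ky_fan \<theta> (Suc (to_nat_on (UNIV :: 'd set) j)) A"
proof -
  let ?nat = "to_nat_on (UNIV :: 'd set)"
  obtain E lam where E: "unitary E" "A = E ** diag lam ** conj_transpose E"
    and sorted: "\<And>i j. ?nat i \<le> ?nat j \<Longrightarrow> Re (\<theta> * lam i) \<le> Re (\<theta> * lam j)"
    using normal_diagonalization[OF A, of \<theta>] by blast
  define \<mu> where "\<mu> i = Re (\<theta> * lam i)" for i
  have bn: "bij_betw ?nat UNIV {..<CARD('d)}" using to_nat_on_finite[of "UNIV :: 'd set"] by simp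
  define inv where "inv = the_inv_into UNIV ?nat"
  have bi: "bij_betw inv {..<CARD('d)} UNIV" unfolding inv_def by (rule bij_betw_the_inv_into[OF bn])
  have inv: "inv (?nat i) = i" for i
    unfolding inv_def using bn by (simp add: the_inv_into_f_f bij_betw_def)
  have nat_inv: "?nat (inv k) = k" if "k < CARD('d)" for k
    unfolding inv_def using bn that by (intro f_the_inv_into_f) (auto simp: bij_betw_def)
  \<comment> \<open>Listing the values along the numbering gives an already sorted list, so sorting
    the multiset returns it unchanged and position \<open>?nat j\<close> holds
    \<open>\<mu> j\<close>.\<close>
  let ?L = "map (\<mu> \<circ> inv) [0..<CARD('d)]"
  have "image_mset (\<lambda>z. Re (\<theta> * z)) (eigenvalues A) = image_mset \<mu> (mset_set UNIV)"
    by (simp add: eigenvalues_similar_diag[OF E] multiset.map_comp comp_def \<mu>_def[abs_def])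
  also have "mset_set (UNIV :: 'd set) = image_mset inv (mset_set {..<CARD('d)})"
    using bi by (simp add: image_mset_mset_set bij_betw_def)
  also have "image_mset \<mu> \<dots> = mset ?L"
    by (simp add: multiset.map_comp lessThan_atLeast0)
  finally have "sorted_list_of_multiset (image_mset (\<lambda>z. Re (\<theta> * z)) (eigenvalues A)) = sort ?L"
    by (simp only: sorted_list_of_multiset_mset)
  also have "\<dots> = ?L"
  proof (rule sorted_sort_id)
    have "\<mu> (inv i) \<le> \<mu> (inv j)" if "i \<le> j" "j < CARD('d)" for i j
      unfolding \<mu>_def by (rule sorted) (use that nat_inv in auto)
    then show "sorted ?L" by (auto simp: sorted_iff_nth_mono)
  qed
  finally have "sorted_projection \<theta> (eigenvalues A) $ j = ?L ! ?nat j"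
    by (simp add: sorted_projection_def)
  also have "\<dots> = \<mu> j"
  proof -
    have "?nat j < CARD('d)" using bn by (auto simp: bij_betw_def)
    then show ?thesis by (simp add: inv)
  qed
  finally have L: "sorted_projection \<theta> (eigenvalues A) $ j = \<mu> j" .
  have "{i. ?nat i < Suc (?nat j)} = insert j {i. ?nat i < ?nat j}"
    using inv by (auto simp: less_Suc_eq)
  then have "(\<Sum>i | ?nat i < Suc (?nat j). \<mu> i) = \<mu> j + (\<Sum>i | ?nat i < ?nat j. \<mu> i)" by simp
  moreover have "ky_fan \<theta> n A = - (\<Sum>i | ?nat i < n. \<mu> i)" for n
    unfolding \<mu>_def by (rule ky_fan_normal[OF E]) (rule sorted)
  ultimately show ?thesis using L by simp
qed

section \<open>Continuity of the characteristic map\<close>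

theorem theorem1p8:
  fixes U :: "(real ^ 'm::finite) set"
    and q :: real
    and \<theta> :: "'h::finite \<Rightarrow> complex"
  assumes "1 \<le> q"
    and "open U" and "bounded U"
    and "almgren_family CARD('d::finite) \<theta>"
  shows "continuous_between
           (sobolev_Norm q U :: (real ^ 'm \<Rightarrow> complex ^ 'd ^ 'd) set)
           (\<lambda>A B. sobolev_norm q U (\<lambda>x. A x - B x))
           (sobolev_tuples (almgren \<theta> :: complex multiset \<Rightarrow> real ^ 'd ^ 'h) q U)
           (rho (almgren \<theta> :: complex multiset \<Rightarrow> real ^ 'd ^ 'h) q U)
           char_map"
proof -
  let ?\<Delta> = "almgren \<theta> :: complex multiset \<Rightarrow> real ^ 'd ^ 'h"
  let ?nat = "to_nat_on (UNIV :: 'd set)"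
  \<comment> \<open>The Boolean selects the two Ky Fan sums whose difference is coordinate (l, j):
    \<open>True\<close> the shorter one with positive coefficient, \<open>False\<close> the longer
    one with negative coefficient. The square root in \<open>c\<close> is the normalisation of
    \<open>almgren\<close>.\<close>
  define f :: "'h \<times> 'd \<times> bool \<Rightarrow> complex ^ 'd ^ 'd \<Rightarrow> real"
    where "f = (\<lambda>(l, j, s). ky_fan (\<theta> l) (if s then ?nat j else Suc (?nat j)))"
  define c :: "'h \<times> 'd \<times> bool \<Rightarrow> real ^ 'd ^ 'h"
    where "c = (\<lambda>(l, j, s). ((if s then 1 else - 1) / sqrt (real CARD('h))) *\<^sub>R axis l (axis j 1))"
  interpret dc_map UNIV f "\<lambda>(l, j, s). cmod (\<theta> l) * real (CARD('d)) ^ 3" c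
  proof (rule dc_map.intro)
    show "convex_lipschitz (f k) (case k of (l, j, s) \<Rightarrow> cmod (\<theta> l) * real (CARD('d)) ^ 3)" for k
      by (cases k) (simp add: f_def convex_lipschitz_ky_fan)
  qed simp
  \<comment> \<open>\<open>F\<close> is defined on all matrices, but it is identified with the
    spectral data only at normal ones.\<close>
  have eq: "F A = ?\<Delta> (eigenvalues A)" if A: "A \<in> Norm_mat" for A
  proof -
    have "F A $ l $ j = ?\<Delta> (eigenvalues A) $ l $ j" for l j
    proof -
      have "F A $ l $ j = (\<Sum>k\<in>UNIV. \<Sum>i\<in>UNIV. \<Sum>s\<in>UNIV. f (k, i, s) A * (c (k, i, s) $ l $ j))"
        by (simp add: F_def sum.cartesian_product UNIV_Times_UNIV split_beta)
      also have "\<dots> = (\<Sum>k\<in>UNIV. \<Sum>i\<in>UNIV. if i = j then if k = l then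
          (ky_fan (\<theta> l) (?nat j) A - ky_fan (\<theta> l) (Suc (?nat j)) A) / sqrt (real CARD('h)) else 0 else 0)"
        by (intro sum.cong) (auto simp: UNIV_bool f_def c_def axis_def diff_divide_distrib)
      also have "\<dots> = (ky_fan (\<theta> l) (?nat j) A - ky_fan (\<theta> l) (Suc (?nat j)) A) / sqrt (real CARD('h))"
        by simp
      also have "\<dots> = ?\<Delta> (eigenvalues A) $ l $ j"
        by (simp add: almgren_def sorted_projection_normal[OF A])
      finally show ?thesis .
    qed
    then show ?thesis by (simp add: vec_eq_iff)
  qed
  have size: "eigenvalues A \<in> unordered_tuples CARD('d)" if A: "A \<in> Norm_mat" for A :: "complex ^ 'd ^ 'd"
  proof -
    obtain E lam where "unitary E" "A = E ** diag lam ** conj_transpose E"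
      using normal_diagonalization[OF A] by metis
    from eigenvalues_similar_diag[OF this] show ?thesis by (simp add: unordered_tuples_def)
  qed
  show ?thesis
    unfolding continuous_between_def
  proof (intro conjI ballI allI impI)
    fix A :: "real ^ 'm \<Rightarrow> complex ^ 'd ^ 'd" assume "A \<in> sobolev_Norm q U"
    then have A: "A \<in> sobolev q U" "\<And>x. x \<in> U \<Longrightarrow> A x \<in> Norm_mat" by (auto simp: sobolev_Norm_def)
    \<comment> \<open>Off \<open>U\<close> the values of \<open>A\<close> need not be normal, so the
      two maps are compared on \<open>U\<close> only.\<close>
    have "F (A x) = (?\<Delta> \<circ> char_map A) x" if "x \<in> U" for x
      using A(2)[OF that] by (simp add: eq char_map_def)
    from sobolev_cong(1)[of U "\<lambda>x. F (A x)" "?\<Delta> \<circ> char_map A" q, OF this] have "?\<Delta> \<circ> char_map A \<in> sobolev q U"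
      using F_sobolev[OF assms(1,2) A(1)] by blast
    then show "char_map A \<in> sobolev_tuples ?\<Delta> q U"
      using A(2) size by (simp add: sobolev_tuples_def char_map_def)
    fix e :: real assume "e > 0"
    from sobolev_continuous[OF assms(1,2) A(1) this] obtain d where d: "d > 0"
      "\<And>B. B \<in> sobolev q U \<Longrightarrow> sobolev_norm q U (\<lambda>x. A x - B x) < d \<Longrightarrow> sobolev_norm q U (\<lambda>x. F (A x) - F (B x)) < e"
      by blast
    have "rho ?\<Delta> q U (char_map A) (char_map B) < e"
      if "B \<in> sobolev_Norm q U" "sobolev_norm q U (\<lambda>x. A x - B x) < d" for B
    proof -
      have B: "B \<in> sobolev q U" "\<And>x. x \<in> U \<Longrightarrow> B x \<in> Norm_mat" using that(1) by (auto simp: sobolev_Norm_def)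
      have "rho ?\<Delta> q U (char_map A) (char_map B) = sobolev_norm q U (\<lambda>x. F (A x) - F (B x))"
        unfolding rho_def using A(2) B(2) by (intro sobolev_cong(2)) (simp add: eq char_map_def)
      then show ?thesis using d(2)[OF B(1) that(2)] by simp
    qed
    then show "\<exists>d>0. \<forall>B\<in>sobolev_Norm q U. sobolev_norm q U (\<lambda>x. A x - B x) < d \<longrightarrow>
        rho ?\<Delta> q U (char_map A) (char_map B) < e"
      using d(1) by blast
  qed
qed

end
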